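(* Let $g:\mathbb{R}\to\mathbb{R}$ be continuous and increasing, and suppose that $G(x)=E_x\left[\int_0^\infty g(X_t)e^{-rt}\,dt\right]$ satisfies $|G(x)|<\infty$ for all $x\in\mathbb{R}$. Let $\kappa(x):=\frac1rE_0\left[g\left(x+\underline{X}'_{T'(r)}\right)\right]$, let $x^*(c)=\inf\{x\in\mathbb{R}:\kappa(x)\ge c\}$, and for $c\in\mathbb{R}$ let $$v(x,c)=\inf_{\tau\ge0}E_x\left[\int_0^\tau g(X_t)e^{-rt}\,dt+ce^{-r\tau}\right].$$ Then the value function satisfies $$G(x)-v(x,c)=\frac1rE_x\left[\left(g(X_{T(r)})-rc\right)\mathbb{I}_{[\overline{X}_{T(r)}\ge x^*(c)]}\right]=E_x\left[\int_0^\infty\sup_{0\le u\le t}\left(\kappa(X_u)-c\right)^+re^{-rt}\,dt\right].$$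
   Context: $X=(X_t)_{t\ge0}$ is a real-valued Lévy process with $X_0=x$ under $P_x$ ($x\in\mathbb{R}$), $E_x$ denotes expectation under $P_x$, and $r>0$ is a constant. The infimum defining $v$ is over stopping times $\tau$ of the natural filtration of $X$, which may take the value $+\infty$ (with $e^{-r\tau}=0$ there). $X'$ is an independent copy of $X$; $T(r)$ and $T'(r)$ are independent exponentially distributed random variables with parameter $r$, independent of $X$ and $X'$. $\overline{X}_t=\sup_{0\le s\le t}X_s$, and $\underline{X}'_t=\inf_{0\le s\le t}X'_s$ (with $X'_0=0$ under $P_0$). $y^+=\max(y,0)$ and $\mathbb{I}$ denotes an indicator. *)

theory Defs
  imports "HOL-Probability.Probability"
begin

section \<open>Levy processes\<close>

definition cadlag :: "(real \<Rightarrow> real) \<Rightarrow> bool" where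
  "cadlag f \<longleftrightarrow>
     (\<forall>t\<ge>0. (f \<longlongrightarrow> f t) (at_right t)) \<and> (\<forall>t>0. \<exists>l. (f \<longlongrightarrow> l) (at_left t))"

definition path :: "real set \<Rightarrow> (real \<Rightarrow> 'a \<Rightarrow> real) \<Rightarrow> 'a \<Rightarrow> real \<Rightarrow> real" where
  "path I X \<omega> = (\<lambda>s\<in>I. X s \<omega>)"

abbreviation path_space :: "real set \<Rightarrow> (real \<Rightarrow> real) measure" where
  "path_space I \<equiv> Pi\<^sub>M I (\<lambda>_. borel)"

abbreviation path_law :: "'a measure \<Rightarrow> (real \<Rightarrow> 'a \<Rightarrow> real) \<Rightarrow> (real \<Rightarrow> real) measure" where
  "path_law M X \<equiv> distr M (path_space {0..}) (path {0..} X)"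

text \<open>
  The library's \<open>indep_var\<close> forces both variables to have the same value type, which paths and
  reals do not; this is its unfolding without that restriction.
\<close>

definition indep_rv ::
  "'a measure \<Rightarrow> 'b measure \<Rightarrow> ('a \<Rightarrow> 'b) \<Rightarrow> 'c measure \<Rightarrow> ('a \<Rightarrow> 'c) \<Rightarrow> bool" where
  "indep_rv M N Y N' Z \<longleftrightarrow>
     Y \<in> measurable M N \<and> Z \<in> measurable M N' \<and>
     prob_space.indep_set M {Y -` A \<inter> space M |A. A \<in> sets N} {Z -` B \<inter> space M |B. B \<in> sets N'}"

text \<open>
  Time is \<open>[0, \<infinity>)\<close>; the values \<open>X t\<close> for \<open>t < 0\<close> are never used.
  All paths, not merely almost all, are cadlag, as on the canonical space; since measure spaces
  need not be complete, this is what makes running extrema and time integrals measurable.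
\<close>

definition levy_process :: "'a measure \<Rightarrow> real \<Rightarrow> (real \<Rightarrow> 'a \<Rightarrow> real) \<Rightarrow> bool" where
  "levy_process M x X \<longleftrightarrow>
     prob_space M \<and>
     (\<forall>t\<ge>0. X t \<in> borel_measurable M) \<and>
     (AE \<omega> in M. X 0 \<omega> = x) \<and>
     (\<forall>\<omega>\<in>space M. cadlag (\<lambda>t. X t \<omega>)) \<and>
     (\<forall>s t. 0 \<le> s \<and> s \<le> t \<longrightarrow>
        distr M borel (\<lambda>\<omega>. X t \<omega> - X s \<omega>) = distr M borel (\<lambda>\<omega>. X (t - s) \<omega> - X 0 \<omega>)) \<and>
     (\<forall>s t. 0 \<le> s \<and> s \<le> t \<longrightarrow>
        indep_rv M borel (\<lambda>\<omega>. X t \<omega> - X s \<omega>) (path_space {0..s}) (path {0..s} X))"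

text \<open>
  The measures \<open>P x\<close> live on one measurable space; under \<open>P x\<close> the process starts at \<open>x\<close> and
  has the law of \<open>x + X\<close> under \<open>P 0\<close>, so that all \<open>P x\<close> describe the same Levy process.
\<close>

definition levy_family :: "(real \<Rightarrow> 'a measure) \<Rightarrow> (real \<Rightarrow> 'a \<Rightarrow> real) \<Rightarrow> bool" where
  "levy_family P X \<longleftrightarrow>
     (\<forall>x. sets (P x) = sets (P 0)) \<and>
     (\<forall>x. levy_process (P x) x X) \<and>
     (\<forall>x. path_law (P x) X = path_law (P 0) (\<lambda>t \<omega>. x + X t \<omega>))"

definition independent_copy ::
  "'a measure \<Rightarrow> (real \<Rightarrow> 'a \<Rightarrow> real) \<Rightarrow> (real \<Rightarrow> 'a \<Rightarrow> real) \<Rightarrow> bool" where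
  "independent_copy M X X' \<longleftrightarrow>
     (\<forall>t\<ge>0. X' t \<in> borel_measurable M) \<and>
     (\<forall>\<omega>\<in>space M. cadlag (\<lambda>t. X' t \<omega>)) \<and>
     path_law M X' = path_law M X \<and>
     indep_rv M (path_space {0..}) (path {0..} X) (path_space {0..}) (path {0..} X')"

text \<open>
  Nonnegativity is required everywhere because \<open>X (T \<omega>) \<omega>\<close> has no meaning for \<open>T \<omega> < 0\<close>.
\<close>

definition exponential_time :: "'a measure \<Rightarrow> real \<Rightarrow> ('a \<Rightarrow> real) \<Rightarrow> bool" where
  "exponential_time M r T \<longleftrightarrow>
     (\<forall>\<omega>\<in>space M. 0 \<le> T \<omega>) \<and> distributed M lborel T (exponential_density r)"

text \<open>
  Together with independence of \<open>X\<close> and \<open>X'\<close>, the two independence requirements below say that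
  \<open>X, X', T, T'\<close> are mutually independent.
\<close>

definition independent_exponential_times ::
  "'a measure \<Rightarrow> real \<Rightarrow> (real \<Rightarrow> 'a \<Rightarrow> real) \<Rightarrow> (real \<Rightarrow> 'a \<Rightarrow> real) \<Rightarrow> ('a \<Rightarrow> real) \<Rightarrow> ('a \<Rightarrow> real) \<Rightarrow> bool"
  where
  "independent_exponential_times M r X X' T T' \<longleftrightarrow>
     exponential_time M r T \<and> exponential_time M r T' \<and>
     indep_rv M borel T borel T' \<and>
     indep_rv M
       (path_space {0..} \<Otimes>\<^sub>M path_space {0..}) (\<lambda>\<omega>. (path {0..} X \<omega>, path {0..} X' \<omega>))
       (borel \<Otimes>\<^sub>M borel) (\<lambda>\<omega>. (T \<omega>, T' \<omega>))"

definition running_sup :: "(real \<Rightarrow> 'a \<Rightarrow> real) \<Rightarrow> real \<Rightarrow> 'a \<Rightarrow> real" where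
  "running_sup X t \<omega> = (SUP s\<in>{0..t}. X s \<omega>)"

definition running_inf :: "(real \<Rightarrow> 'a \<Rightarrow> real) \<Rightarrow> real \<Rightarrow> 'a \<Rightarrow> real" where
  "running_inf X t \<omega> = (INF s\<in>{0..t}. X s \<omega>)"

section \<open>The stopping problem\<close>

text \<open>
  Indexing the filtration by \<^typ>\<open>ennreal\<close> lets the library's stopping times take the value
  \<open>\<infinity>\<close>; the condition at the index \<open>\<infinity>\<close> is vacuous.
\<close>

definition natural_filtration ::
  "'a set \<Rightarrow> (real \<Rightarrow> 'a \<Rightarrow> real) \<Rightarrow> ennreal \<Rightarrow> 'a measure" where
  "natural_filtration \<Omega> X t =
     sigma \<Omega> {X s -` B \<inter> \<Omega> |s B. 0 \<le> s \<and> ennreal s \<le> t \<and> B \<in> sets borel}"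

definition discount :: "real \<Rightarrow> ennreal \<Rightarrow> real" where
  "discount r \<tau> = (if \<tau> = \<infinity> then 0 else exp (- r * enn2real \<tau>))"

definition running_cost ::
  "(real \<Rightarrow> real) \<Rightarrow> real \<Rightarrow> (real \<Rightarrow> 'a \<Rightarrow> real) \<Rightarrow> ennreal \<Rightarrow> 'a \<Rightarrow> real" where
  "running_cost g r X \<tau> \<omega> =
     (LBINT t:{t. 0 \<le> t \<and> ennreal t \<le> \<tau>}. g (X t \<omega>) * exp (- r * t))"

text \<open>
  Finiteness of the resolvent in the Lebesgue sense: the defining double integral converges
  absolutely.
\<close>

definition resolvent_finite ::
  "(real \<Rightarrow> 'a measure) \<Rightarrow> (real \<Rightarrow> 'a \<Rightarrow> real) \<Rightarrow> real \<Rightarrow> (real \<Rightarrow> real) \<Rightarrow> real \<Rightarrow> bool" where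
  "resolvent_finite P X r g x \<longleftrightarrow>
     integrable (P x \<Otimes>\<^sub>M lborel)
       (\<lambda>(\<omega>, t). indicator {0..} t * (g (X t \<omega>) * exp (- r * t)))"

definition resolvent ::
  "(real \<Rightarrow> 'a measure) \<Rightarrow> (real \<Rightarrow> 'a \<Rightarrow> real) \<Rightarrow> real \<Rightarrow> (real \<Rightarrow> real) \<Rightarrow> real \<Rightarrow> real" where
  "resolvent P X r g x = (\<integral>\<omega>. running_cost g r X \<infinity> \<omega> \<partial>P x)"

text \<open>
  For the \<open>g\<close> with finite resolvent, the expected costs are bounded below by
  \<open>- E\<^sub>x [\<integral> \<bar>g (X\<^sub>t)\<bar> e\<^sup>-\<^sup>r\<^sup>t dt] - \<bar>c\<bar>\<close>, so the real infimum is the true one.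
\<close>

definition stopping_value ::
  "(real \<Rightarrow> 'a measure) \<Rightarrow> (real \<Rightarrow> 'a \<Rightarrow> real) \<Rightarrow> real \<Rightarrow> (real \<Rightarrow> real) \<Rightarrow> real \<Rightarrow> real \<Rightarrow> real" where
  "stopping_value P X r g x c =
     (INF \<tau>\<in>{\<tau>. stopping_time (natural_filtration (space (P x)) X) \<tau>}.
        \<integral>\<omega>. running_cost g r X (\<tau> \<omega>) \<omega> + c * discount r (\<tau> \<omega>) \<partial>P x)"

definition kappa ::
  "(real \<Rightarrow> 'a measure) \<Rightarrow> (real \<Rightarrow> 'a \<Rightarrow> real) \<Rightarrow> ('a \<Rightarrow> real) \<Rightarrow> real \<Rightarrow> (real \<Rightarrow> real) \<Rightarrow> real \<Rightarrow> real" where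
  "kappa P X' T' r g x = 1 / r * (\<integral>\<omega>. g (x + running_inf X' (T' \<omega>) \<omega>) \<partial>P 0)"

text \<open>The level set may be empty or all of the real line, whence the extended infimum.\<close>

definition threshold :: "(real \<Rightarrow> real) \<Rightarrow> real \<Rightarrow> ereal" where
  "threshold k c = (INF x\<in>{x. k x \<ge> c}. ereal x)"

end

theory Submission
  imports Defs
begin

text \<open>
  Put \<open>h = g - r c\<close>, and let \<open>T\<close> be an exponential time with rate \<open>r\<close> that is independent of \<open>X\<close>.
  Since \<open>c e\<^sup>-\<^sup>r\<^sup>\<tau>\<close> is \<open>c\<close> minus a discounted running cost at the constant rate \<open>r c\<close>, stopping at
  \<open>\<tau>\<close> instead of never lowers the expected cost by \<open>1/r\<close> times \<open>E\<^sub>x [h(X\<^sub>T); T > \<tau>]\<close>. Hence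
  \<open>G(x) - v(x, c)\<close> is the supremum of these gains over all stopping times (\<open>expected_cost\<close>), and
  the claim is that it equals \<open>V(x) = E\<^sub>x [(\<kappa>(M\<^sub>T) - c)\<^sup>+]\<close>, where \<open>M\<close> is the running maximum of \<open>X\<close>.

  The link between \<open>h\<close> and \<open>\<kappa>\<close> is the Wiener--Hopf factorisation (\<open>wiener_hopf\<close>): the rise
  \<open>S = M\<^sub>T - X\<^sub>0\<close> and the drawdown \<open>D = M\<^sub>T - X\<^sub>T\<close> are independent, and \<open>-D\<close> is distributed like
  the infimum in the definition of \<open>\<kappa>\<close>. Therefore \<open>r \<kappa>(y) = E [g(y - D)]\<close>, and conditioning on \<open>S\<close>
  gives \<open>E\<^sub>x [h(X\<^sub>T)] = r E [\<kappa>(x + S) - c]\<close>. This is at most \<open>r V(x)\<close>; as \<open>\<kappa>\<close> is increasing and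
  \<open>S \<ge> 0\<close>, it is equal to \<open>r V(x)\<close> if \<open>\<kappa>(x) \<ge> c\<close>. The same conditioning turns the middle expression
  of the theorem into \<open>V(x)\<close> because, \<open>\<kappa>\<close> being continuous, \<open>M\<^sub>T \<ge> x\<^sup>*(c)\<close> means \<open>\<kappa>(M\<^sub>T) \<ge> c\<close>. The
  last expression is \<open>V(x)\<close> because an increasing continuous function commutes with the supremum.

  By the Markov property (\<open>markov\<close>) and the lack of memory of \<open>T\<close>, the comparison can be restarted
  at any time \<open>s\<close>: for an event \<open>A\<close> that is known at time \<open>s\<close>, \<open>E\<^sub>x [h(X\<^sub>T); A, T > s]\<close> is at most
  \<open>r E\<^sub>x [(\<kappa>(sup\<^bsub>[s,T]\<^esub> X) - c)\<^sup>+; A, T > s]\<close>, with equality if \<open>\<kappa>(X\<^sub>s) \<ge> c\<close> on \<open>A\<close>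
  (\<open>gain_after_le\<close>, \<open>gain_after_eq\<close>). Summing over the values of a stopping time with values in a
  dyadic grid shows that its gain is at most \<open>V(x)\<close>, and approximation from the right extends this
  to every stopping time (\<open>gain_beyond_le\<close>). Conversely, stop at the first point of the grid where
  \<open>\<kappa>(X) > c\<close>. Then equality holds in each summand, and the gain is at least the expected excess of
  \<open>\<kappa>\<close> over \<open>c\<close> at the maximum of \<open>X\<close> over the grid points before \<open>T\<close>; this tends to \<open>V(x)\<close> as the
  mesh tends to zero (\<open>gain_beyond_grid_entry_ge\<close>, \<open>grid_excess_lower\<close>).

  The factorisation itself is inherited from random walks. For the walk \<open>X\<close> on a dyadic grid the
  joint law of maximum and drawdown after \<open>k\<close> steps is a convolution over the time of the maximum
  (\<open>split_at_maximum\<close>). Mixing over a geometric number of steps turns the convolution into a Cauchy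
  product of two series, that is, into independence (\<open>wiener_hopf_grid\<close>); right continuity of the
  paths carries it to the limit.
\<close>

section \<open>Cadlag paths on dyadic grids\<close>

definition grid :: "nat \<Rightarrow> nat \<Rightarrow> real" where
  "grid n k = real k / 2 ^ n"

text \<open>
  The grid point \<open>grid n (cell n t)\<close> is the first one at or to the right of \<open>t\<close>, so right-continuous
  paths can be evaluated along these points.
\<close>

definition cell :: "nat \<Rightarrow> real \<Rightarrow> nat" where
  "cell n t = nat \<lceil>t * 2 ^ n\<rceil>"

definition grid_max :: "(real \<Rightarrow> real) \<Rightarrow> nat \<Rightarrow> nat \<Rightarrow> real" where
  "grid_max p n k = (MAX j\<in>{..k}. p (grid n j))"

text \<open>
  For cadlag paths these two functionals are the value and the supremum up to time \<open>t\<close>. Being limits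
  of countably many coordinates, they are jointly measurable in the path and the time on the whole
  product space, where evaluation and suprema over intervals are not.
\<close>

definition path_val :: "(real \<Rightarrow> real) \<Rightarrow> real \<Rightarrow> real" where
  "path_val p t = lim (\<lambda>n. p (grid n (cell n t)))"

definition path_sup :: "(real \<Rightarrow> real) \<Rightarrow> real \<Rightarrow> real" where
  "path_sup p t = lim (\<lambda>n. grid_max p n (cell n t))"

lemma grid_nonneg [simp]: "0 \<le> grid n k"
  by (simp add: grid_def)

lemma grid_0 [simp]: "grid n 0 = 0"
  by (simp add: grid_def)

lemma grid_le_iff: "grid n j \<le> grid n k \<longleftrightarrow> j \<le> k"
  by (simp add: grid_def divide_le_cancel)

lemma grid_add: "grid n (j + k) = grid n j + grid n k"
  by (simp add: grid_def add_divide_distrib)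

lemma le_grid_iff: "t \<le> grid n k \<longleftrightarrow> cell n t \<le> k"
proof -
  have "t \<le> grid n k \<longleftrightarrow> t * 2 ^ n \<le> real k"
    by (simp add: grid_def field_simps)
  also have "\<dots> \<longleftrightarrow> cell n t \<le> k"
    by (auto simp: cell_def nat_le_iff ceiling_le_iff)
  finally show ?thesis .
qed

lemma grid_less_cell_iff: "grid n k < t \<longleftrightarrow> k < cell n t"
  using le_grid_iff[of t n k] by linarith

lemma le_grid_cell: "t \<le> grid n (cell n t)"
  by (simp add: le_grid_iff)

lemma grid_cell_less:
  assumes "0 \<le> t" shows "grid n (cell n t) < t + 1 / 2 ^ n"
proof (cases "cell n t")
  case 0
  then show ?thesis using assms by (simp add: add_nonneg_pos)
next
  case (Suc k)
  then have "grid n k < t" by (simp add: grid_less_cell_iff)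
  then show ?thesis by (simp add: Suc grid_def add_divide_distrib)
qed

lemma cell_mono: "s \<le> t \<Longrightarrow> cell n s \<le> cell n t"
  using le_grid_iff[of s n "cell n t"] le_grid_cell[of t n] by linarith

lemma grid_cell_tendsto:
  assumes "0 \<le> t" shows "(\<lambda>n. grid n (cell n t)) \<longlonglongrightarrow> t"
proof (rule tendsto_sandwich)
  show "(\<lambda>n. t) \<longlonglongrightarrow> t" by simp
  have "(\<lambda>n. t + (1 / 2) ^ n) \<longlonglongrightarrow> t + 0"
    by (intro tendsto_add tendsto_const LIMSEQ_power_zero) simp
  then show "(\<lambda>n. t + 1 / 2 ^ n) \<longlonglongrightarrow> t" by (simp add: power_divide)
qed (use assms in \<open>auto intro!: always_eventually le_grid_cell less_imp_le[OF grid_cell_less]\<close>)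

lemma measurable_cell [measurable]: "cell n \<in> measurable borel (count_space UNIV)"
  unfolding cell_def[abs_def] by measurable

lemma cadlag_right_sequence:
  assumes "cadlag p" "0 \<le> t" "u \<longlonglongrightarrow> t" "\<And>n. t \<le> u n"
  shows "(\<lambda>n. p (u n)) \<longlonglongrightarrow> p t"
proof -
  have "(p \<longlongrightarrow> p t) (at t within {t..})"
    using assms(1,2) by (simp add: cadlag_def at_within_Ici_at_right)
  then have "continuous (at t within {t..}) p"
    by (simp add: continuous_within)
  then show ?thesis
    by (rule continuous_within_tendsto_compose') (use assms in auto)
qed

lemma cadlag_grid_cell_tendsto:
  assumes "cadlag p" "0 \<le> t"
  shows "(\<lambda>n. p (grid n (cell n t))) \<longlonglongrightarrow> p t"
  by (rule cadlag_right_sequence[OF assms grid_cell_tendsto[OF assms(2)] le_grid_cell])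

lemma path_val_cadlag:
  assumes "cadlag p" "0 \<le> t" shows "path_val p t = p t"
  unfolding path_val_def using cadlag_grid_cell_tendsto[OF assms] by (rule limI)

text \<open>
  One-sided limits make the path locally bounded, and compactness does the rest. Without this the
  running suprema of reals would carry no information.
\<close>

lemma cadlag_bounded:
  assumes p: "cadlag p" shows "bounded (p ` {0..t})"
proof -
  have loc: "\<exists>e>0. bounded (p ` (ball s e \<inter> {0..t}))" if s: "s \<in> {0..t}" for s
  proof -
    have ev_bounded: "\<exists>B. eventually (\<lambda>u. \<bar>p u\<bar> \<le> B) F" if "(p \<longlongrightarrow> l) F" for F l
    proof -
      have "eventually (\<lambda>u. dist (p u) l < 1) F"
        using that by (rule tendstoD) simp
      then have "eventually (\<lambda>u. \<bar>p u\<bar> \<le> \<bar>l\<bar> + 1) F"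
        by (rule eventually_mono) (auto simp: dist_real_def)
      then show ?thesis by blast
    qed
    have "(p \<longlongrightarrow> p s) (at_right s)" using p s by (auto simp: cadlag_def)
    from ev_bounded[OF this] obtain B where "eventually (\<lambda>u. \<bar>p u\<bar> \<le> B) (at_right s)" by blast
    then obtain b where b: "b > s" "\<And>u. s < u \<Longrightarrow> u < b \<Longrightarrow> \<bar>p u\<bar> \<le> B"
      unfolding eventually_at_right_field by blast
    obtain a A where a: "a < s" "\<And>u. a < u \<Longrightarrow> u < s \<Longrightarrow> 0 \<le> u \<Longrightarrow> \<bar>p u\<bar> \<le> A"
    proof (cases "s = 0")
      case True
      then show ?thesis using that[of "-1" 0] by simp
    next
      case False
      then have "0 < s" using s by simp
      then obtain l where "(p \<longlongrightarrow> l) (at_left s)" using p unfolding cadlag_def by blast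
      from ev_bounded[OF this] obtain A where "eventually (\<lambda>u. \<bar>p u\<bar> \<le> A) (at_left s)" by blast
      then show ?thesis using that[of _ A] unfolding eventually_at_left_field by blast
    qed
    have "\<bar>p u\<bar> \<le> max (max A B) \<bar>p s\<bar>" if "u \<in> ball s (min (b - s) (s - a)) \<inter> {0..t}" for u
      using that a(2)[of u] b(2)[of u]
      by (cases u s rule: linorder_cases) (auto simp: dist_real_def abs_if split: if_splits)
    then have "bounded (p ` (ball s (min (b - s) (s - a)) \<inter> {0..t}))"
      unfolding bounded_iff by (intro exI[of _ "max (max A B) \<bar>p s\<bar>"] ballI) (auto simp del: mem_ball max.bounded_iff)
    then show ?thesis using a(1) b(1) by (intro exI[of _ "min (b - s) (s - a)"]) auto
  qed
  then obtain e where e: "\<And>s. s \<in> {0..t} \<Longrightarrow> 0 < e s \<and> bounded (p ` (ball s (e s) \<inter> {0..t}))"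
    by metis
  have "{0..t} \<subseteq> (\<Union>s\<in>{0..t}. ball s (e s))" using e by fastforce
  then obtain C where C: "C \<subseteq> {0..t}" "finite C" "{0..t} \<subseteq> (\<Union>s\<in>C. ball s (e s))"
    by (rule compactE_image[rotated 2]) auto
  have "bounded (\<Union>s\<in>C. p ` (ball s (e s) \<inter> {0..t}))"
    using C(1,2) e by (intro bounded_UN) auto
  moreover have "p ` {0..t} \<subseteq> (\<Union>s\<in>C. p ` (ball s (e s) \<inter> {0..t}))" using C(3) by blast
  ultimately show ?thesis by (rule bounded_subset)
qed

lemma cadlag_bdd_above: "cadlag p \<Longrightarrow> bdd_above (p ` {0..t})"
  by (intro bounded_imp_bdd_above cadlag_bounded)

lemma cadlag_minus:
  assumes "cadlag p" shows "cadlag (\<lambda>t. - p t)"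
  using assms unfolding cadlag_def by (blast intro: tendsto_minus)

lemma cadlag_increment:
  assumes p: "cadlag p" and s: "0 \<le> s"
  shows "cadlag (\<lambda>t. p (s + t) - a)"
proof -
  have R: "filterlim (\<lambda>u. s + u) (at_right (s + t)) (at_right t)"
    and L: "filterlim (\<lambda>u. s + u) (at_left (s + t)) (at_left t)" for t
    unfolding filterlim_at by (auto intro!: tendsto_intros simp: eventually_at_filter)
  show ?thesis
    unfolding cadlag_def
  proof (intro conjI allI impI)
    fix t :: real assume "0 \<le> t"
    then have "(p \<longlongrightarrow> p (s + t)) (at_right (s + t))" using p s by (simp add: cadlag_def)
    then show "((\<lambda>t. p (s + t) - a) \<longlongrightarrow> p (s + t) - a) (at_right t)"
      by (intro tendsto_diff tendsto_const filterlim_compose[OF _ R])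
  next
    fix t :: real assume "0 < t"
    then obtain l where "(p \<longlongrightarrow> l) (at_left (s + t))" using p s by (force simp: cadlag_def)
    then have "((\<lambda>t. p (s + t) - a) \<longlongrightarrow> l - a) (at_left t)"
      by (intro tendsto_diff tendsto_const filterlim_compose[OF _ L])
    then show "\<exists>l. ((\<lambda>t. p (s + t) - a) \<longlongrightarrow> l) (at_left t)" by blast
  qed
qed

lemma grid_max_ge: "j \<le> k \<Longrightarrow> p (grid n j) \<le> grid_max p n k"
  by (auto simp: grid_max_def intro: Max_ge)

lemma grid_max_less_iff: "grid_max p n k < a \<longleftrightarrow> (\<forall>j\<le>k. p (grid n j) < a)"
  unfolding grid_max_def by (subst Max_less_iff) auto

text \<open>
  A value above \<open>a\<close> at a time \<open>s\<close> persists at the grid points just to the right of \<open>s\<close>; conversely,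
  the grid overshoots \<open>t\<close> by less than a mesh, where the path is close to its value at \<open>t\<close>.
\<close>

lemma grid_max_tendsto:
  assumes p: "cadlag p" and t: "0 \<le> t"
  shows "(\<lambda>n. grid_max p n (cell n t)) \<longlonglongrightarrow> (SUP s\<in>{0..t}. p s)"
proof (rule order_tendstoI)
  fix a assume "a < (SUP s\<in>{0..t}. p s)"
  then obtain s where s: "0 \<le> s" "s \<le> t" "a < p s"
    using t cadlag_bdd_above[OF p] by (subst (asm) less_cSUP_iff) auto
  have "eventually (\<lambda>n. a < p (grid n (cell n s))) sequentially"
    using cadlag_grid_cell_tendsto[OF p s(1)] s(3) by (rule order_tendstoD)
  then show "eventually (\<lambda>n. a < grid_max p n (cell n t)) sequentially"
    by (rule eventually_mono)
       (use grid_max_ge[OF cell_mono[OF s(2)], of p] in \<open>blast intro: less_le_trans\<close>)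
next
  fix b assume b: "(SUP s\<in>{0..t}. p s) < b"
  have le: "p s < b" if "s \<in> {0..t}" for s
    using cSUP_upper[OF that cadlag_bdd_above[OF p]] b by linarith
  have "(p \<longlongrightarrow> p t) (at_right t)" using p t by (simp add: cadlag_def)
  then have "eventually (\<lambda>u. p u < b) (at_right t)"
    using le[of t] t by (intro order_tendstoD(2)) auto
  then obtain d where d: "d > t" "\<And>u. t < u \<Longrightarrow> u < d \<Longrightarrow> p u < b"
    unfolding eventually_at_right_field by blast
  have "eventually (\<lambda>n. grid n (cell n t) < d) sequentially"
    using grid_cell_tendsto[OF t] d(1) by (rule order_tendstoD)
  then show "eventually (\<lambda>n. grid_max p n (cell n t) < b) sequentially"
  proof (rule eventually_mono)
    fix n assume n: "grid n (cell n t) < d"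
    have "p (grid n j) < b" if "j \<le> cell n t" for j
    proof (cases "grid n j \<le> t")
      case True then show ?thesis by (intro le) auto
    next
      case False
      moreover have "grid n j \<le> grid n (cell n t)" using that by (simp add: grid_le_iff)
      ultimately show ?thesis using n by (intro d(2)) auto
    qed
    then show "grid_max p n (cell n t) < b" by (simp add: grid_max_less_iff)
  qed
qed

lemma path_sup_cadlag:
  assumes "cadlag p" "0 \<le> t" shows "path_sup p t = (SUP s\<in>{0..t}. p s)"
  unfolding path_sup_def using grid_max_tendsto[OF assms] by (rule limI)

lemma measurable_grid_max:
  assumes "\<And>j. j \<le> k \<Longrightarrow> (\<lambda>x. p x (grid n j)) \<in> borel_measurable M"
  shows "(\<lambda>x. grid_max (p x) n k) \<in> borel_measurable M"
  unfolding grid_max_def using assms by (intro borel_measurable_Max) auto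

lemma measurable_path_val:
  assumes p: "\<And>s. 0 \<le> s \<Longrightarrow> (\<lambda>x. p x s) \<in> borel_measurable M"
    and t: "t \<in> borel_measurable M"
  shows "(\<lambda>x. path_val (p x) (t x)) \<in> borel_measurable M"
proof -
  have [measurable]: "(\<lambda>x. p x (grid n j)) \<in> borel_measurable M" for n j by (intro p) simp
  have "(\<lambda>x. p x (grid n (cell n (t x)))) \<in> borel_measurable M" for n
    by (rule measurable_compose_countable[where f="\<lambda>k x. p x (grid n k)"]) (use t in measurable)
  then show ?thesis unfolding path_val_def by measurable
qed

lemma measurable_path_sup:
  assumes p: "\<And>s. 0 \<le> s \<Longrightarrow> (\<lambda>x. p x s) \<in> borel_measurable M"
    and t: "t \<in> borel_measurable M"
  shows "(\<lambda>x. path_sup (p x) (t x)) \<in> borel_measurable M"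
proof -
  have [measurable]: "(\<lambda>x. grid_max (p x) n k) \<in> borel_measurable M" for n k
    by (intro measurable_grid_max p) simp
  have "(\<lambda>x. grid_max (p x) n (cell n (t x))) \<in> borel_measurable M" for n
    by (rule measurable_compose_countable[where f="\<lambda>k x. grid_max (p x) n k"]) (use t in measurable)
  then show ?thesis unfolding path_sup_def by measurable
qed

lemma path_val_path: "path_val (path {0..} X \<omega>) t = path_val (\<lambda>s. X s \<omega>) t"
  by (simp add: path_val_def path_def)

lemma path_sup_path: "path_sup (path {0..} X \<omega>) t = path_sup (\<lambda>s. X s \<omega>) t"
  by (simp add: path_sup_def path_def grid_max_def)

section \<open>The Markov property of a Levy process\<close>

lemma distr_pair_indep:
  assumes M: "prob_space M" and indep: "indep_rv M N Y N' Z"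
  shows "distr M (N \<Otimes>\<^sub>M N') (\<lambda>\<omega>. (Y \<omega>, Z \<omega>)) = distr M N Y \<Otimes>\<^sub>M distr M N' Z"
    (is "?J = ?Y \<Otimes>\<^sub>M ?Z")
proof (rule pair_measure_eqI[symmetric])
  interpret prob_space M by fact
  have Y [measurable]: "Y \<in> measurable M N" and Z [measurable]: "Z \<in> measurable M N'"
    and YZ: "indep_set {Y -` A \<inter> space M |A. A \<in> sets N} {Z -` B \<inter> space M |B. B \<in> sets N'}"
    using indep by (auto simp: indep_rv_def)
  interpret Y: prob_space "?Y" by (rule prob_space_distr) simp
  interpret Z: prob_space "?Z" by (rule prob_space_distr) simp
  show "sigma_finite_measure ?Y" "sigma_finite_measure ?Z"
    by unfold_locales
  show "sets (?Y \<Otimes>\<^sub>M ?Z) = sets ?J"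
    by (simp cong: sets_pair_measure_cong)
  fix A B assume "A \<in> sets ?Y" "B \<in> sets ?Z"
  then have AB [measurable]: "A \<in> sets N" "B \<in> sets N'" by auto
  have "prob ((Y -` A \<inter> space M) \<inter> (Z -` B \<inter> space M)) =
      prob (Y -` A \<inter> space M) * prob (Z -` B \<inter> space M)"
    by (rule indep_setD[OF YZ]) (use AB in auto)
  moreover have "(\<lambda>\<omega>. (Y \<omega>, Z \<omega>)) -` (A \<times> B) \<inter> space M = (Y -` A \<inter> space M) \<inter> (Z -` B \<inter> space M)"
    by auto
  ultimately show "emeasure ?Y A * emeasure ?Z B =
      emeasure ?J (A \<times> B)"
    by (simp add: emeasure_distr emeasure_eq_measure ennreal_mult)
qed

locale levy_measures =
  fixes P :: "real \<Rightarrow> 'a measure" and X :: "real \<Rightarrow> 'a \<Rightarrow> real"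
  assumes family: "levy_family P X"
begin

abbreviation F :: "real \<Rightarrow> 'a measure" where
  "F s \<equiv> natural_filtration (space (P 0)) X (ennreal s)"

abbreviation shift_path :: "real \<Rightarrow> 'a \<Rightarrow> real \<Rightarrow> real" where
  "shift_path s \<equiv> path {0..} (\<lambda>t \<omega>. X (s + t) \<omega> - X s \<omega>)"

definition increment_law :: "real \<Rightarrow> real measure" where
  "increment_law d = distr (P 0) borel (\<lambda>\<omega>. X d \<omega> - X 0 \<omega>)"

lemma sets_P: "sets (P x) = sets (P 0)"
  using family by (auto simp: levy_family_def)

lemma space_P: "space (P x) = space (P 0)"
  by (rule sets_eq_imp_space_eq[OF sets_P])

lemma levy: "levy_process (P x) x X"
  using family by (auto simp: levy_family_def)

sublocale prob_space "P x" for x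
  using levy by (auto simp: levy_process_def)

lemma measurable_X: "0 \<le> t \<Longrightarrow> X t \<in> borel_measurable (P x)"
  using levy by (auto simp: levy_process_def)

lemma start: "AE \<omega> in P x. X 0 \<omega> = x"
  using levy by (auto simp: levy_process_def)

lemma cadlag_X: "\<omega> \<in> space (P x) \<Longrightarrow> cadlag (\<lambda>t. X t \<omega>)"
  using levy by (auto simp: levy_process_def)

lemma measurable_path [measurable]: "path {0..} X \<in> measurable (P x) (path_space {0..})"
  unfolding path_def by (intro measurable_restrict measurable_X) auto

lemma measurable_shift_path:
  "0 \<le> s \<Longrightarrow> shift_path s \<in> measurable (P x) (path_space {0..})"
  unfolding path_def by (intro measurable_restrict borel_measurable_diff measurable_X) auto

text \<open>
  The laws of the increments depend neither on the starting point nor on the starting time: all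
  the path laws are translates of each other.
\<close>

lemma increment_law:
  assumes s: "0 \<le> s" "s \<le> t"
  shows "distr (P x) borel (\<lambda>\<omega>. X t \<omega> - X s \<omega>) = increment_law (t - s)"
proof -
  define d where "d = t - s"
  have d: "0 \<le> d" using s by (simp add: d_def)
  have [measurable]: "(\<lambda>p. p d - p 0) \<in> borel_measurable (path_space {0..})"
    using d by (intro borel_measurable_diff measurable_component_singleton) auto
  have [measurable]: "path {0..} (\<lambda>t \<omega>. x + X t \<omega>) \<in> measurable (P 0) (path_space {0..})"
    unfolding path_def by (intro measurable_restrict borel_measurable_add measurable_X) auto
  have "distr (P x) borel (\<lambda>\<omega>. X t \<omega> - X s \<omega>) = distr (P x) borel (\<lambda>\<omega>. X d \<omega> - X 0 \<omega>)"
    using levy[of x, unfolded levy_process_def] s unfolding d_def by blast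
  also have "\<dots> = distr (path_law (P x) X) borel (\<lambda>p. p d - p 0)"
    using d by (simp add: distr_distr o_def path_def)
  also have "path_law (P x) X = path_law (P 0) (\<lambda>t \<omega>. x + X t \<omega>)"
    using family by (simp add: levy_family_def)
  also have "distr \<dots> borel (\<lambda>p. p d - p 0) = increment_law d"
    using d by (simp add: distr_distr o_def path_def increment_law_def)
  finally show ?thesis by (simp add: d_def)
qed

lemma prob_space_increment_law: "0 \<le> d \<Longrightarrow> prob_space (increment_law d)"
  unfolding increment_law_def by (intro prob_space_distr borel_measurable_diff measurable_X) auto

lemma sets_increment_law [simp, measurable_cong]: "sets (increment_law d) = sets borel"
  by (simp add: increment_law_def)

lemma space_increment_law [simp]: "space (increment_law d) = UNIV"
  by (simp add: increment_law_def)

lemma space_natural_filtration: "space (natural_filtration \<Omega> X u) = \<Omega>"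
  unfolding natural_filtration_def by (rule space_measure_of) auto

lemma sets_natural_filtration: "sets (natural_filtration \<Omega> X u) =
    sigma_sets \<Omega> {X s -` B \<inter> \<Omega> |s B. 0 \<le> s \<and> ennreal s \<le> u \<and> B \<in> sets borel}"
  unfolding natural_filtration_def by (rule sets_measure_of) auto

lemma filtration_mono:
  "u \<le> v \<Longrightarrow> sets (natural_filtration \<Omega> X u) \<subseteq> sets (natural_filtration \<Omega> X v)"
  unfolding sets_natural_filtration by (rule sigma_sets_mono') (blast intro: order.trans[of _ u v])

lemma filtration_events:
  "sets (natural_filtration (space (P 0)) X u) \<subseteq> sets (P x)"
proof -
  have "X s -` B \<inter> space (P 0) \<in> sets (P 0)" if "0 \<le> s" "B \<in> sets borel" for s B
    using measurable_X[OF that(1)] that(2) by (rule measurable_sets)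
  then show ?thesis
    unfolding sets_natural_filtration sets_P[of x] by (intro sets.sigma_sets_subset) blast
qed

lemma measurable_filtration_mono:
  assumes "W \<in> measurable (natural_filtration \<Omega> X u) N" "u \<le> v"
  shows "W \<in> measurable (natural_filtration \<Omega> X v) N"
  by (rule measurable_from_subalg[OF _ assms(1)])
     (simp add: subalgebra_def space_natural_filtration filtration_mono[OF assms(2)])

lemma measurable_filtration:
  "W \<in> measurable (F s) N \<Longrightarrow> W \<in> measurable (P x) N"
  by (rule measurable_from_subalg[of _ "F s"])
     (simp add: subalgebra_def space_natural_filtration space_P[of x] filtration_events)

lemma adapted:
  assumes "0 \<le> u" "u \<le> s" shows "X u \<in> borel_measurable (F s)"
proof (rule measurableI)
  fix B :: "real set" assume "B \<in> sets borel"
  then have "X u -` B \<inter> space (P 0) \<in> sets (F s)"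
    unfolding sets_natural_filtration using assms ennreal_leI[OF assms(2)]
    by (intro sigma_sets.Basic) blast
  then show "X u -` B \<inter> space (F s) \<in> sets (F s)" by (simp add: space_natural_filtration)
qed simp

text \<open>
  The independence of increments is stated relative to the path up to time \<open>s\<close>, the stopping times
  relative to the natural filtration; this lemma passes from the second to the first.
\<close>

lemma filtration_path_event:
  assumes A: "A \<in> sets (F s)" and s: "0 \<le> s"
  shows "\<exists>B \<in> sets (path_space {0..s}). A = path {0..s} X -` B \<inter> space (P 0)"
proof -
  let ?V = "vimage_algebra (space (P 0)) (path {0..s} X) (path_space {0..s})"
  have V: "sets ?V = {path {0..s} X -` B \<inter> space (P 0) |B. B \<in> sets (path_space {0..s})}"
    by (intro sets_vimage_algebra2) (auto simp: space_PiM path_def)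
  have "X u -` B \<inter> space (P 0) \<in> sets ?V"
    if u: "0 \<le> u" "ennreal u \<le> ennreal s" and B: "B \<in> sets borel" for u B
  proof -
    have us: "u \<in> {0..s}" using u s by (simp add: ennreal_le_iff)
    then have "(\<lambda>p. p u) -` B \<inter> space (path_space {0..s}) \<in> sets (path_space {0..s})"
      using B by (intro measurable_sets[OF measurable_component_singleton]) auto
    moreover have "X u -` B \<inter> space (P 0) =
        path {0..s} X -` ((\<lambda>p. p u) -` B \<inter> space (path_space {0..s})) \<inter> space (P 0)"
      using us by (auto simp: space_PiM path_def)
    ultimately show ?thesis unfolding V by blast
  qed
  then have "sets (F s) \<subseteq> sets ?V"
    using sets.sigma_sets_subset[of "{X u -` B \<inter> space (P 0) |u B. 0 \<le> u \<and> ennreal u \<le> ennreal s \<and> B \<in> sets borel}" ?V]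
    unfolding sets_natural_filtration by (simp, blast)
  then show ?thesis using A unfolding V by blast
qed

lemma indep_increment:
  assumes W: "W \<in> measurable (F s) N" and s: "0 \<le> s" "s \<le> t"
  shows "indep_rv (P x) N W borel (\<lambda>\<omega>. X t \<omega> - X s \<omega>)"
proof -
  have I: "indep_set x {(\<lambda>\<omega>. X t \<omega> - X s \<omega>) -` A \<inter> space (P x) |A. A \<in> sets borel}
      {path {0..s} X -` B \<inter> space (P x) |B. B \<in> sets (path_space {0..s})}"
    using levy[of x, unfolded levy_process_def indep_rv_def] s by blast
  have W': "W \<in> measurable (P x) N" by (rule measurable_filtration[OF W])
  have inc: "(\<lambda>\<omega>. X t \<omega> - X s \<omega>) \<in> borel_measurable (P x)"
    using s by (intro borel_measurable_diff measurable_X) auto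
  have "indep_set x {W -` A \<inter> space (P x) |A. A \<in> sets N}
      {(\<lambda>\<omega>. X t \<omega> - X s \<omega>) -` B \<inter> space (P x) |B. B \<in> sets borel}"
  proof (rule indep_setI)
    show "{W -` A \<inter> space (P x) |A. A \<in> sets N} \<subseteq> events x"
      using W' by (auto intro: measurable_sets)
    show "{(\<lambda>\<omega>. X t \<omega> - X s \<omega>) -` B \<inter> space (P x) |B. B \<in> sets borel} \<subseteq> events x"
      using inc by (auto intro: measurable_sets)
    fix a b assume "a \<in> {W -` A \<inter> space (P x) |A. A \<in> sets N}"
      and b: "b \<in> {(\<lambda>\<omega>. X t \<omega> - X s \<omega>) -` B \<inter> space (P x) |B. B \<in> sets borel}"
    then have "a \<in> sets (F s)"
      using measurable_sets[OF W] by (auto simp: space_natural_filtration space_P[of x])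
    from filtration_path_event[OF this s(1)]
    have "a \<in> {path {0..s} X -` B \<inter> space (P x) |B. B \<in> sets (path_space {0..s})}"
      by (auto simp: space_P[of x])
    from indep_setD[OF I b this] show "prob x (a \<inter> b) = prob x a * prob x b"
      by (simp add: Int_commute mult.commute)
  qed
  then show ?thesis using W' inc by (simp add: indep_rv_def)
qed

lemma distr_increment:
  assumes W: "W \<in> measurable (F s) N" and s: "0 \<le> s" "s \<le> t"
  shows "distr (P x) (N \<Otimes>\<^sub>M borel) (\<lambda>\<omega>. (W \<omega>, X t \<omega> - X s \<omega>)) =
    distr (P x) N W \<Otimes>\<^sub>M increment_law (t - s)"
  using distr_pair_indep[OF prob_space_axioms indep_increment[OF assms]] increment_law[OF s]
  by simp

lemma nn_integral_increment:
  assumes W: "W \<in> measurable (F s) N" and s: "0 \<le> s" "s \<le> t"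
    and f [measurable]: "f \<in> borel_measurable (N \<Otimes>\<^sub>M borel)"
  shows "(\<integral>\<^sup>+\<omega>. f (W \<omega>, X t \<omega> - X s \<omega>) \<partial>P x) =
    (\<integral>\<^sup>+\<omega>. \<integral>\<^sup>+z. f (W \<omega>, z) \<partial>increment_law (t - s) \<partial>P x)"
proof -
  have [measurable]: "W \<in> measurable (P x) N" by (rule measurable_filtration[OF W])
  have [measurable]: "(\<lambda>\<omega>. X t \<omega> - X s \<omega>) \<in> borel_measurable (P x)"
    using s by (intro borel_measurable_diff measurable_X) auto
  interpret I: prob_space "increment_law (t - s)" using s by (intro prob_space_increment_law) auto
  have [measurable]: "f \<in> borel_measurable (N \<Otimes>\<^sub>M increment_law (t - s))"
    by (simp cong: measurable_cong_sets sets_pair_measure_cong)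
  have "(\<integral>\<^sup>+\<omega>. f (W \<omega>, X t \<omega> - X s \<omega>) \<partial>P x) =
      (\<integral>\<^sup>+y. f y \<partial>distr (P x) (N \<Otimes>\<^sub>M borel) (\<lambda>\<omega>. (W \<omega>, X t \<omega> - X s \<omega>)))"
    by (simp add: nn_integral_distr)
  also have "\<dots> = (\<integral>\<^sup>+w. \<integral>\<^sup>+z. f (w, z) \<partial>increment_law (t - s) \<partial>distr (P x) N W)"
    unfolding distr_increment[OF W s] by (subst I.nn_integral_fst[symmetric]) simp_all
  also have "\<dots> = (\<integral>\<^sup>+\<omega>. \<integral>\<^sup>+z. f (W \<omega>, z) \<partial>increment_law (t - s) \<partial>P x)"
    by (subst nn_integral_distr) (simp_all)
  finally show ?thesis .
qed

text \<open>
  The probability that, starting from \<open>y\<close> at time \<open>u\<close>, the process lies in \<open>B t\<close> at each of the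
  listed later times \<open>t\<close>, written as an iterated integral over the increments.
\<close>

primrec cylinder :: "(real \<Rightarrow> real set) \<Rightarrow> real list \<Rightarrow> real \<Rightarrow> real \<Rightarrow> ennreal" where
  "cylinder B [] u y = 1"
| "cylinder B (t # ts) u y =
    (\<integral>\<^sup>+z. indicator (B t) (y + z) * cylinder B ts t (y + z) \<partial>increment_law (t - u))"

lemma measurable_cylinder:
  assumes "sorted (u # ts)" "\<And>t. t \<in> set ts \<Longrightarrow> B t \<in> sets borel"
  shows "cylinder B ts u \<in> borel_measurable borel"
  using assms
proof (induction ts arbitrary: u)
  case (Cons t ts)
  interpret I: prob_space "increment_law (t - u)" using Cons.prems by (intro prob_space_increment_law) auto
  have [measurable]: "cylinder B ts t \<in> borel_measurable borel" "B t \<in> sets borel"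
    using Cons by auto
  show ?case by simp
next
  case Nil
  have "cylinder B [] u = (\<lambda>_. 1)" by (simp add: fun_eq_iff)
  then show ?case by simp
qed

text \<open>
  Induction along the list. The first factor is absorbed into the event \<open>A\<close> and the first increment
  into the starting position \<open>Y\<close>; both are known at the next time, where the induction hypothesis
  applies. This is why the lemma allows an arbitrary known event and a random starting position.
\<close>

lemma nn_integral_cylinder:
  assumes "sorted (u # ts)" "0 \<le> u" "0 \<le> s" "\<And>t. t \<in> set ts \<Longrightarrow> B t \<in> sets borel"
    and "A \<in> sets (F (s + u))" "Y \<in> borel_measurable (F (s + u))"
  shows "(\<integral>\<^sup>+\<omega>. indicator A \<omega> *
      (\<Prod>t\<leftarrow>ts. indicator (B t) (Y \<omega> + (X (s + t) \<omega> - X (s + u) \<omega>))) \<partial>P x) =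
    (\<integral>\<^sup>+\<omega>. indicator A \<omega> * cylinder B ts u (Y \<omega>) \<partial>P x)"
  using assms
proof (induction ts arbitrary: u A Y)
  case (Cons t ts)
  let ?\<xi> = "\<lambda>\<omega>. X (s + t) \<omega> - X (s + u) \<omega>"
  have ut: "0 \<le> s + u" "s + u \<le> s + t" and t: "0 \<le> t" "sorted (t # ts)"
    using Cons.prems by auto
  have cyl [measurable]: "cylinder B ts t \<in> borel_measurable borel"
    using Cons.prems by (intro measurable_cylinder) auto
  have B [measurable]: "B t \<in> sets borel" using Cons.prems by simp
  have [measurable]: "Y \<in> borel_measurable (F (s + t))"
    by (rule measurable_filtration_mono[OF Cons.prems(6) ennreal_leI[OF ut(2)]])
  have [measurable]: "X (s + t) \<in> borel_measurable (F (s + t))"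
    "X (s + u) \<in> borel_measurable (F (s + t))"
    using ut by (intro adapted; linarith)+
  have \<xi>'_meas: "(\<lambda>\<omega>. Y \<omega> + ?\<xi> \<omega>) \<in> borel_measurable (F (s + t))" by measurable
  have step_meas: "(\<lambda>((a, y), z). a * (indicator (B t) (y + z) * cylinder B ts t (y + z)))
      \<in> borel_measurable ((borel \<Otimes>\<^sub>M borel) \<Otimes>\<^sub>M borel)"
    unfolding split_beta' by measurable
  define A' where "A' = A \<inter> ((\<lambda>\<omega>. Y \<omega> + ?\<xi> \<omega>) -` B t \<inter> space (F (s + t)))"
  have A': "A' \<in> sets (F (s + t))"
    unfolding A'_def using filtration_mono[OF ennreal_leI[OF ut(2)]] Cons.prems(5)
    by (intro sets.Int measurable_sets[OF \<xi>'_meas B]) auto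
  have "(\<integral>\<^sup>+\<omega>. indicator A \<omega> * (\<Prod>t\<leftarrow>t # ts. indicator (B t) (Y \<omega> + (X (s + t) \<omega> - X (s + u) \<omega>))) \<partial>P x)
    = (\<integral>\<^sup>+\<omega>. indicator A' \<omega> * (\<Prod>t'\<leftarrow>ts. indicator (B t') ((Y \<omega> + ?\<xi> \<omega>) + (X (s + t') \<omega> - X (s + t) \<omega>))) \<partial>P x)"
    by (intro nn_integral_cong) (auto simp: A'_def space_natural_filtration space_P[of x] indicator_def)
  also have "\<dots> = (\<integral>\<^sup>+\<omega>. indicator A' \<omega> * cylinder B ts t (Y \<omega> + ?\<xi> \<omega>) \<partial>P x)"
    using Cons.prems t by (intro Cons.IH A' \<xi>'_meas) auto
  also have "\<dots> = (\<integral>\<^sup>+\<omega>. (\<lambda>((a, y), z). a * (indicator (B t) (y + z) * cylinder B ts t (y + z)))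
      ((indicator A \<omega>, Y \<omega>), ?\<xi> \<omega>) \<partial>P x)"
    by (intro nn_integral_cong) (auto simp: A'_def space_natural_filtration space_P[of x] indicator_def)
  also have "\<dots> = (\<integral>\<^sup>+\<omega>. \<integral>\<^sup>+z. (\<lambda>((a, y), z). a * (indicator (B t) (y + z) * cylinder B ts t (y + z)))
      ((indicator A \<omega>, Y \<omega>), z) \<partial>increment_law (s + t - (s + u)) \<partial>P x)"
    using Cons.prems(5,6) ut
    by (intro nn_integral_increment[where N = "borel \<Otimes>\<^sub>M borel"] step_meas) auto
  also have "\<dots> = (\<integral>\<^sup>+\<omega>. indicator A \<omega> * cylinder B (t # ts) u (Y \<omega>) \<partial>P x)"
    by (simp add: nn_integral_cmult)
  finally show ?case .
qed simp

lemma emeasure_path_cylinder: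
  assumes s: "0 \<le> s" and A: "A \<in> sets (F s)"
    and J: "finite J" "J \<subseteq> {0..}" "\<And>j. j \<in> J \<Longrightarrow> B j \<in> sets borel"
  shows "emeasure (P x) (A \<inter> (shift_path s -` prod_emb {0..} (\<lambda>_. borel) J (Pi\<^sub>E J B) \<inter> space (P x))) =
    emeasure (P x) A * cylinder B (sorted_list_of_set J) 0 0"
proof -
  let ?C = "prod_emb {0..} (\<lambda>_. borel) J (Pi\<^sub>E J B)" and ?ts = "sorted_list_of_set J"
  have C: "?C \<in> sets (path_space {0..})" using J by (intro sets_PiM_I) auto
  have A': "A \<in> sets (P x)" using A filtration_events by blast
  have C': "shift_path s -` ?C \<inter> space (P x) \<in> sets (P x)"
    by (rule measurable_sets[OF measurable_shift_path[OF s] C])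
  have list: "(\<Prod>t\<leftarrow>ts. indicator (B t) (f t)) = (if \<forall>t\<in>set ts. f t \<in> B t then 1 else 0 :: ennreal)"
    for ts f by (induction ts) auto
  have "emeasure (P x) (A \<inter> (shift_path s -` ?C \<inter> space (P x))) =
      (\<integral>\<^sup>+\<omega>. indicator (A \<inter> (shift_path s -` ?C \<inter> space (P x))) \<omega> \<partial>P x)"
    using A' C' by simp
  also have "\<dots> = (\<integral>\<^sup>+\<omega>. indicator A \<omega> * (\<Prod>t\<leftarrow>?ts. indicator (B t) (0 + (X (s + t) \<omega> - X (s + 0) \<omega>))) \<partial>P x)"
    unfolding list using J
    by (intro nn_integral_cong) (auto simp: indicator_def prod_emb_def path_def PiE_iff)
  also have "\<dots> = (\<integral>\<^sup>+\<omega>. indicator A \<omega> * cylinder B ?ts 0 0 \<partial>P x)"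
    by (rule nn_integral_cylinder) (use s A J in auto)
  also have "\<dots> = emeasure (P x) A * cylinder B ?ts 0 0"
    using A' by (simp add: nn_integral_multc)
  finally show ?thesis .
qed

definition path_increments_law :: "(real \<Rightarrow> real) measure" where
  "path_increments_law = distr (P 0) (path_space {0..}) (shift_path 0)"

lemma path_increments_law_eq: "path_increments_law = path_law (P 0) X"
  unfolding path_increments_law_def
proof (rule distr_cong_AE)
  show "AE \<omega> in P 0. shift_path 0 \<omega> = path {0..} X \<omega>"
    using start[of 0] by eventually_elim (simp add: path_def fun_eq_iff)
qed (use measurable_shift_path[of 0 0] in auto)

text \<open>
  On cylinders both sides are given by \<open>cylinder\<close>, the right-hand side by the case \<open>s = 0\<close> with the
  sure event. Finite measures that agree on cylinders are equal.
\<close>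

lemma emeasure_path_increments_law:
  assumes s: "0 \<le> s" and A: "A \<in> sets (F s)" and C: "C \<in> sets (path_space {0..})"
  shows "emeasure (P x) (A \<inter> (shift_path s -` C \<inter> space (P x))) =
    emeasure (P x) A * emeasure path_increments_law C"
proof -
  have A' [measurable]: "A \<in> sets (P x)" using A filtration_events by blast
  have sh [measurable]: "shift_path s \<in> measurable (P x) (path_space {0..})"
    by (rule measurable_shift_path[OF s])
  have sh0 [measurable]: "shift_path 0 \<in> measurable (P 0) (path_space {0..})"
    by (rule measurable_shift_path) simp
  let ?Q = "distr (density (P x) (indicator A)) (path_space {0..}) (shift_path s)"
  let ?R = "density path_increments_law (\<lambda>_. emeasure (P x) A)"
  have Q: "emeasure ?Q C = emeasure (P x) (A \<inter> (shift_path s -` C \<inter> space (P x)))"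
    if C: "C \<in> sets (path_space {0..})" for C
  proof -
    have C' [measurable]: "shift_path s -` C \<inter> space (P x) \<in> sets (P x)"
      by (rule measurable_sets[OF sh C])
    have "emeasure ?Q C = emeasure (density (P x) (indicator A)) (shift_path s -` C \<inter> space (P x))"
      using C by (subst emeasure_distr) auto
    also have "\<dots> = (\<integral>\<^sup>+\<omega>. indicator (A \<inter> (shift_path s -` C \<inter> space (P x))) \<omega> \<partial>P x)"
      by (subst emeasure_density)
        (auto intro!: nn_integral_cong split: split_indicator simp del: nn_integral_indicator)
    also have "\<dots> = emeasure (P x) (A \<inter> (shift_path s -` C \<inter> space (P x)))"
      by (rule nn_integral_indicator) (use A' C' in \<open>rule sets.Int\<close>)
    finally show ?thesis .
  qed
  have R: "emeasure ?R C = emeasure (P x) A * emeasure path_increments_law C"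
    if "C \<in> sets (path_space {0..})" for C
    using that by (simp add: emeasure_density path_increments_law_def nn_integral_cmult)
  have "?Q = ?R"
  proof (rule measure_eqI_PiM_infinite)
    fix B and J :: "real set" assume J: "finite J" "J \<subseteq> {0..}" "\<And>i. i \<in> J \<Longrightarrow> B i \<in> sets (borel :: real measure)"
    let ?C = "prod_emb {0..} (\<lambda>_. borel :: real measure) J (Pi\<^sub>E J B)"
    have C: "?C \<in> sets (path_space {0..})" using J by (intro sets_PiM_I) auto
    have "emeasure path_increments_law ?C =
        emeasure (P 0) (space (P 0) \<inter> (shift_path 0 -` ?C \<inter> space (P 0)))"
      unfolding path_increments_law_def by (subst emeasure_distr[OF sh0 C]) (simp add: Int_absorb1)
    also have "\<dots> = cylinder B (sorted_list_of_set J) 0 0"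
      using sets.top[of "F 0"] 
      by (subst emeasure_path_cylinder[OF _ _ J]) (auto simp: space_natural_filtration emeasure_space_1)
    finally show "emeasure ?Q ?C = emeasure ?R ?C"
      unfolding Q[OF C] R[OF C] by (simp add: emeasure_path_cylinder[OF s A J])
  next
    have "emeasure ?Q (space ?Q) \<noteq> \<infinity>"
      using Q[OF sets.top] by (simp add: emeasure_finite)
    then show "finite_measure ?Q" by (rule finite_measureI)
  qed (auto simp: path_increments_law_def)
  then show ?thesis using Q[OF C] R[OF C] by simp
qed

text \<open>
  The previous lemma factorises the joint law on rectangles, which determine it.
\<close>

theorem markov:
  assumes s: "0 \<le> s" and W: "W \<in> measurable (F s) N"
  shows "distr (P x) (N \<Otimes>\<^sub>M path_space {0..}) (\<lambda>\<omega>. (W \<omega>, shift_path s \<omega>)) =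
    distr (P x) N W \<Otimes>\<^sub>M path_law (P 0) X" (is "?J = ?W \<Otimes>\<^sub>M ?L")
proof (rule pair_measure_eqI[symmetric])
  have W' [measurable]: "W \<in> measurable (P x) N" by (rule measurable_filtration[OF W])
  have sh [measurable]: "shift_path s \<in> measurable (P x) (path_space {0..})"
    by (rule measurable_shift_path[OF s])
  interpret W: prob_space "?W" by (rule prob_space_distr) simp
  interpret L: prob_space "?L" by (rule prob_space_distr) simp
  show "sigma_finite_measure ?W" "sigma_finite_measure ?L"
    by unfold_locales
  show "sets (?W \<Otimes>\<^sub>M ?L) =
      sets ?J"
    by (simp cong: sets_pair_measure_cong)
  fix A C assume "A \<in> sets ?W" "C \<in> sets ?L"
  then have A: "A \<in> sets N" and C: "C \<in> sets (path_space {0..})" by auto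
  have "W -` A \<inter> space (P x) \<in> sets (F s)"
    using measurable_sets[OF W A] by (simp add: space_natural_filtration space_P[of x])
  moreover have "(\<lambda>\<omega>. (W \<omega>, shift_path s \<omega>)) -` (A \<times> C) \<inter> space (P x) =
      (W -` A \<inter> space (P x)) \<inter> (shift_path s -` C \<inter> space (P x))"
    by auto
  ultimately show "emeasure ?W A * emeasure ?L C =
      emeasure ?J (A \<times> C)"
    using A C emeasure_path_increments_law[OF s _ C, of "W -` A \<inter> space (P x)" x]
    by (simp add: emeasure_distr path_increments_law_eq)
qed

end

section \<open>Exponential times\<close>

definition exp_law :: "real \<Rightarrow> real measure" where
  "exp_law r = density lborel (exponential_density r)"

lemma sets_exp_law [simp, measurable_cong]: "sets (exp_law r) = sets borel"
  by (simp add: exp_law_def)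

lemma space_exp_law [simp]: "space (exp_law r) = UNIV"
  by (simp add: exp_law_def)

lemma AE_exp_law_pos: "AE t in exp_law r. 0 < t"
proof -
  have "AE t in lborel. t \<noteq> (0 :: real)" by (rule AE_lborel_singleton)
  then have "AE t in lborel. 0 < ennreal (exponential_density r t) \<longrightarrow> 0 < t"
    by eventually_elim (auto simp: exponential_density_def)
  then show ?thesis unfolding exp_law_def by (subst AE_density) auto
qed

lemma nn_integral_exp_law:
  assumes [measurable]: "f \<in> borel_measurable borel"
  shows "(\<integral>\<^sup>+t. f t \<partial>exp_law r) = (\<integral>\<^sup>+t. ennreal (exponential_density r t) * f t \<partial>lborel)"
  unfolding exp_law_def by (rule nn_integral_density) auto

lemma nn_integral_exp_law_after:
  assumes r: "0 < r" and s: "0 \<le> s" and f [measurable]: "f \<in> borel_measurable borel"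
  shows "(\<integral>\<^sup>+t. indicator {s<..} t * f t \<partial>exp_law r) =
    ennreal (exp (- r * s)) * (\<integral>\<^sup>+t. f (s + t) \<partial>exp_law r)"
proof -
  have "(\<integral>\<^sup>+t. indicator {s<..} t * f t \<partial>exp_law r) =
      (\<integral>\<^sup>+t. ennreal (exponential_density r t) * (indicator {s<..} t * f t) \<partial>lborel)"
    by (simp add: nn_integral_exp_law)
  also have "\<dots> = (\<integral>\<^sup>+t. ennreal (exponential_density r (s + t)) * (indicator {s<..} (s + t) * f (s + t)) \<partial>lborel)"
    by (subst nn_integral_real_affine[where c = 1 and t = s]) simp_all
  also have "\<dots> = (\<integral>\<^sup>+t. ennreal (exp (- r * s)) * (ennreal (exponential_density r t) * f (s + t)) \<partial>lborel)"
  proof (rule nn_integral_cong_AE)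
    have "AE t in lborel. t \<noteq> (0 :: real)" by (rule AE_lborel_singleton)
    then show "AE t in lborel. ennreal (exponential_density r (s + t)) * (indicator {s<..} (s + t) * f (s + t)) =
        ennreal (exp (- r * s)) * (ennreal (exponential_density r t) * f (s + t))"
    proof eventually_elim
      case (elim t)
      show ?case
      proof (cases "t < 0")
        case False
        then have "exponential_density r (s + t) = exp (- r * s) * exponential_density r t"
          using s by (simp add: exponential_density_def exp_add[symmetric] algebra_simps)
        then show ?thesis
          using False elim r by (simp add: ennreal_mult mult.assoc exponential_density_nonneg)
      qed (simp add: exponential_density_def)
    qed
  qed
  also have "\<dots> = ennreal (exp (- r * s)) * (\<integral>\<^sup>+t. f (s + t) \<partial>exp_law r)"
    by (simp add: nn_integral_cmult nn_integral_exp_law)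
  finally show ?thesis .
qed

text \<open>
  Memorylessness, with a bystander \<open>\<omega>\<close> that is independent of the exponential time.
\<close>

lemma nn_integral_memoryless:
  assumes r: "0 < r" and s: "0 \<le> s" and f [measurable]: "f \<in> borel_measurable (M \<Otimes>\<^sub>M borel)"
  shows "(\<integral>\<^sup>+(\<omega>, t). indicator {s<..} t * f (\<omega>, t) \<partial>(M \<Otimes>\<^sub>M exp_law r)) =
    ennreal (exp (- r * s)) * (\<integral>\<^sup>+(\<omega>, t). f (\<omega>, s + t) \<partial>(M \<Otimes>\<^sub>M exp_law r))"
proof -
  interpret E: prob_space "exp_law r"
    unfolding exp_law_def using r by (rule prob_space_exponential_density)
  have [measurable]: "f \<in> borel_measurable (M \<Otimes>\<^sub>M exp_law r)"
    by (simp cong: measurable_cong_sets sets_pair_measure_cong)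
  have "(\<integral>\<^sup>+(\<omega>, t). indicator {s<..} t * f (\<omega>, t) \<partial>(M \<Otimes>\<^sub>M exp_law r)) =
      (\<integral>\<^sup>+\<omega>. \<integral>\<^sup>+t. indicator {s<..} t * f (\<omega>, t) \<partial>exp_law r \<partial>M)"
    by (subst E.nn_integral_fst[symmetric]) (simp_all add: split_beta')
  also have "\<dots> = (\<integral>\<^sup>+\<omega>. ennreal (exp (- r * s)) * (\<integral>\<^sup>+t. f (\<omega>, s + t) \<partial>exp_law r) \<partial>M)"
    by (intro nn_integral_cong nn_integral_exp_law_after r s) measurable
  also have "\<dots> = ennreal (exp (- r * s)) * (\<integral>\<^sup>+(\<omega>, t). f (\<omega>, s + t) \<partial>(M \<Otimes>\<^sub>M exp_law r))"
    by (subst E.nn_integral_fst[symmetric]) (simp_all add: split_beta' nn_integral_cmult)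
  finally show ?thesis .
qed

text \<open>
  Stated as an equality of measures, memorylessness applies to signed integrands as well as to
  nonnegative ones.
\<close>

lemma memoryless_measure:
  assumes r: "0 < r" and s: "0 \<le> s"
  shows "density (M \<Otimes>\<^sub>M exp_law r) (\<lambda>(\<omega>, t). ennreal (indicator {s<..} t)) =
    density (distr (M \<Otimes>\<^sub>M exp_law r) (M \<Otimes>\<^sub>M exp_law r) (\<lambda>(\<omega>, t). (\<omega>, s + t)))
      (\<lambda>_. ennreal (exp (- r * s)))" (is "?M = ?N")
proof (rule measure_eqI)
  fix A assume "A \<in> sets ?M"
  then have A [measurable]: "A \<in> sets (M \<Otimes>\<^sub>M exp_law r)" by simp
  have sets_eq: "sets (M \<Otimes>\<^sub>M exp_law r) = sets (M \<Otimes>\<^sub>M borel)"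
    by (intro sets_pair_measure_cong) simp_all
  have A': "A \<in> sets (M \<Otimes>\<^sub>M borel)" using A sets_eq by auto
  then have ind: "(indicator A :: _ \<Rightarrow> ennreal) \<in> borel_measurable (M \<Otimes>\<^sub>M borel)"
    by (rule borel_measurable_indicator)
  have shift: "(\<lambda>(\<omega>, t). (\<omega>, s + t)) \<in> measurable (M \<Otimes>\<^sub>M exp_law r) (M \<Otimes>\<^sub>M exp_law r)"
    by measurable
  have "emeasure ?M A =
      (\<integral>\<^sup>+(\<omega>, t). indicator {s<..} t * indicator A (\<omega>, t) \<partial>(M \<Otimes>\<^sub>M exp_law r))"
    using A' by (subst emeasure_density) (auto simp: split_beta' intro!: nn_integral_cong split: split_indicator)
  also have "\<dots> = ennreal (exp (- r * s)) *
      (\<integral>\<^sup>+y. indicator A ((\<lambda>(\<omega>, t). (\<omega>, s + t)) y) \<partial>(M \<Otimes>\<^sub>M exp_law r))"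
    unfolding nn_integral_memoryless[OF r s ind] by (simp only: split_beta')
  also have "(\<integral>\<^sup>+y. indicator A ((\<lambda>(\<omega>, t). (\<omega>, s + t)) y) \<partial>(M \<Otimes>\<^sub>M exp_law r)) =
      (\<integral>\<^sup>+y. indicator A y \<partial>distr (M \<Otimes>\<^sub>M exp_law r) (M \<Otimes>\<^sub>M exp_law r) (\<lambda>(\<omega>, t). (\<omega>, s + t)))"
    by (rule nn_integral_distr[OF shift, symmetric]) (simp add: A)
  also have "ennreal (exp (- r * s)) * \<dots> =
      emeasure ?N A"
    using A' by (subst emeasure_density_const) simp_all
  finally show "emeasure ?M A =
      emeasure ?N A" .
qed simp

lemma integral_memoryless:
  fixes f :: "'a \<times> real \<Rightarrow> real"
  assumes r: "0 < r" and s: "0 \<le> s" and f [measurable]: "f \<in> borel_measurable (M \<Otimes>\<^sub>M borel)"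
  shows "(\<integral>(\<omega>, t). indicator {s<..} t * f (\<omega>, t) \<partial>(M \<Otimes>\<^sub>M exp_law r)) =
      exp (- r * s) * (\<integral>(\<omega>, t). f (\<omega>, s + t) \<partial>(M \<Otimes>\<^sub>M exp_law r))" (is ?A)
    and "integrable (M \<Otimes>\<^sub>M exp_law r) (\<lambda>(\<omega>, t). f (\<omega>, s + t)) \<longleftrightarrow>
      integrable (M \<Otimes>\<^sub>M exp_law r) (\<lambda>(\<omega>, t). indicator {s<..} t * f (\<omega>, t))" (is ?B)
proof -
  have [measurable]: "f \<in> borel_measurable (M \<Otimes>\<^sub>M exp_law r)"
    by (simp cong: measurable_cong_sets sets_pair_measure_cong)
  have shift: "(\<lambda>(\<omega>, t). (\<omega>, s + t)) \<in> measurable (M \<Otimes>\<^sub>M exp_law r) (M \<Otimes>\<^sub>M exp_law r)"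
    by measurable
  let ?D = "distr (M \<Otimes>\<^sub>M exp_law r) (M \<Otimes>\<^sub>M exp_law r) (\<lambda>(\<omega>, t). (\<omega>, s + t))"
  have "(\<integral>y. f y \<partial>density (M \<Otimes>\<^sub>M exp_law r) (\<lambda>(\<omega>, t). ennreal (indicator {s<..} t))) =
      (\<integral>(\<omega>, t). indicator {s<..} t * f (\<omega>, t) \<partial>(M \<Otimes>\<^sub>M exp_law r))"
    using integral_density[of f "M \<Otimes>\<^sub>M exp_law r" "\<lambda>(\<omega>, t). indicator {s<..} t"]
    by (simp add: split_beta')
  moreover have "(\<integral>y. f y \<partial>density ?D (\<lambda>_. ennreal (exp (- r * s)))) =
      exp (- r * s) * (\<integral>(\<omega>, t). f (\<omega>, s + t) \<partial>(M \<Otimes>\<^sub>M exp_law r))"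
    using integral_density[of f ?D "\<lambda>_. exp (- r * s)"] integral_distr[OF shift, of f]
    by (simp add: split_beta')
  ultimately show ?A using memoryless_measure[OF r s, of M] by simp
  have "integrable (density (M \<Otimes>\<^sub>M exp_law r) (\<lambda>(\<omega>, t). ennreal (indicator {s<..} t))) f \<longleftrightarrow>
      integrable (M \<Otimes>\<^sub>M exp_law r) (\<lambda>(\<omega>, t). indicator {s<..} t * f (\<omega>, t))"
    using integrable_density[of f "M \<Otimes>\<^sub>M exp_law r" "\<lambda>(\<omega>, t). indicator {s<..} t"]
    by (simp add: split_beta')
  moreover have "integrable (density ?D (\<lambda>_. ennreal (exp (- r * s)))) f \<longleftrightarrow>
      integrable (M \<Otimes>\<^sub>M exp_law r) (\<lambda>(\<omega>, t). f (\<omega>, s + t))"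
    using integrable_density[of f ?D "\<lambda>_. exp (- r * s)"] integrable_distr_eq[OF shift, of f]
    by (simp add: split_beta')
  ultimately show ?B using memoryless_measure[OF r s, of M] by simp
qed

lemma cell_shift: "0 \<le> t \<Longrightarrow> cell n (grid n 1 + t) = Suc (cell n t)"
proof -
  assume t: "0 \<le> t"
  have "(grid n 1 + t) * 2 ^ n = t * 2 ^ n + 1" by (simp add: grid_def distrib_right)
  then have "\<lceil>(grid n 1 + t) * 2 ^ n\<rceil> = \<lceil>t * 2 ^ n\<rceil> + 1" by (simp only: ceiling_add_one)
  moreover have "0 \<le> \<lceil>t * 2 ^ n\<rceil>" using t by (simp add: less_le_trans[of "-1" 0])
  ultimately show ?thesis by (simp add: cell_def nat_add_distrib del: zero_le_ceiling One_nat_def)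
qed

text \<open>
  The index of the dyadic cell that contains an exponential time is geometric: by memorylessness
  the count starts afresh after the first cell.
\<close>

lemma nn_integral_cell:
  fixes \<Phi> :: "nat \<Rightarrow> ennreal"
  assumes r: "0 < r"
  shows "(\<integral>\<^sup>+t. \<Phi> (cell n t - 1) \<partial>exp_law r) =
    ennreal (1 - exp (- r * grid n 1)) * \<Phi> 0 +
    ennreal (exp (- r * grid n 1)) * (\<integral>\<^sup>+t. \<Phi> (cell n t) \<partial>exp_law r)"
proof -
  interpret E: prob_space "exp_law r"
    unfolding exp_law_def using r by (rule prob_space_exponential_density)
  let ?s = "grid n 1"
  have after: "ennreal (exp (- r * ?s)) = emeasure (exp_law r) {?s<..}"
    using nn_integral_exp_law_after[OF r, of ?s "\<lambda>_. 1"] E.emeasure_space_1 by simp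
  have "emeasure (exp_law r) {..?s} = emeasure (exp_law r) (space (exp_law r) - {?s<..})"
    by (rule arg_cong[where f = "emeasure _"]) auto
  also have "\<dots> = ennreal (1 - exp (- r * ?s))"
    using E.emeasure_space_1 after[symmetric]
    by (subst emeasure_Diff) (auto simp: ennreal_minus ennreal_1[symmetric] simp del: ennreal_1)
  finally have before: "emeasure (exp_law r) {..?s} = ennreal (1 - exp (- r * ?s))" .
  have small: "cell n t \<le> 1 \<longleftrightarrow> t \<le> ?s" for t
    by (simp add: le_grid_iff)
  have "(\<integral>\<^sup>+t. \<Phi> (cell n t - 1) \<partial>exp_law r) =
      (\<integral>\<^sup>+t. \<Phi> 0 * indicator {..?s} t + indicator {?s<..} t * \<Phi> (cell n t - 1) \<partial>exp_law r)"
    by (intro nn_integral_cong) (use small in \<open>auto split: split_indicator\<close>)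
  also have "\<dots> = \<Phi> 0 * emeasure (exp_law r) {..?s} +
      (\<integral>\<^sup>+t. indicator {?s<..} t * \<Phi> (cell n t - 1) \<partial>exp_law r)"
    by (subst nn_integral_add) (simp_all add: nn_integral_cmult)
  also have "(\<integral>\<^sup>+t. indicator {?s<..} t * \<Phi> (cell n t - 1) \<partial>exp_law r) =
      ennreal (exp (- r * ?s)) * (\<integral>\<^sup>+t. \<Phi> (cell n (?s + t) - 1) \<partial>exp_law r)"
    by (rule nn_integral_exp_law_after[OF r]) simp_all
  also have "(\<integral>\<^sup>+t. \<Phi> (cell n (?s + t) - 1) \<partial>exp_law r) = (\<integral>\<^sup>+t. \<Phi> (cell n t) \<partial>exp_law r)"
    using AE_exp_law_pos[of r]
    by (intro nn_integral_cong_AE) (auto elim!: eventually_mono simp: cell_shift simp del: One_nat_def)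
  finally show ?thesis unfolding before by (simp add: mult.commute)
qed

lemma integral_cell:
  fixes \<Phi> :: "nat \<Rightarrow> real"
  assumes r: "0 < r" and bound: "\<And>k. \<bar>\<Phi> k\<bar> \<le> C"
  shows "(\<integral>t. \<Phi> (cell n t - 1) \<partial>exp_law r) =
    (1 - exp (- r * grid n 1)) * \<Phi> 0 + exp (- r * grid n 1) * (\<integral>t. \<Phi> (cell n t) \<partial>exp_law r)"
proof -
  interpret E: prob_space "exp_law r"
    unfolding exp_law_def using r by (rule prob_space_exponential_density)
  let ?q = "exp (- r * grid n 1)"
  have q: "0 \<le> ?q" "?q \<le> 1" using r by (auto simp: mult_nonneg_nonneg)
  have int: "integrable (exp_law r) (\<lambda>t. \<Phi> (h (cell n t)))" for h
    using bound by (intro E.integrable_const_bound[of _ C]) auto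
  \<comment> \<open>The shift by the bound makes the integrand nonnegative.\<close>
  define \<Psi> where "\<Psi> k = \<Phi> k + C" for k
  have \<Psi>: "0 \<le> \<Psi> k" for k using bound[of k] by (simp add: \<Psi>_def)
  have int': "integrable (exp_law r) (\<lambda>t. \<Psi> (h (cell n t)))" for h
    unfolding \<Psi>_def using int by simp
  have nn: "(\<integral>\<^sup>+t. ennreal (\<Psi> (h (cell n t))) \<partial>exp_law r) = ennreal (\<integral>t. \<Psi> (h (cell n t)) \<partial>exp_law r)" for h
    by (rule nn_integral_eq_integral[OF int']) (simp add: \<Psi>)
  have nonneg: "0 \<le> (\<integral>t. \<Psi> (h (cell n t)) \<partial>exp_law r)" for h
    by (intro integral_nonneg_AE) (simp add: \<Psi>)
  have "ennreal (\<integral>t. \<Psi> (cell n t - 1) \<partial>exp_law r) =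
      ennreal ((1 - ?q) * \<Psi> 0 + ?q * (\<integral>t. \<Psi> (cell n t) \<partial>exp_law r))"
    using nn_integral_cell[OF r, of "\<lambda>k. ennreal (\<Psi> k)" n] nn[of "\<lambda>k. k - 1"] nn[of "\<lambda>k. k"] q
      nonneg[of "\<lambda>k. k"] \<Psi>[of 0]
    by (simp add: ennreal_mult[symmetric] ennreal_plus[symmetric] del: ennreal_plus)
  then have "(\<integral>t. \<Psi> (cell n t - 1) \<partial>exp_law r) = (1 - ?q) * \<Psi> 0 + ?q * (\<integral>t. \<Psi> (cell n t) \<partial>exp_law r)"
    using q nonneg[of "\<lambda>k. k - 1"] nonneg[of "\<lambda>k. k"] \<Psi>[of 0] by (subst (asm) ennreal_inj) auto
  moreover have "(\<integral>t. \<Psi> (h (cell n t)) \<partial>exp_law r) = (\<integral>t. \<Phi> (h (cell n t)) \<partial>exp_law r) + C" for h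
    unfolding \<Psi>_def using int[of h] E.prob_space by simp
  note this[of "\<lambda>k. k - 1"] this[of "\<lambda>k. k"]
  ultimately show ?thesis by (simp add: \<Psi>_def algebra_simps)
qed

text \<open>
  Iterating the identity \<open>integral_cell\<close> expands the integral into a geometric series.
\<close>

lemma geometric_series_cell:
  fixes \<Phi> :: "nat \<Rightarrow> real"
  assumes r: "0 < r" and bound: "\<And>k. \<bar>\<Phi> k\<bar> \<le> C"
  shows "(\<lambda>k. (1 - exp (- r * grid n 1)) * exp (- r * grid n 1) ^ k * \<Phi> k) sums
    (\<integral>t. \<Phi> (cell n t - 1) \<partial>exp_law r)"
proof -
  interpret E: prob_space "exp_law r"
    unfolding exp_law_def using r by (rule prob_space_exponential_density)
  let ?q = "exp (- r * grid n 1)"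
  have q: "0 \<le> ?q" "?q < 1" using r by (auto simp: grid_def)
  define I where "I N = (\<integral>t. \<Phi> (N + (cell n t - 1)) \<partial>exp_law r)" for N
  have I_Suc: "I N = (1 - ?q) * \<Phi> N + ?q * I (Suc N)" for N
  proof -
    have "(\<integral>t. \<Phi> (N + cell n t) \<partial>exp_law r) = I (Suc N)"
      unfolding I_def
    proof (rule integral_cong_AE)
      show "AE t in exp_law r. \<Phi> (N + cell n t) = \<Phi> (Suc N + (cell n t - 1))"
        using AE_exp_law_pos[of r]
      proof eventually_elim
        case (elim t)
        then have "0 < cell n t" using grid_less_cell_iff[of n 0 t] by simp
        then have "N + cell n t = Suc N + (cell n t - 1)" by simp
        then show ?case by (rule arg_cong)
      qed
    qed measurable
    moreover have "(\<integral>t. \<Phi> (N + (cell n t - 1)) \<partial>exp_law r) =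
        (1 - ?q) * \<Phi> (N + 0) + ?q * (\<integral>t. \<Phi> (N + cell n t) \<partial>exp_law r)"
      by (rule integral_cell[OF r]) (rule bound)
    ultimately show ?thesis by (simp only: I_def add_0_right)
  qed
  have partial: "(\<Sum>k<N. (1 - ?q) * ?q ^ k * \<Phi> k) = I 0 - ?q ^ N * I N" for N
  proof (induction N)
    case (Suc N)
    show ?case unfolding sum.lessThan_Suc Suc.IH by (simp add: I_Suc[of N] algebra_simps)
  qed simp
  have "\<bar>I N\<bar> \<le> C" for N
    unfolding I_def
    by (rule order_trans[OF integral_abs_bound])
      (use bound in \<open>auto intro!: E.integral_le_const E.integrable_const_bound[of _ C]\<close>)
  then have le: "norm (?q ^ N * I N) \<le> ?q ^ N * C" for N
    using q by (simp add: abs_mult mult_left_mono)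
  have lim: "(\<lambda>N. ?q ^ N * C) \<longlonglongrightarrow> 0"
    using tendsto_mult[OF LIMSEQ_realpow_zero[OF q] tendsto_const[of C]] by simp
  have "(\<lambda>N. ?q ^ N * I N) \<longlonglongrightarrow> 0"
    by (rule Lim_null_comparison[OF always_eventually lim]) (intro allI le)
  from tendsto_diff[OF tendsto_const[of "I 0"] this]
  have "(\<lambda>N. \<Sum>k<N. (1 - ?q) * ?q ^ k * \<Phi> k) \<longlonglongrightarrow> I 0"
    unfolding partial by simp
  moreover have "I 0 = (\<integral>t. \<Phi> (cell n t - 1) \<partial>exp_law r)"
    unfolding I_def add_0_left by (rule refl)
  ultimately show ?thesis unfolding sums_def by simp
qed

section \<open>The Wiener--Hopf factorisation on a dyadic grid\<close>

lemma grid_max_0: "grid_max p n 0 = p 0"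
  by (simp add: grid_max_def)

lemma grid_max_Suc: "grid_max p n (Suc k) = max (p (grid n (Suc k))) (grid_max p n k)"
  unfolding grid_max_def atMost_Suc by (subst image_insert, subst Max_insert) auto

text \<open>
  One step of a walk with step law \<open>\<mu>\<close>, seen through its drawdown \<open>d\<close>: killed as soon as the walk
  exceeds its old maximum, respectively reflected there.
\<close>

definition step_below :: "real measure \<Rightarrow> (real \<Rightarrow> real) \<Rightarrow> real \<Rightarrow> real" where
  "step_below \<mu> \<psi> d = (\<integral>z. (if z \<le> d then \<psi> (d - z) else 0) \<partial>\<mu>)"

definition step_reflected :: "real measure \<Rightarrow> (real \<Rightarrow> real) \<Rightarrow> real \<Rightarrow> real" where
  "step_reflected \<mu> \<psi> d = (\<integral>z. \<psi> (max (d - z) 0) \<partial>\<mu>)"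

lemma bounded_step:
  assumes "prob_space \<mu>" and sets [measurable_cong]: "sets \<mu> = sets borel"
    and [measurable]: "\<psi> \<in> borel_measurable borel" and bound: "\<And>d. \<bar>\<psi> d\<bar> \<le> C"
  shows "step_below \<mu> \<psi> \<in> borel_measurable borel" "\<bar>step_below \<mu> \<psi> d\<bar> \<le> C"
    "step_reflected \<mu> \<psi> \<in> borel_measurable borel" "\<bar>step_reflected \<mu> \<psi> d\<bar> \<le> C"
proof -
  interpret prob_space \<mu> by fact
  have C: "0 \<le> C" using bound[of 0] by linarith
  show "step_below \<mu> \<psi> \<in> borel_measurable borel" "step_reflected \<mu> \<psi> \<in> borel_measurable borel"
    unfolding step_below_def[abs_def] step_reflected_def[abs_def] by measurable
  have avg: "\<bar>\<integral>z. h z \<partial>\<mu>\<bar> \<le> C"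
    if [measurable]: "h \<in> borel_measurable \<mu>" and h: "\<And>z. \<bar>h z\<bar> \<le> C" for h :: "real \<Rightarrow> real"
    by (rule order_trans[OF integral_abs_bound integral_le_const])
      (auto intro!: integrable_const_bound[of _ C] h)
  show "\<bar>step_below \<mu> \<psi> d\<bar> \<le> C" unfolding step_below_def
    by (rule avg) (use bound C in auto)
  show "\<bar>step_reflected \<mu> \<psi> d\<bar> \<le> C" unfolding step_reflected_def
    by (rule avg) (use bound in auto)
qed

context levy_measures
begin

lemma integral_increment:
  fixes f :: "'b \<times> real \<Rightarrow> real"
  assumes W: "W \<in> measurable (F s) N" and s: "0 \<le> s" "s \<le> t"
    and f [measurable]: "f \<in> borel_measurable (N \<Otimes>\<^sub>M borel)" and bound: "\<And>y. \<bar>f y\<bar> \<le> C"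
  shows "(\<integral>\<omega>. f (W \<omega>, X t \<omega> - X s \<omega>) \<partial>P x) =
    (\<integral>\<omega>. \<integral>z. f (W \<omega>, z) \<partial>increment_law (t - s) \<partial>P x)"
proof -
  have W' [measurable]: "W \<in> measurable (P x) N" by (rule measurable_filtration[OF W])
  have [measurable]: "(\<lambda>\<omega>. X t \<omega> - X s \<omega>) \<in> borel_measurable (P x)"
    using s by (intro borel_measurable_diff measurable_X) auto
  interpret I: prob_space "increment_law (t - s)" using s by (intro prob_space_increment_law) auto
  interpret W: prob_space "distr (P x) N W" by (rule prob_space_distr) simp
  interpret WI: pair_prob_space "distr (P x) N W" "increment_law (t - s)" ..
  have f' [measurable]: "f \<in> borel_measurable (N \<Otimes>\<^sub>M increment_law (t - s))"
    by (simp cong: measurable_cong_sets sets_pair_measure_cong)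
  have int: "integrable (distr (P x) N W \<Otimes>\<^sub>M increment_law (t - s)) f"
    using bound by (intro WI.integrable_const_bound[of _ C]) auto
  have "(\<integral>\<omega>. f (W \<omega>, X t \<omega> - X s \<omega>) \<partial>P x) =
      (\<integral>y. f y \<partial>distr (P x) (N \<Otimes>\<^sub>M borel) (\<lambda>\<omega>. (W \<omega>, X t \<omega> - X s \<omega>)))"
    by (simp add: integral_distr)
  also have "\<dots> = (\<integral>w. \<integral>z. f (w, z) \<partial>increment_law (t - s) \<partial>distr (P x) N W)"
    unfolding distr_increment[OF W s] using WI.integral_fst'[OF int] by simp
  also have "\<dots> = (\<integral>\<omega>. \<integral>z. f (W \<omega>, z) \<partial>increment_law (t - s) \<partial>P x)"
    by (subst integral_distr) simp_all
  finally show ?thesis .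
qed

definition walk_max :: "nat \<Rightarrow> nat \<Rightarrow> 'a \<Rightarrow> real" where
  "walk_max n k \<omega> = grid_max (\<lambda>t. X t \<omega> - X 0 \<omega>) n k"

definition walk_drawdown :: "nat \<Rightarrow> nat \<Rightarrow> 'a \<Rightarrow> real" where
  "walk_drawdown n k \<omega> = walk_max n k \<omega> - (X (grid n k) \<omega> - X 0 \<omega>)"

definition walk_depth :: "nat \<Rightarrow> nat \<Rightarrow> 'a \<Rightarrow> real" where
  "walk_depth n k \<omega> = grid_max (\<lambda>t. X 0 \<omega> - X t \<omega>) n k"

definition walk_step :: "nat \<Rightarrow> nat \<Rightarrow> 'a \<Rightarrow> real" where
  "walk_step n k \<omega> = X (grid n (Suc k)) \<omega> - X (grid n k) \<omega>"

text \<open>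
  The expectation of \<open>\<phi>\<close> of the position after \<open>i\<close> steps on the event that it is a new strict
  maximum; the start counts as one.
\<close>

definition ladder :: "nat \<Rightarrow> (real \<Rightarrow> real) \<Rightarrow> nat \<Rightarrow> real" where
  "ladder n \<phi> i = (case i of 0 \<Rightarrow> \<phi> 0 | Suc k \<Rightarrow>
    (\<integral>\<omega>. (if walk_drawdown n k \<omega> < walk_step n k \<omega> then \<phi> (walk_max n (Suc k) \<omega>) else 0) \<partial>P 0))"

lemma walk_0 [simp]: "walk_max n 0 \<omega> = 0" "walk_drawdown n 0 \<omega> = 0" "walk_depth n 0 \<omega> = 0"
  by (simp_all add: walk_max_def walk_drawdown_def walk_depth_def grid_max_0)

lemma walk_Suc:
  "walk_max n (Suc k) \<omega> = walk_max n k \<omega> + max (walk_step n k \<omega> - walk_drawdown n k \<omega>) 0"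
  "walk_drawdown n (Suc k) \<omega> = max (walk_drawdown n k \<omega> - walk_step n k \<omega>) 0"
  by (simp_all add: walk_max_def walk_drawdown_def walk_step_def grid_max_Suc max_def)

lemma adapted_walk:
  "walk_max n k \<in> borel_measurable (F (grid n k))"
  "walk_drawdown n k \<in> borel_measurable (F (grid n k))"
proof -
  have "X (grid n j) \<in> borel_measurable (F (grid n k))" if "j \<le> k" for j
    using that by (intro adapted) (auto simp: grid_le_iff)
  note X = this this[of 0, simplified]
  show *: "walk_max n k \<in> borel_measurable (F (grid n k))"
    unfolding walk_max_def[abs_def] by (intro measurable_grid_max borel_measurable_diff X)
  show "walk_drawdown n k \<in> borel_measurable (F (grid n k))"
    unfolding walk_drawdown_def[abs_def] by (intro borel_measurable_diff X * order_refl)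
qed

lemma measurable_walk [measurable]:
  "walk_max n k \<in> borel_measurable (P x)"
  "walk_drawdown n k \<in> borel_measurable (P x)"
  "walk_depth n k \<in> borel_measurable (P x)"
  "walk_step n k \<in> borel_measurable (P x)"
  using measurable_filtration[OF adapted_walk(1)] measurable_filtration[OF adapted_walk(2)]
  unfolding walk_depth_def[abs_def] walk_step_def[abs_def]
  by (auto intro!: measurable_grid_max borel_measurable_diff measurable_X)

lemma walk_step_law:
  fixes f :: "real \<Rightarrow> real \<Rightarrow> real \<Rightarrow> real"
  assumes f: "(\<lambda>((m, d), z). f m d z) \<in> borel_measurable ((borel \<Otimes>\<^sub>M borel) \<Otimes>\<^sub>M borel)"
    and bound: "\<And>m d z. \<bar>f m d z\<bar> \<le> C"
  shows "(\<integral>\<omega>. f (walk_max n k \<omega>) (walk_drawdown n k \<omega>) (walk_step n k \<omega>) \<partial>P x) =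
    (\<integral>\<omega>. \<integral>z. f (walk_max n k \<omega>) (walk_drawdown n k \<omega>) z \<partial>increment_law (grid n 1) \<partial>P x)"
proof -
  have "grid n (Suc k) - grid n k = grid n 1"
    using grid_add[of n 1 k] by simp
  moreover have "(\<lambda>\<omega>. (walk_max n k \<omega>, walk_drawdown n k \<omega>)) \<in> measurable (F (grid n k)) (borel \<Otimes>\<^sub>M borel)"
    using adapted_walk[of n k] by (rule measurable_Pair)
  from integral_increment[OF this _ _ f, of "grid n (Suc k)" C x]
  have "(\<integral>\<omega>. f (walk_max n k \<omega>) (walk_drawdown n k \<omega>) (walk_step n k \<omega>) \<partial>P x) =
    (\<integral>\<omega>. \<integral>z. f (walk_max n k \<omega>) (walk_drawdown n k \<omega>) z
      \<partial>increment_law (grid n (Suc k) - grid n k) \<partial>P x)"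
    using bound by (simp add: split_beta' walk_step_def grid_le_iff)
  ultimately show ?thesis by simp
qed

text \<open>
  The decomposition of the walk at the time \<open>i\<close> of its last strict record: up to \<open>i\<close> it reaches a new
  maximum, and in the remaining \<open>k - i\<close> steps it does not exceed it. In the
  induction on \<open>k\<close> the last step either leaves the maximum unchanged, which applies \<open>step_below\<close> to
  the test function \<open>\<psi>\<close> of the drawdown, or sets a new record, which is the summand with \<open>i = k + 1\<close>.
\<close>

lemma split_at_maximum:
  fixes \<phi> \<psi> :: "real \<Rightarrow> real"
  assumes [measurable]: "\<phi> \<in> borel_measurable borel" "\<psi> \<in> borel_measurable borel"
    and bound: "\<And>y. \<bar>\<phi> y\<bar> \<le> 1" "\<And>y. \<bar>\<psi> y\<bar> \<le> 1"
  shows "(\<integral>\<omega>. \<phi> (walk_max n k \<omega>) * \<psi> (walk_drawdown n k \<omega>) \<partial>P 0) =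
    (\<Sum>i\<le>k. ladder n \<phi> i * (step_below (increment_law (grid n 1)) ^^ (k - i)) \<psi> 0)"
  using assms(2) bound(2)
proof (induction k arbitrary: \<psi>)
  case 0
  then show ?case by (simp add: ladder_def prob_space)
next
  case (Suc k)
  note [measurable] = Suc.prems(1)
  let ?\<mu> = "increment_law (grid n 1)"
  let ?M = "walk_max n k" and ?D = "walk_drawdown n k" and ?Z = "walk_step n k"
  have \<mu>: "prob_space ?\<mu>" by (rule prob_space_increment_law) simp
  note step = bounded_step[OF \<mu> sets_increment_law Suc.prems]
  have prod_bound: "\<bar>\<phi> y * \<psi> d\<bar> \<le> 1" for y d
    using mult_mono[OF bound(1)[of y] Suc.prems(2)[of d]] by (simp add: abs_mult)
  have below: "(\<integral>\<omega>. (if ?Z \<omega> \<le> ?D \<omega> then \<phi> (?M \<omega>) * \<psi> (?D \<omega> - ?Z \<omega>) else 0) \<partial>P 0) =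
      (\<integral>\<omega>. \<phi> (?M \<omega>) * step_below ?\<mu> \<psi> (?D \<omega>) \<partial>P 0)"
  proof -
    have "(\<integral>\<omega>. (if ?Z \<omega> \<le> ?D \<omega> then \<phi> (?M \<omega>) * \<psi> (?D \<omega> - ?Z \<omega>) else 0) \<partial>P 0) =
      (\<integral>\<omega>. \<integral>z. (if z \<le> ?D \<omega> then \<phi> (?M \<omega>) * \<psi> (?D \<omega> - z) else 0) \<partial>?\<mu> \<partial>P 0)"
      by (rule walk_step_law[where C = 1]) (auto simp: prod_bound split_beta')
    also have "\<dots> = (\<integral>\<omega>. \<phi> (?M \<omega>) * step_below ?\<mu> \<psi> (?D \<omega>) \<partial>P 0)"
      unfolding step_below_def
      by (intro Bochner_Integration.integral_cong refl, subst integral_mult_right_zero[symmetric],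
          intro Bochner_Integration.integral_cong refl) simp
    finally show ?thesis .
  qed
  have ladder_Suc: "(\<integral>\<omega>. (if ?D \<omega> < ?Z \<omega> then \<phi> (walk_max n (Suc k) \<omega>) * \<psi> 0 else 0) \<partial>P 0) =
      ladder n \<phi> (Suc k) * \<psi> 0"
    unfolding ladder_def nat.case
    by (subst integral_mult_left_zero[symmetric], intro Bochner_Integration.integral_cong refl) simp
  have "(\<integral>\<omega>. \<phi> (walk_max n (Suc k) \<omega>) * \<psi> (walk_drawdown n (Suc k) \<omega>) \<partial>P 0) =
      (\<integral>\<omega>. (if ?Z \<omega> \<le> ?D \<omega> then \<phi> (?M \<omega>) * \<psi> (?D \<omega> - ?Z \<omega>) else 0) +
        (if ?D \<omega> < ?Z \<omega> then \<phi> (walk_max n (Suc k) \<omega>) * \<psi> 0 else 0) \<partial>P 0)"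
    by (intro Bochner_Integration.integral_cong) (auto simp: walk_Suc max_def)
  also have "\<dots> = (\<integral>\<omega>. \<phi> (?M \<omega>) * step_below ?\<mu> \<psi> (?D \<omega>) \<partial>P 0) + ladder n \<phi> (Suc k) * \<psi> 0"
    unfolding below[symmetric] ladder_Suc[symmetric]
    by (rule Bochner_Integration.integral_add)
      (rule integrable_const_bound[where B = 1], use prod_bound in auto)+
  also have "(\<integral>\<omega>. \<phi> (?M \<omega>) * step_below ?\<mu> \<psi> (?D \<omega>) \<partial>P 0) =
      (\<Sum>i\<le>k. ladder n \<phi> i * (step_below ?\<mu> ^^ (k - i)) (step_below ?\<mu> \<psi>) 0)"
    by (rule Suc.IH[OF step(1,2)])
  also have "\<dots> = (\<Sum>i\<le>k. ladder n \<phi> i * (step_below ?\<mu> ^^ (Suc k - i)) \<psi> 0)"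
    by (intro sum.cong) (auto simp: Suc_diff_le funpow_Suc_right simp del: funpow.simps)
  finally show ?case by simp
qed

text \<open>
  Time reversal, without reversing time: the drawdown after one more step at the end and the depth
  of the minimum after one more step at the beginning are obtained from the shorter walk by the same
  reflected step. For the depth, the walk after its first step is fresh by the Markov property.
\<close>

lemma drawdown_depth_law:
  fixes \<psi> :: "real \<Rightarrow> real"
  assumes "\<psi> \<in> borel_measurable borel" "\<And>y. \<bar>\<psi> y\<bar> \<le> 1"
  shows "(\<integral>\<omega>. \<psi> (walk_drawdown n k \<omega>) \<partial>P 0) = (\<integral>\<omega>. \<psi> (walk_depth n k \<omega>) \<partial>P 0)"
  using assms
proof (induction k arbitrary: \<psi>)
  case (Suc k)
  note [measurable] = Suc.prems(1)
  let ?\<mu> = "increment_law (grid n 1)" and ?L = "path_increments_law"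
  have \<mu>: "prob_space ?\<mu>" by (rule prob_space_increment_law) simp
  interpret \<mu>: prob_space ?\<mu> by fact
  have L: "prob_space ?L"
    unfolding path_increments_law_def by (rule prob_space_distr) (rule measurable_shift_path, simp)
  interpret L: prob_space ?L by fact
  interpret \<mu>L: pair_prob_space ?\<mu> ?L ..
  note step = bounded_step[OF \<mu> sets_increment_law Suc.prems]
  note step(3) [measurable]
  have depth [measurable]: "(\<lambda>p. grid_max (\<lambda>t. - p t) n k) \<in> borel_measurable (path_space {0..})"
    by (intro measurable_grid_max borel_measurable_uminus measurable_component_singleton) simp
  have sets_L [measurable_cong]: "sets ?L = sets (path_space {0..})"
    by (simp add: path_increments_law_def)
  have [measurable]: "(\<lambda>x. grid_max (\<lambda>t. - snd x t) n k) \<in> borel_measurable (?\<mu> \<Otimes>\<^sub>M ?L)"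
    by (rule measurable_compose[OF _ depth]) measurable
  have "(\<integral>\<omega>. \<psi> (walk_drawdown n (Suc k) \<omega>) \<partial>P 0) =
      (\<integral>\<omega>. \<integral>z. \<psi> (max (walk_drawdown n k \<omega> - z) 0) \<partial>?\<mu> \<partial>P 0)"
    unfolding walk_Suc by (rule walk_step_law[where C = 1]) (auto simp: Suc.prems split_beta')
  also have "\<dots> = (\<integral>\<omega>. step_reflected ?\<mu> \<psi> (walk_drawdown n k \<omega>) \<partial>P 0)"
    unfolding step_reflected_def by (rule refl)
  also have "\<dots> = (\<integral>\<omega>. step_reflected ?\<mu> \<psi> (walk_depth n k \<omega>) \<partial>P 0)"
    by (rule Suc.IH[OF step(3,4)])
  also have "\<dots> = (\<integral>p. step_reflected ?\<mu> \<psi> (grid_max (\<lambda>t. - p t) n k) \<partial>?L)"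
  proof -
    have "walk_depth n k \<omega> = grid_max (\<lambda>t. - shift_path 0 \<omega> t) n k" for \<omega>
      by (simp add: walk_depth_def path_def grid_max_def)
    then show ?thesis
      unfolding path_increments_law_def
      using integral_distr[OF measurable_shift_path[of 0 0] measurable_compose[OF depth step(3)]] by simp
  qed
  also have "\<dots> = (\<integral>(z, p). \<psi> (max (grid_max (\<lambda>t. - p t) n k - z) 0) \<partial>(?\<mu> \<Otimes>\<^sub>M ?L))"
  proof -
    have "integrable (?\<mu> \<Otimes>\<^sub>M ?L) (\<lambda>(z, p). \<psi> (max (grid_max (\<lambda>t. - p t) n k - z) 0))"
    proof (rule \<mu>L.integrable_const_bound)
      show "AE y in ?\<mu> \<Otimes>\<^sub>M ?L. norm (case y of (z, p) \<Rightarrow> \<psi> (max (grid_max (\<lambda>t. - p t) n k - z) 0)) \<le> 1"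
        using Suc.prems(2) by (simp add: split_beta')
      show "(\<lambda>(z, p). \<psi> (max (grid_max (\<lambda>t. - p t) n k - z) 0)) \<in> borel_measurable (?\<mu> \<Otimes>\<^sub>M ?L)"
        unfolding split_beta' by measurable
    qed
    from \<mu>L.integral_snd[OF this] show ?thesis unfolding step_reflected_def by simp
  qed
  also have "?\<mu> \<Otimes>\<^sub>M ?L = distr (P 0) (borel \<Otimes>\<^sub>M path_space {0..})
      (\<lambda>\<omega>. (X (grid n 1) \<omega> - X 0 \<omega>, shift_path (grid n 1) \<omega>))"
  proof -
    have "(\<lambda>\<omega>. X (grid n 1) \<omega> - X 0 \<omega>) \<in> borel_measurable (F (grid n 1))"
      by (intro borel_measurable_diff adapted) auto
    from markov[OF grid_nonneg this, of 0] show ?thesis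
      unfolding path_increments_law_eq[symmetric] increment_law_def by simp
  qed
  also have "(\<integral>(z, p). \<psi> (max (grid_max (\<lambda>t. - p t) n k - z) 0) \<partial>\<dots>) =
      (\<integral>\<omega>. \<psi> (max (grid_max (\<lambda>t. - shift_path (grid n 1) \<omega> t) n k - (X (grid n 1) \<omega> - X 0 \<omega>)) 0) \<partial>P 0)"
    by (subst integral_distr)
      (auto intro!: measurable_Pair measurable_shift_path borel_measurable_diff measurable_X simp: split_beta')
  also have "\<dots> = (\<integral>\<omega>. \<psi> (walk_depth n (Suc k) \<omega>) \<partial>P 0)"
  proof (intro Bochner_Integration.integral_cong refl arg_cong[where f = \<psi>])
    fix \<omega>
    let ?p = "\<lambda>t. X 0 \<omega> - X t \<omega>"
    have "(MAX j\<in>{..k}. ?p (grid n (Suc j))) =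
        (MAX j\<in>{..k}. - shift_path (grid n 1) \<omega> (grid n j) + - (X (grid n 1) \<omega> - X 0 \<omega>))"
    proof (intro arg_cong[where f = Max] image_cong refl)
      fix j
      show "?p (grid n (Suc j)) = - shift_path (grid n 1) \<omega> (grid n j) + - (X (grid n 1) \<omega> - X 0 \<omega>)"
        using grid_add[of n 1 j] by (simp add: path_def)
    qed
    also have "\<dots> = grid_max (\<lambda>t. - shift_path (grid n 1) \<omega> t) n k + - (X (grid n 1) \<omega> - X 0 \<omega>)"
      unfolding grid_max_def by (rule Max_add_commute) auto
    finally have "grid_max (\<lambda>t. - shift_path (grid n 1) \<omega> t) n k - (X (grid n 1) \<omega> - X 0 \<omega>) =
        (MAX j\<in>{..k}. ?p (grid n (Suc j)))" by simp
    moreover have "{..Suc k} = insert 0 (Suc ` {..k})" by (rule atMost_Suc_eq_insert_0)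
    then have "walk_depth n (Suc k) \<omega> = max 0 (MAX j\<in>{..k}. ?p (grid n (Suc j)))"
      unfolding walk_depth_def grid_max_def by (simp add: image_image)
    ultimately show "max (grid_max (\<lambda>t. - shift_path (grid n 1) \<omega> t) n k - (X (grid n 1) \<omega> - X 0 \<omega>)) 0 =
        walk_depth n (Suc k) \<omega>" by (simp add: max.commute)
  qed
  finally show ?case .
qed simp

end

section \<open>The Wiener--Hopf factorisation at an exponential time\<close>

lemma cts_step_tendsto:
  "(\<lambda>n. cts_step a (a + 1 / Suc n) x) \<longlonglongrightarrow> indicator {..a} x"
proof (cases "x \<le> a")
  case False
  then have "eventually (\<lambda>n. 1 / Suc n < x - a) sequentially"
    using order_tendstoD(2)[OF LIMSEQ_inverse_real_of_nat, of "x - a"] by (simp add: inverse_eq_divide)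
  then have "eventually (\<lambda>n. cts_step a (a + 1 / Suc n) x = 0) sequentially"
    by eventually_elim (use False in \<open>auto simp: cts_step_def\<close>)
  then show ?thesis using False by (simp add: tendsto_eventually)
qed (simp add: cts_step_def)

lemma cts_step_bounds: "a < b \<Longrightarrow> 0 \<le> cts_step a b x \<and> cts_step a b x \<le> 1"
  by (auto simp: cts_step_def)

lemma continuous_cts_step: "a < b \<Longrightarrow> continuous_on UNIV (cts_step a b)"
  by (intro uniformly_continuous_imp_continuous cts_step_uniformly_continuous)

lemma measure_eqI_quadrants:
  fixes M N :: "(real \<times> real) measure"
  assumes M: "sets M = sets (borel \<Otimes>\<^sub>M borel)" and N: "sets N = sets (borel \<Otimes>\<^sub>M borel)"
    and fin: "finite_measure M"
    and eq: "\<And>a b. emeasure M ({..a} \<times> {..b}) = emeasure N ({..a} \<times> {..b})"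
  shows "M = N"
proof (rule measure_eqI_generator_eq)
  have quad: "{..a} \<times> {..b} = {..(a, b)}" for a b :: real
    by (auto simp: less_eq_prod_def)
  let ?E = "range (\<lambda>c :: real \<times> real. {..c})"
  show "Int_stable ?E"
  proof (rule Int_stableI_image)
    fix c d :: "real \<times> real"
    show "\<exists>e\<in>UNIV. {..c} \<inter> {..d} = {..e}" by (intro bexI[of _ "inf c d"]) auto
  qed
  show "?E \<subseteq> Pow UNIV" by simp
  show "emeasure M A = emeasure N A" if "A \<in> ?E" for A
    using that eq by (auto simp: quad)
  have "sets (borel :: (real \<times> real) measure) = sigma_sets UNIV ?E"
    by (subst borel_eq_atMost) simp
  then show "sets M = sigma_sets UNIV ?E" "sets N = sigma_sets UNIV ?E"
    unfolding M N borel_prod by simp_all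
  show "range (\<lambda>n. {..(real n, real n)}) \<subseteq> ?E" by auto
  show "(\<Union>n. {..(real n, real n)}) = UNIV"
  proof -
    have "\<exists>n. a \<le> real n \<and> b \<le> real n" for a b :: real
      using real_arch_simple[of "max a b"] by auto
    then show ?thesis by (auto simp: less_eq_prod_def)
  qed
  show "emeasure M {..(real n, real n)} \<noteq> \<infinity>" for n
    using finite_measure.emeasure_finite[OF fin] by auto
qed

locale levy_exp = levy_measures +
  fixes r :: real
  assumes r: "0 < r"
begin

sublocale E: prob_space "exp_law r"
  unfolding exp_law_def using r by (rule prob_space_exponential_density)

sublocale B: pair_prob_space "P x" "exp_law r" for x ..

text \<open>
  The product space carries an exponential time that is independent of everything else. On it,
  discounted time integrals are expectations at that time by Fubini's theorem.
\<close>

abbreviation \<B> :: "real \<Rightarrow> ('a \<times> real) measure" where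
  "\<B> x \<equiv> P x \<Otimes>\<^sub>M exp_law r"

lemma AE_time_pos: "AE z in \<B> x. fst z \<in> space (P x) \<and> 0 < snd z"
proof -
  have "AE z in \<B> x. 0 < snd z"
  proof (rule B.AE_pair_measure)
    show "{z \<in> space (\<B> x). 0 < snd z} \<in> sets (\<B> x)" by measurable
    show "AE \<omega> in P x. AE t in exp_law r. 0 < snd (\<omega>, t)"
      using AE_exp_law_pos[of r] by simp
  qed
  then show ?thesis using AE_space by eventually_elim (auto simp: space_pair_measure)
qed

lemma measurable_X_fst: "0 \<le> s \<Longrightarrow> (\<lambda>z. X s (fst z)) \<in> borel_measurable (\<B> x)"
  by (intro measurable_compose[OF measurable_fst] measurable_X)

lemma measurable_path_functionals [measurable]:
  "(\<lambda>z. path_sup (\<lambda>s. X s (fst z) - X 0 (fst z)) (snd z)) \<in> borel_measurable (\<B> x)"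
  "(\<lambda>z. path_sup (\<lambda>s. X 0 (fst z) - X s (fst z)) (snd z)) \<in> borel_measurable (\<B> x)"
  "(\<lambda>z. path_val (\<lambda>s. X s (fst z) - X 0 (fst z)) (snd z)) \<in> borel_measurable (\<B> x)"
  by (intro measurable_path_sup measurable_path_val borel_measurable_diff measurable_X_fst; simp)+

lemma measurable_walk_cell [measurable]:
  "(\<lambda>z. walk_max n (cell n (snd z)) (fst z)) \<in> borel_measurable (\<B> x)"
  "(\<lambda>z. walk_drawdown n (cell n (snd z)) (fst z)) \<in> borel_measurable (\<B> x)"
  "(\<lambda>z. walk_depth n (cell n (snd z)) (fst z)) \<in> borel_measurable (\<B> x)"
proof -
  have [measurable]: "(\<lambda>z. cell n (snd z)) \<in> measurable (\<B> x) (count_space UNIV)" by measurable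
  show "(\<lambda>z. walk_max n (cell n (snd z)) (fst z)) \<in> borel_measurable (\<B> x)"
    by (rule measurable_compose_countable[where f = "\<lambda>k z. walk_max n k (fst z)"]) measurable
  show "(\<lambda>z. walk_drawdown n (cell n (snd z)) (fst z)) \<in> borel_measurable (\<B> x)"
    by (rule measurable_compose_countable[where f = "\<lambda>k z. walk_drawdown n k (fst z)"]) measurable
  show "(\<lambda>z. walk_depth n (cell n (snd z)) (fst z)) \<in> borel_measurable (\<B> x)"
    by (rule measurable_compose_countable[where f = "\<lambda>k z. walk_depth n k (fst z)"]) measurable
qed

text \<open>
  The number of steps \<open>cell n t - 1\<close> is geometric. Weighting \<open>split_at_maximum\<close> with \<open>q\<^sup>k\<close> and summing
  over \<open>k\<close> gives a Cauchy product, in which the contributions of \<open>\<phi>\<close> and \<open>\<psi>\<close> separate. Setting \<open>\<phi>\<close>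
  or \<open>\<psi>\<close> to one identifies the factors as the marginals up to constants, whose product is one.
\<close>

lemma wiener_hopf_grid:
  fixes \<phi> \<psi> :: "real \<Rightarrow> real"
  assumes meas [measurable]: "\<phi> \<in> borel_measurable borel" "\<psi> \<in> borel_measurable borel"
    and bound: "\<And>y. \<bar>\<phi> y\<bar> \<le> 1" "\<And>y. \<bar>\<psi> y\<bar> \<le> 1"
  shows "(\<integral>t. (\<integral>\<omega>. \<phi> (walk_max n (cell n t - 1) \<omega>) * \<psi> (walk_drawdown n (cell n t - 1) \<omega>) \<partial>P 0) \<partial>exp_law r) =
    (\<integral>t. (\<integral>\<omega>. \<phi> (walk_max n (cell n t - 1) \<omega>) \<partial>P 0) \<partial>exp_law r) *
    (\<integral>t. (\<integral>\<omega>. \<psi> (walk_depth n (cell n t - 1) \<omega>) \<partial>P 0) \<partial>exp_law r)"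
proof -
  define q where "q = exp (- r * grid n 1)"
  have q: "0 < q" "q < 1" using r by (auto simp: q_def grid_def)
  let ?\<mu> = "increment_law (grid n 1)"
  have \<mu>: "prob_space ?\<mu>" by (rule prob_space_increment_law) simp
  define b where "b \<psi> m = (step_below ?\<mu> ^^ m) \<psi> 0" for \<psi> m
  define W where "W \<phi> \<psi> = (\<integral>t. (\<integral>\<omega>. \<phi> (walk_max n (cell n t - 1) \<omega>) *
      \<psi> (walk_drawdown n (cell n t - 1) \<omega>) \<partial>P 0) \<partial>exp_law r)" for \<phi> \<psi> :: "real \<Rightarrow> real"
  have avg: "\<bar>\<integral>\<omega>. h \<omega> \<partial>P 0\<bar> \<le> 1"
    if [measurable]: "h \<in> borel_measurable (P 0)" and h: "\<And>z. \<bar>h z\<bar> \<le> 1" for h :: "'a \<Rightarrow> real"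
    by (rule order_trans[OF integral_abs_bound integral_le_const])
      (auto intro!: integrable_const_bound[where B = 1] h)
  have ladder_bound: "\<bar>ladder n \<phi> i\<bar> \<le> 1"
    if [measurable]: "\<phi> \<in> borel_measurable borel" and "\<And>y. \<bar>\<phi> y\<bar> \<le> 1" for \<phi> i
    using that(2) unfolding ladder_def by (cases i) (auto intro!: avg)
  have step: "(step_below ?\<mu> ^^ m) \<psi> \<in> borel_measurable borel \<and> (\<forall>y. \<bar>(step_below ?\<mu> ^^ m) \<psi> y\<bar> \<le> 1)"
    if "\<psi> \<in> borel_measurable borel" "\<And>y. \<bar>\<psi> y\<bar> \<le> 1" for \<psi> m
    by (induction m) (use that bounded_step(1,2)[OF \<mu> sets_increment_law] in auto)
  have b_bound: "\<bar>b \<psi> m\<bar> \<le> 1"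
    if "\<psi> \<in> borel_measurable borel" "\<And>y. \<bar>\<psi> y\<bar> \<le> 1" for \<psi> m
    using step[OF that] by (simp add: b_def)
  have summable: "summable (\<lambda>i. norm (q ^ i * h i))" if "\<And>i. \<bar>h i\<bar> \<le> 1" for h :: "nat \<Rightarrow> real"
  proof (rule summable_comparison_test')
    show "summable (\<lambda>i. q ^ i)" using q by (intro summable_geometric) auto
    show "norm (norm (q ^ i * h i)) \<le> q ^ i" for i
      using that[of i] q by (simp add: abs_mult mult_left_le)
  qed
  define A where "A \<phi> = (\<Sum>i. q ^ i * ladder n \<phi> i)" for \<phi>
  define B where "B \<psi> = (\<Sum>m. q ^ m * b \<psi> m)" for \<psi>
  have W: "W \<phi> \<psi> = (1 - q) * A \<phi> * B \<psi>"
    if [measurable]: "\<phi> \<in> borel_measurable borel" "\<psi> \<in> borel_measurable borel"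
      and bd: "\<And>y. \<bar>\<phi> y\<bar> \<le> 1" "\<And>y. \<bar>\<psi> y\<bar> \<le> 1" for \<phi> \<psi>
  proof -
    let ?\<Phi> = "\<lambda>k. \<integral>\<omega>. \<phi> (walk_max n k \<omega>) * \<psi> (walk_drawdown n k \<omega>) \<partial>P 0"
    have prod_bound: "\<bar>\<phi> y * \<psi> d\<bar> \<le> 1" for y d
      using mult_mono[OF bd(1)[of y] bd(2)[of d]] by (simp add: abs_mult)
    have "(\<lambda>k. (1 - q) * q ^ k * ?\<Phi> k) sums W \<phi> \<psi>"
      unfolding W_def q_def
      by (rule geometric_series_cell[OF r, of ?\<Phi> 1]) (intro avg, measurable, rule prod_bound)
    moreover have "(\<lambda>k. \<Sum>i\<le>k. (q ^ i * ladder n \<phi> i) * (q ^ (k - i) * b \<psi> (k - i))) sums (A \<phi> * B \<psi>)"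
      unfolding A_def B_def
      by (intro Cauchy_product_sums summable ladder_bound b_bound that)
    then have "(\<lambda>k. (1 - q) * (\<Sum>i\<le>k. (q ^ i * ladder n \<phi> i) * (q ^ (k - i) * b \<psi> (k - i)))) sums
        ((1 - q) * (A \<phi> * B \<psi>))"
      by (rule sums_mult)
    moreover have "(\<Sum>i\<le>k. (q ^ i * ladder n \<phi> i) * (q ^ (k - i) * b \<psi> (k - i))) = q ^ k * ?\<Phi> k" for k
    proof -
      have "(\<Sum>i\<le>k. (q ^ i * ladder n \<phi> i) * (q ^ (k - i) * b \<psi> (k - i))) =
          (\<Sum>i\<le>k. q ^ k * (ladder n \<phi> i * b \<psi> (k - i)))"
      proof (rule sum.cong)
        fix i assume "i \<in> {..k}"
        then have "q ^ k = q ^ i * q ^ (k - i)" by (simp add: power_add[symmetric])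
        then show "(q ^ i * ladder n \<phi> i) * (q ^ (k - i) * b \<psi> (k - i)) = q ^ k * (ladder n \<phi> i * b \<psi> (k - i))"
          by simp
      qed simp
      then show ?thesis
        unfolding split_at_maximum[OF that] b_def by (simp add: sum_distrib_left)
    qed
    ultimately have "(\<lambda>k. (1 - q) * q ^ k * ?\<Phi> k) sums ((1 - q) * (A \<phi> * B \<psi>))"
      by (simp add: mult.assoc)
    then show ?thesis using \<open>_ sums W \<phi> \<psi>\<close> sums_unique2 by (simp add: mult.assoc) blast
  qed
  have one: "(\<lambda>_. 1) \<in> borel_measurable (borel :: real measure)" "\<And>y :: real. \<bar>1 :: real\<bar> \<le> 1"
    by simp_all
  have "W (\<lambda>_. 1) (\<lambda>_. 1) = 1"
    unfolding W_def by (simp add: prob_space E.prob_space[simplified])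
  then have "W \<phi> \<psi> = W \<phi> (\<lambda>_. 1) * W (\<lambda>_. 1) \<psi>"
    unfolding W[OF meas bound] W[OF meas(1) one(1) bound(1) one(2)]
      W[OF one(1) meas(2) one(2) bound(2)] W[OF one(1,1,2,2)]
    by (metis (no_types, lifting) mult.assoc mult.commute mult.right_neutral)
  then show ?thesis
    unfolding W_def by (simp add: drawdown_depth_law[OF meas(2) bound(2)])
qed

lemma cadlag_recentred:
  assumes "\<omega> \<in> space (P x)"
  shows "cadlag (\<lambda>s. X s \<omega> - X 0 \<omega>)" "cadlag (\<lambda>s. X 0 \<omega> - X s \<omega>)"
proof -
  show c: "cadlag (\<lambda>s. X s \<omega> - X 0 \<omega>)"
    using cadlag_increment[OF cadlag_X[OF assms], of 0 "X 0 \<omega>"] by simp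
  show "cadlag (\<lambda>s. X 0 \<omega> - X s \<omega>)"
    using cadlag_minus[OF c] by simp
qed

lemma walk_tendsto:
  assumes \<omega>: "\<omega> \<in> space (P x)" and t: "0 < t"
  shows "(\<lambda>n. walk_max n (cell n t) \<omega>) \<longlonglongrightarrow> path_sup (\<lambda>s. X s \<omega> - X 0 \<omega>) t"
    and "(\<lambda>n. walk_drawdown n (cell n t) \<omega>) \<longlonglongrightarrow>
      path_sup (\<lambda>s. X s \<omega> - X 0 \<omega>) t - path_val (\<lambda>s. X s \<omega> - X 0 \<omega>) t"
    and "(\<lambda>n. walk_depth n (cell n t) \<omega>) \<longlonglongrightarrow> path_sup (\<lambda>s. X 0 \<omega> - X s \<omega>) t"
proof -
  have t': "0 \<le> t" using t by simp
  note c = cadlag_recentred[OF \<omega>]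
  show 1: "(\<lambda>n. walk_max n (cell n t) \<omega>) \<longlonglongrightarrow> path_sup (\<lambda>s. X s \<omega> - X 0 \<omega>) t"
    unfolding walk_max_def path_sup_cadlag[OF c(1) t'] by (rule grid_max_tendsto[OF c(1) t'])
  show "(\<lambda>n. walk_depth n (cell n t) \<omega>) \<longlonglongrightarrow> path_sup (\<lambda>s. X 0 \<omega> - X s \<omega>) t"
    unfolding walk_depth_def path_sup_cadlag[OF c(2) t'] by (rule grid_max_tendsto[OF c(2) t'])
  show "(\<lambda>n. walk_drawdown n (cell n t) \<omega>) \<longlonglongrightarrow>
      path_sup (\<lambda>s. X s \<omega> - X 0 \<omega>) t - path_val (\<lambda>s. X s \<omega> - X 0 \<omega>) t"
    unfolding walk_drawdown_def path_val_cadlag[OF c(1) t']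
    by (intro tendsto_diff 1 cadlag_grid_cell_tendsto[OF c(1) t'])
qed

text \<open>
  The factorisation holds for the geometric index \<open>cell n t - 1\<close>, whose grid point lies to the left of
  \<open>t\<close>, whereas right continuity of the paths requires the index \<open>cell n t\<close>. By \<open>integral_cell\<close>
  the two mixtures differ by terms that vanish with the mesh.
\<close>

lemma grid_mixture_tendsto:
  fixes f :: "nat \<Rightarrow> nat \<Rightarrow> 'a \<Rightarrow> real"
  assumes meas [measurable]: "\<And>n k. f n k \<in> borel_measurable (P 0)"
    and meas_h [measurable]: "h \<in> borel_measurable (\<B> 0)"
    and bound: "\<And>n k \<omega>. \<bar>f n k \<omega>\<bar> \<le> 1"
    and conv: "\<And>\<omega> t. \<omega> \<in> space (P 0) \<Longrightarrow> 0 < t \<Longrightarrow> (\<lambda>n. f n (cell n t) \<omega>) \<longlonglongrightarrow> h (\<omega>, t)"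
  shows "(\<lambda>n. \<integral>t. (\<integral>\<omega>. f n (cell n t - 1) \<omega> \<partial>P 0) \<partial>exp_law r) \<longlonglongrightarrow> (\<integral>z. h z \<partial>\<B> 0)"
proof -
  define q where "q n = exp (- r * grid n 1)" for n
  have avg: "\<bar>\<integral>\<omega>. f n k \<omega> \<partial>P 0\<bar> \<le> 1" for n k
    by (rule order_trans[OF integral_abs_bound integral_le_const])
      (auto intro!: integrable_const_bound[where B = 1] bound)
  have [measurable]: "(\<lambda>z. f n (cell n (snd z)) (fst z)) \<in> borel_measurable (\<B> 0)" for n
    by (rule measurable_compose_countable[where f = "\<lambda>k z. f n k (fst z)"]) measurable
  have int: "integrable (\<B> 0) (\<lambda>z. f n (cell n (snd z)) (fst z))" for n
    by (rule B.integrable_const_bound[where B = 1]) (auto simp: bound)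
  have iterated: "(\<integral>t. (\<integral>\<omega>. f n (cell n t) \<omega> \<partial>P 0) \<partial>exp_law r) = (\<integral>z. f n (cell n (snd z)) (fst z) \<partial>\<B> 0)" for n
    using B.integral_snd[where f = "\<lambda>\<omega> t. f n (cell n t) \<omega>"] int[of n] by (simp add: split_beta')
  have "(\<lambda>n. grid n 1) \<longlonglongrightarrow> 0"
    using LIMSEQ_power_zero[of "1 / 2 :: real"] by (simp add: grid_def power_divide)
  then have "q \<longlonglongrightarrow> exp (- r * 0)"
    unfolding q_def by (intro tendsto_intros)
  then have q: "q \<longlonglongrightarrow> 1" by simp
  have lim: "(\<lambda>n. \<integral>z. f n (cell n (snd z)) (fst z) \<partial>\<B> 0) \<longlonglongrightarrow> (\<integral>z. h z \<partial>\<B> 0)"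
  proof (rule integral_dominated_convergence[where w = "\<lambda>_. 1"])
    show "AE z in \<B> 0. (\<lambda>n. f n (cell n (snd z)) (fst z)) \<longlonglongrightarrow> h z"
      using AE_time_pos[of 0] by eventually_elim (use conv in \<open>metis prod.collapse\<close>)
  qed (auto simp: bound)
  have le: "norm ((1 - q n) * (\<integral>\<omega>. f n 0 \<omega> \<partial>P 0)) \<le> \<bar>1 - q n\<bar>" for n
    using avg[of n 0] by (simp add: abs_mult mult_left_le)
  have null: "(\<lambda>n. \<bar>1 - q n\<bar>) \<longlonglongrightarrow> 0"
    using tendsto_rabs[OF tendsto_diff[OF tendsto_const[of 1] q]] by simp
  have "(\<lambda>n. (1 - q n) * (\<integral>\<omega>. f n 0 \<omega> \<partial>P 0)) \<longlonglongrightarrow> 0"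
    by (rule Lim_null_comparison[OF always_eventually null]) (intro allI le)
  from tendsto_add[OF this tendsto_mult[OF q lim]]
  have "(\<lambda>n. (1 - q n) * (\<integral>\<omega>. f n 0 \<omega> \<partial>P 0) +
      q n * (\<integral>z. f n (cell n (snd z)) (fst z) \<partial>\<B> 0)) \<longlonglongrightarrow> (\<integral>z. h z \<partial>\<B> 0)" by simp
  moreover have "(\<integral>t. (\<integral>\<omega>. f n (cell n t - 1) \<omega> \<partial>P 0) \<partial>exp_law r) =
      (1 - q n) * (\<integral>\<omega>. f n 0 \<omega> \<partial>P 0) + q n * (\<integral>z. f n (cell n (snd z)) (fst z) \<partial>\<B> 0)" for n
    unfolding iterated[symmetric] q_def by (rule integral_cell[OF r avg])
  ultimately show ?thesis by simp
qed

definition sup_law :: "real measure" where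
  "sup_law = distr (\<B> 0) borel (\<lambda>z. path_sup (\<lambda>s. X s (fst z) - X 0 (fst z)) (snd z))"

definition depth_law :: "real measure" where
  "depth_law = distr (\<B> 0) borel (\<lambda>z. path_sup (\<lambda>s. X 0 (fst z) - X s (fst z)) (snd z))"

lemma sets_sup_law [simp, measurable_cong]: "sets sup_law = sets borel"
  by (simp add: sup_law_def)

lemma sets_depth_law [simp, measurable_cong]: "sets depth_law = sets borel"
  by (simp add: depth_law_def)

lemma space_laws [simp]: "space sup_law = UNIV" "space depth_law = UNIV"
  by (simp_all add: sup_law_def depth_law_def)

sublocale S: prob_space sup_law
  unfolding sup_law_def by (intro B.prob_space_distr) simp

sublocale D: prob_space depth_law
  unfolding depth_law_def by (intro B.prob_space_distr) simp

sublocale SD: pair_prob_space sup_law depth_law ..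

lemma wiener_hopf_continuous:
  fixes \<phi> \<psi> :: "real \<Rightarrow> real"
  assumes cont: "continuous_on UNIV \<phi>" "continuous_on UNIV \<psi>"
    and bound: "\<And>y. \<bar>\<phi> y\<bar> \<le> 1" "\<And>y. \<bar>\<psi> y\<bar> \<le> 1"
  shows "(\<integral>z. \<phi> (path_sup (\<lambda>s. X s (fst z) - X 0 (fst z)) (snd z)) *
      \<psi> (path_sup (\<lambda>s. X s (fst z) - X 0 (fst z)) (snd z) -
         path_val (\<lambda>s. X s (fst z) - X 0 (fst z)) (snd z)) \<partial>\<B> 0) =
    (\<integral>s. \<phi> s \<partial>sup_law) * (\<integral>d. \<psi> d \<partial>depth_law)" (is "integral\<^sup>L _ ?h = _")
proof -
  have meas [measurable]: "\<phi> \<in> borel_measurable borel" "\<psi> \<in> borel_measurable borel"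
    using cont by (auto intro: borel_measurable_continuous_onI)
  have comp: "(\<lambda>n. \<phi> (u n)) \<longlonglongrightarrow> \<phi> l" "(\<lambda>n. \<psi> (u n)) \<longlonglongrightarrow> \<psi> l" if "u \<longlonglongrightarrow> l" for u l
    using continuous_on_tendsto_compose[OF cont(1) that] continuous_on_tendsto_compose[OF cont(2) that]
    by auto
  have prod_bound: "\<bar>\<phi> y * \<psi> d\<bar> \<le> 1" for y d
    using mult_mono[OF bound(1)[of y] bound(2)[of d]] by (simp add: abs_mult)
  have L1: "(\<lambda>n. \<integral>t. (\<integral>\<omega>. \<phi> (walk_max n (cell n t - 1) \<omega>) * \<psi> (walk_drawdown n (cell n t - 1) \<omega>) \<partial>P 0)
      \<partial>exp_law r) \<longlonglongrightarrow> integral\<^sup>L (\<B> 0) ?h"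
    by (rule grid_mixture_tendsto)
      (auto intro!: tendsto_mult comp walk_tendsto simp: prod_bound)
  have L2: "(\<lambda>n. \<integral>t. (\<integral>\<omega>. \<phi> (walk_max n (cell n t - 1) \<omega>) \<partial>P 0) \<partial>exp_law r) \<longlonglongrightarrow>
      (\<integral>z. \<phi> (path_sup (\<lambda>s. X s (fst z) - X 0 (fst z)) (snd z)) \<partial>\<B> 0)"
    by (rule grid_mixture_tendsto) (auto intro!: comp walk_tendsto simp: bound)
  have L3: "(\<lambda>n. \<integral>t. (\<integral>\<omega>. \<psi> (walk_depth n (cell n t - 1) \<omega>) \<partial>P 0) \<partial>exp_law r) \<longlonglongrightarrow>
      (\<integral>z. \<psi> (path_sup (\<lambda>s. X 0 (fst z) - X s (fst z)) (snd z)) \<partial>\<B> 0)"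
    by (rule grid_mixture_tendsto) (auto intro!: comp walk_tendsto simp: bound)
  have "integral\<^sup>L (\<B> 0) ?h =
      (\<integral>z. \<phi> (path_sup (\<lambda>s. X s (fst z) - X 0 (fst z)) (snd z)) \<partial>\<B> 0) *
      (\<integral>z. \<psi> (path_sup (\<lambda>s. X 0 (fst z) - X s (fst z)) (snd z)) \<partial>\<B> 0)"
    by (rule LIMSEQ_unique[OF L1]) (unfold wiener_hopf_grid[OF meas bound], rule tendsto_mult[OF L2 L3])
  then show ?thesis
    unfolding sup_law_def depth_law_def
    by (subst (1 2) integral_distr) simp_all
qed

end

context levy_exp
begin

text \<open>
  Continuous steps that decrease to the indicators of half-lines extend the factorisation from
  continuous test functions to quadrants, hence to all events.
\<close>

theorem wiener_hopf_sup_drawdown: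
  "distr (\<B> 0) (borel \<Otimes>\<^sub>M borel) (\<lambda>z. (path_sup (\<lambda>s. X s (fst z) - X 0 (fst z)) (snd z),
      path_sup (\<lambda>s. X s (fst z) - X 0 (fst z)) (snd z) - path_val (\<lambda>s. X s (fst z) - X 0 (fst z)) (snd z))) =
    sup_law \<Otimes>\<^sub>M depth_law" (is "?J = _" is "distr _ _ (\<lambda>z. (?S z, ?S z - ?V z)) = _")
proof (rule measure_eqI_quadrants)
  interpret Q: prob_space "?J"
    by (intro B.prob_space_distr) simp
  show "finite_measure ?J"
    by unfold_locales
  show "sets (sup_law \<Otimes>\<^sub>M depth_law) = sets (borel \<Otimes>\<^sub>M borel)"
    by (intro sets_pair_measure_cong) simp_all
  fix a b :: real
  \<comment> \<open>Continuous functions that decrease to the indicators of the two half-lines.\<close>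
  define \<phi> where "\<phi> n = cts_step a (a + 1 / Suc n)" for n
  define \<psi> where "\<psi> n = cts_step b (b + 1 / Suc n)" for n
  have cont: "continuous_on UNIV (\<phi> n)" "continuous_on UNIV (\<psi> n)" for n
    by (simp_all add: \<phi>_def \<psi>_def continuous_cts_step)
  then have [measurable]: "\<phi> n \<in> borel_measurable borel" "\<psi> n \<in> borel_measurable borel" for n
    by (auto intro: borel_measurable_continuous_onI)
  have bd: "0 \<le> \<phi> n y \<and> \<phi> n y \<le> 1" "0 \<le> \<psi> n y \<and> \<psi> n y \<le> 1" for n y
    unfolding \<phi>_def \<psi>_def by (rule cts_step_bounds, simp)+
  have lim: "(\<lambda>n. \<phi> n y) \<longlonglongrightarrow> indicator {..a} y" "(\<lambda>n. \<psi> n y) \<longlonglongrightarrow> indicator {..b} y" for y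
    unfolding \<phi>_def \<psi>_def by (rule cts_step_tendsto)+
  have prod_bd: "\<phi> n y * \<psi> n d \<le> 1" for n y d
    using mult_mono[of "\<phi> n y" 1 "\<psi> n d" 1] bd by simp
  have L1: "(\<lambda>n. \<integral>z. \<phi> n (?S z) * \<psi> n (?S z - ?V z) \<partial>\<B> 0) \<longlonglongrightarrow>
      (\<integral>z. indicat_real {..a} (?S z) * indicat_real {..b} (?S z - ?V z) \<partial>\<B> 0)"
    by (rule integral_dominated_convergence[where w = "\<lambda>_. 1"])
      (auto intro!: tendsto_mult lim simp: bd prod_bd)
  have L2: "(\<lambda>n. \<integral>s. \<phi> n s \<partial>sup_law) \<longlonglongrightarrow> (\<integral>s. indicator {..a} s \<partial>sup_law)"
    by (rule integral_dominated_convergence[where w = "\<lambda>_. 1"]) (auto intro!: lim simp: bd)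
  have L3: "(\<lambda>n. \<integral>d. \<psi> n d \<partial>depth_law) \<longlonglongrightarrow> (\<integral>d. indicator {..b} d \<partial>depth_law)"
    by (rule integral_dominated_convergence[where w = "\<lambda>_. 1"]) (auto intro!: lim simp: bd)
  have eq: "(\<integral>z. \<phi> n (?S z) * \<psi> n (?S z - ?V z) \<partial>\<B> 0) =
      (\<integral>s. \<phi> n s \<partial>sup_law) * (\<integral>d. \<psi> n d \<partial>depth_law)" for n
    by (rule wiener_hopf_continuous[OF cont]) (use bd in auto)
  have "(\<integral>z. indicat_real {..a} (?S z) * indicat_real {..b} (?S z - ?V z) \<partial>\<B> 0) =
      (\<integral>s. indicator {..a} s \<partial>sup_law) * (\<integral>d. indicator {..b} d \<partial>depth_law)"
    using LIMSEQ_unique[OF L1 tendsto_mult[OF L2 L3, folded eq]] .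
  moreover have "(\<integral>z. indicat_real {..a} (?S z) * indicator {..b} (?S z - ?V z) \<partial>\<B> 0) =
      (\<integral>y. indicator ({..a} \<times> {..b}) y \<partial>?J)"
    by (subst integral_distr) (auto intro!: Bochner_Integration.integral_cong simp: indicator_times)
  ultimately have "measure ?J ({..a} \<times> {..b}) =
      measure sup_law {..a} * measure depth_law {..b}"
    by simp
  then show "emeasure ?J ({..a} \<times> {..b}) =
      emeasure (sup_law \<Otimes>\<^sub>M depth_law) ({..a} \<times> {..b})"
    by (simp add: D.emeasure_pair_measure_Times Q.emeasure_eq_measure S.emeasure_eq_measure
        D.emeasure_eq_measure ennreal_mult)
qed simp


definition shift_sup :: "real \<Rightarrow> 'a \<times> real \<Rightarrow> real" where
  "shift_sup s z = path_sup (\<lambda>t. X (s + t) (fst z) - X s (fst z)) (snd z)"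

definition shift_val :: "real \<Rightarrow> 'a \<times> real \<Rightarrow> real" where
  "shift_val s z = path_val (\<lambda>t. X (s + t) (fst z) - X s (fst z)) (snd z)"

lemma measurable_shift_functionals [measurable]:
  assumes "0 \<le> s"
  shows "shift_sup s \<in> borel_measurable (\<B> x)" "shift_val s \<in> borel_measurable (\<B> x)"
  unfolding shift_sup_def[abs_def] shift_val_def[abs_def] using assms
  by (intro measurable_path_sup measurable_path_val borel_measurable_diff measurable_X_fst; simp)+

text \<open>
  By the Markov property the path after \<open>s\<close> may be replaced by an independent path started from
  zero; after exchanging the integrals the factorisation applies to the latter.
\<close>

theorem nn_integral_markov_wiener_hopf:
  assumes s: "0 \<le> s" and W: "W \<in> measurable (F s) N"
    and f [measurable]: "f \<in> borel_measurable (N \<Otimes>\<^sub>M (borel \<Otimes>\<^sub>M borel))"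
  shows "(\<integral>\<^sup>+z. f (W (fst z), (shift_sup s z, shift_sup s z - shift_val s z)) \<partial>\<B> x) =
    (\<integral>\<^sup>+\<omega>. \<integral>\<^sup>+y. f (W \<omega>, y) \<partial>(sup_law \<Otimes>\<^sub>M depth_law) \<partial>P x)"
proof -
  have W' [measurable]: "W \<in> measurable (P x) N" by (rule measurable_filtration[OF W])
  note measurable_shift_functionals[OF s, measurable]
  have shift [measurable]: "shift_path s \<in> measurable (P x) (path_space {0..})"
    by (rule measurable_shift_path[OF s])
  have shift0: "shift_path 0 \<in> measurable (P 0) (path_space {0..})"
    by (rule measurable_shift_path) simp
  define \<Psi> where "\<Psi> y = (path_sup (fst y) (snd y), path_sup (fst y) (snd y) - path_val (fst y) (snd y))" for y
  have coord: "(\<lambda>y. fst y u) \<in> borel_measurable (path_space {0..} \<Otimes>\<^sub>M borel)" if "0 \<le> u" for u :: real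
    using that by (intro measurable_compose[OF measurable_fst measurable_component_singleton]) auto
  have \<Psi> [measurable]: "\<Psi> \<in> measurable (path_space {0..} \<Otimes>\<^sub>M borel) (borel \<Otimes>\<^sub>M borel)"
    unfolding \<Psi>_def[abs_def]
    by (intro measurable_Pair borel_measurable_diff measurable_path_sup measurable_path_val coord measurable_snd)
  interpret L: prob_space "path_law (P 0) X" by (rule prob_space_distr) simp
  interpret W: prob_space "distr (P x) N W" by (rule prob_space_distr) simp
  interpret WE: pair_prob_space "distr (P x) N W" "exp_law r" ..
  have \<Psi>_shift: "\<Psi> (shift_path s \<omega>, t) = (shift_sup s (\<omega>, t), shift_sup s (\<omega>, t) - shift_val s (\<omega>, t))" for s \<omega> t
    by (simp add: \<Psi>_def shift_sup_def shift_val_def path_sup_path path_val_path)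
  \<comment> \<open>The factorisation for the path started from zero, which is the case \<open>s = 0\<close> under \<open>P 0\<close>.\<close>
  have inner: "(\<integral>\<^sup>+t. \<integral>\<^sup>+p. h (\<Psi> (p, t)) \<partial>path_law (P 0) X \<partial>exp_law r) = (\<integral>\<^sup>+y. h y \<partial>(sup_law \<Otimes>\<^sub>M depth_law))"
    if h [measurable]: "h \<in> borel_measurable (borel \<Otimes>\<^sub>M borel)" for h
  proof -
    have "(\<integral>\<^sup>+t. \<integral>\<^sup>+p. h (\<Psi> (p, t)) \<partial>path_law (P 0) X \<partial>exp_law r) =
        (\<integral>\<^sup>+t. \<integral>\<^sup>+\<omega>. h (\<Psi> (shift_path 0 \<omega>, t)) \<partial>P 0 \<partial>exp_law r)"
      unfolding path_increments_law_eq[symmetric] path_increments_law_def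
      by (intro nn_integral_cong nn_integral_distr shift0) measurable
    also have "\<dots> = (\<integral>\<^sup>+z. h (shift_sup 0 z, shift_sup 0 z - shift_val 0 z) \<partial>\<B> 0)"
      unfolding \<Psi>_shift using measurable_shift_functionals[of 0 0]
      by (subst B.nn_integral_snd[symmetric]) (simp_all, measurable)
    also have "\<dots> = (\<integral>\<^sup>+y. h y \<partial>(sup_law \<Otimes>\<^sub>M depth_law))"
      unfolding wiener_hopf_sup_drawdown[symmetric] shift_sup_def shift_val_def
      by (subst nn_integral_distr) simp_all
    finally show ?thesis .
  qed
  have "(\<integral>\<^sup>+z. f (W (fst z), (shift_sup s z, shift_sup s z - shift_val s z)) \<partial>\<B> x) =
      (\<integral>\<^sup>+t. \<integral>\<^sup>+\<omega>. f (W \<omega>, \<Psi> (shift_path s \<omega>, t)) \<partial>P x \<partial>exp_law r)"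
    unfolding \<Psi>_shift by (subst B.nn_integral_snd[symmetric]) simp_all
  also have "\<dots> = (\<integral>\<^sup>+t. \<integral>\<^sup>+y. f (fst y, \<Psi> (snd y, t))
      \<partial>distr (P x) (N \<Otimes>\<^sub>M path_space {0..}) (\<lambda>\<omega>. (W \<omega>, shift_path s \<omega>)) \<partial>exp_law r)"
    by (intro nn_integral_cong) (subst nn_integral_distr, simp_all)
  also have "\<dots> = (\<integral>\<^sup>+t. \<integral>\<^sup>+w. \<integral>\<^sup>+p. f (w, \<Psi> (p, t)) \<partial>path_law (P 0) X \<partial>distr (P x) N W \<partial>exp_law r)"
    unfolding markov[OF s W] by (intro nn_integral_cong) (subst L.nn_integral_fst[symmetric], simp_all)
  also have "\<dots> = (\<integral>\<^sup>+w. \<integral>\<^sup>+t. \<integral>\<^sup>+p. f (w, \<Psi> (p, t)) \<partial>path_law (P 0) X \<partial>exp_law r \<partial>distr (P x) N W)"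
    by (rule WE.Fubini') simp
  also have "\<dots> = (\<integral>\<^sup>+w. \<integral>\<^sup>+y. f (w, y) \<partial>(sup_law \<Otimes>\<^sub>M depth_law) \<partial>distr (P x) N W)"
    by (intro nn_integral_cong inner) simp
  also have "\<dots> = (\<integral>\<^sup>+\<omega>. \<integral>\<^sup>+y. f (W \<omega>, y) \<partial>(sup_law \<Otimes>\<^sub>M depth_law) \<partial>P x)"
    by (subst nn_integral_distr) simp_all
  finally show ?thesis .
qed

theorem markov_wiener_hopf:
  assumes s: "0 \<le> s" and W: "W \<in> measurable (F s) N"
  shows "distr (\<B> x) (N \<Otimes>\<^sub>M (borel \<Otimes>\<^sub>M borel))
      (\<lambda>z. (W (fst z), (shift_sup s z, shift_sup s z - shift_val s z))) =
    distr (P x) N W \<Otimes>\<^sub>M (sup_law \<Otimes>\<^sub>M depth_law)" (is "?J = ?W \<Otimes>\<^sub>M ?SD")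
proof (rule measure_eqI)
  have W' [measurable]: "W \<in> measurable (P x) N" by (rule measurable_filtration[OF W])
  note measurable_shift_functionals[OF s, measurable]
  interpret W: prob_space "?W" by (rule prob_space_distr) simp
  have cong: "sets ?SD = sets (borel \<Otimes>\<^sub>M borel)"
    by (intro sets_pair_measure_cong) simp_all
  show sets: "sets ?J =
    sets (?W \<Otimes>\<^sub>M ?SD)"
    unfolding sets_distr by (intro sets_pair_measure_cong) (simp_all add: cong)
  fix A assume "A \<in> sets ?J"
  then have A [measurable]: "A \<in> sets (N \<Otimes>\<^sub>M (borel \<Otimes>\<^sub>M borel))" by simp
  then have A' [measurable]: "A \<in> sets (N \<Otimes>\<^sub>M ?SD)"
    using sets_pair_measure_cong[OF refl cong, of N] by simp
  have A'': "A \<in> sets (?W \<Otimes>\<^sub>M ?SD)"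
    using A sets by simp
  have "emeasure ?J A =
    (\<integral>\<^sup>+z. indicator A (W (fst z), (shift_sup s z, shift_sup s z - shift_val s z)) \<partial>\<B> x)"
    using A by (subst nn_integral_indicator[symmetric]) (simp, subst nn_integral_distr, simp_all)
  also have "\<dots> = (\<integral>\<^sup>+\<omega>. \<integral>\<^sup>+y. indicator A (W \<omega>, y) \<partial>?SD \<partial>P x)"
    by (rule nn_integral_markov_wiener_hopf[OF s W]) simp
  also have "\<dots> = (\<integral>\<^sup>+w. \<integral>\<^sup>+y. indicator A (w, y) \<partial>?SD \<partial>?W)"
    by (subst nn_integral_distr) simp_all
  also have "\<dots> = emeasure (?W \<Otimes>\<^sub>M ?SD) A"
    using SD.emeasure_pair_measure[OF A''] by simp
  finally show "emeasure ?J A =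
    emeasure (?W \<Otimes>\<^sub>M ?SD) A" .
qed

corollary wiener_hopf:
  "distr (\<B> x) (borel \<Otimes>\<^sub>M borel) (\<lambda>z. (shift_sup 0 z, shift_sup 0 z - shift_val 0 z)) =
    sup_law \<Otimes>\<^sub>M depth_law" (is "?J = ?SD")
proof (rule measure_eqI)
  note measurable_shift_functionals[of 0 x, simplified, measurable]
  have cong: "sets ?SD = sets (borel \<Otimes>\<^sub>M borel)"
    by (intro sets_pair_measure_cong) simp_all
  show "sets ?J =
      sets ?SD"
    using cong by simp
  fix A assume "A \<in> sets ?J"
  then have A [measurable]: "A \<in> sets (borel \<Otimes>\<^sub>M borel)" by simp
  have A': "A \<in> sets ?SD" using A cong by simp
  have "emeasure ?J A =
      (\<integral>\<^sup>+z. indicator A (shift_sup 0 z, shift_sup 0 z - shift_val 0 z) \<partial>\<B> x)"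
    using A by (subst nn_integral_indicator[symmetric]) (simp, subst nn_integral_distr, simp_all)
  also have "\<dots> = (\<integral>\<^sup>+\<omega>. \<integral>\<^sup>+y. indicator A y \<partial>?SD \<partial>P x)"
    using nn_integral_markov_wiener_hopf[of 0 "\<lambda>_. 0 :: real" borel "\<lambda>y. indicator A (snd y)" x] by simp
  also have "\<dots> = emeasure ?SD A"
    using A' by (simp add: emeasure_space_1)
  finally show "emeasure ?J A =
      emeasure ?SD A" .
qed

end

section \<open>The function \<open>\<kappa>\<close>\<close>

lemma cont_mono_Sup:
  fixes f :: "real \<Rightarrow> real"
  assumes "mono f" "continuous_on UNIV f" "S \<noteq> {}" "bdd_above S"
  shows "f (Sup S) = (SUP s\<in>S. f s)"
  using assms by (intro continuous_at_Sup_mono)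
    (auto simp: continuous_on_eq_continuous_at intro: continuous_at_imp_continuous_at_within)

locale stopping_problem = levy_exp +
  fixes g :: "real \<Rightarrow> real" and c :: real
  assumes continuous_g: "continuous_on UNIV g" and mono_g: "mono g"
    and resolvent_finite: "resolvent_finite P X r g y"
begin

definition position :: "'a \<times> real \<Rightarrow> real" where
  "position z = path_val (\<lambda>s. X s (fst z)) (snd z)"

definition maximum :: "'a \<times> real \<Rightarrow> real" where
  "maximum z = path_sup (\<lambda>s. X s (fst z)) (snd z)"

lemma measurable_g [measurable]: "g \<in> borel_measurable borel"
  using continuous_g by (rule borel_measurable_continuous_onI)

lemma measurable_position_maximum [measurable]:
  "position \<in> borel_measurable (\<B> x)" "maximum \<in> borel_measurable (\<B> x)"
  unfolding position_def[abs_def] maximum_def[abs_def]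
  by (intro measurable_path_sup measurable_path_val measurable_X_fst; simp)+

lemma position_eq: "\<omega> \<in> space (P x) \<Longrightarrow> 0 \<le> t \<Longrightarrow> position (\<omega>, t) = X t \<omega>"
  by (simp add: position_def path_val_cadlag cadlag_X)

lemma maximum_eq: "\<omega> \<in> space (P x) \<Longrightarrow> 0 \<le> t \<Longrightarrow> maximum (\<omega>, t) = running_sup X t \<omega>"
  by (simp add: maximum_def path_sup_cadlag cadlag_X running_sup_def)

lemma shift_val_eq:
  assumes "\<omega> \<in> space (P x)" "0 \<le> s" "0 \<le> t"
  shows "shift_val s (\<omega>, t) = X (s + t) \<omega> - X s \<omega>"
  using assms(3) by (simp add: shift_val_def path_val_cadlag[OF cadlag_increment[OF cadlag_X[OF assms(1)] assms(2)]])

lemma shift_sup_ge: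
  assumes \<omega>: "\<omega> \<in> space (P x)" and "0 \<le> s" "s \<le> u" "u \<le> s + t"
  shows "X u \<omega> - X s \<omega> \<le> shift_sup s (\<omega>, t)"
proof -
  have c: "cadlag (\<lambda>t. X (s + t) \<omega> - X s \<omega>)"
    using assms by (intro cadlag_increment cadlag_X) auto
  have "X (s + (u - s)) \<omega> - X s \<omega> \<le> (SUP v\<in>{0..t}. X (s + v) \<omega> - X s \<omega>)"
    using assms by (intro cSUP_upper cadlag_bdd_above[OF c]) auto
  then show ?thesis using assms by (simp add: shift_sup_def path_sup_cadlag c)
qed

lemma shift_sup_le:
  assumes \<omega>: "\<omega> \<in> space (P x)" and s: "0 \<le> s" and t: "0 \<le> t"
  shows "X s \<omega> + shift_sup s (\<omega>, t) \<le> running_sup X (s + t) \<omega>"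
proof -
  have c: "cadlag (\<lambda>t. X (s + t) \<omega> - X s \<omega>)"
    using assms by (intro cadlag_increment cadlag_X) auto
  have "X (s + u) \<omega> \<le> running_sup X (s + t) \<omega>" if "u \<in> {0..t}" for u
    unfolding running_sup_def using that s by (intro cSUP_upper cadlag_bdd_above cadlag_X[OF \<omega>]) auto
  then have "(SUP u\<in>{0..t}. X (s + u) \<omega> - X s \<omega>) \<le> running_sup X (s + t) \<omega> - X s \<omega>"
    using t by (intro cSUP_least) auto
  then show ?thesis using t by (simp add: shift_sup_def path_sup_cadlag c)
qed

lemma AE_from_start:
  "AE z in \<B> x. position z = x + shift_val 0 z \<and> maximum z = x + shift_sup 0 z"
proof -
  have "AE z in \<B> x. X 0 (fst z) = x"
  proof (rule B.AE_pair_measure)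
    show "{z \<in> space (\<B> x). X 0 (fst z) = x} \<in> sets (\<B> x)"
      using measurable_X_fst[of 0 x] by measurable
    show "AE \<omega> in P x. AE t in exp_law r. X 0 (fst (\<omega>, t)) = x"
      using start[of x] by simp
  qed
  then show ?thesis
    using AE_time_pos[of x]
  proof eventually_elim
    case (elim z)
    obtain \<omega> t where z: "z = (\<omega>, t)" by force
    with elim have \<omega>: "\<omega> \<in> space (P x)" and t: "0 \<le> t" and x: "X 0 \<omega> = x" by auto
    have "running_sup X t \<omega> \<le> x + shift_sup 0 (\<omega>, t)"
      unfolding running_sup_def
    proof (rule cSUP_least)
      fix u assume "u \<in> {0..t}"
      then show "X u \<omega> \<le> x + shift_sup 0 (\<omega>, t)" using shift_sup_ge[OF \<omega>, of 0 u t] x by simp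
    qed (use t in auto)
    then show ?case
      using shift_sup_le[OF \<omega> order_refl t] shift_val_eq[OF \<omega> order_refl t] x
      by (simp add: z position_eq[OF \<omega> t] maximum_eq[OF \<omega> t])
  qed
qed

lemma product_density:
  "\<B> x = density (P x \<Otimes>\<^sub>M lborel) (\<lambda>z. ennreal (exponential_density r (snd z)))"
proof -
  have "density (P x) (\<lambda>_. 1) \<Otimes>\<^sub>M density lborel (\<lambda>t. ennreal (exponential_density r t)) =
      density (P x \<Otimes>\<^sub>M lborel) (\<lambda>(\<omega>, t). 1 * ennreal (exponential_density r t))"
    by (rule pair_measure_density)
      (simp_all add: lborel.sigma_finite_measure_axioms E.sigma_finite_measure_axioms[unfolded exp_law_def])
  then show ?thesis by (simp add: density_1 exp_law_def split_beta')
qed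

lemma integrable_g_position: "integrable (\<B> x) (\<lambda>z. g (position z))"
proof -
  have [measurable]: "position \<in> borel_measurable (P x \<Otimes>\<^sub>M lborel)"
    using measurable_position_maximum(1)[of x]
    by (simp add: product_density)
  have "integrable (P x \<Otimes>\<^sub>M lborel) (\<lambda>z. r * (indicator {0..} (snd z) * (g (X (snd z) (fst z)) * exp (- r * snd z))))"
    using resolvent_finite[of x] by (simp add: resolvent_finite_def split_beta')
  also have "?this \<longleftrightarrow> integrable (P x \<Otimes>\<^sub>M lborel) (\<lambda>z. exponential_density r (snd z) *\<^sub>R g (position z))"
  proof (intro Bochner_Integration.integrable_cong refl)
    fix z assume "z \<in> space (P x \<Otimes>\<^sub>M (lborel :: real measure))"
    then obtain \<omega> t where z: "z = (\<omega>, t)" "\<omega> \<in> space (P x)" by (auto simp: space_pair_measure)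
    show "r * (indicator {0..} (snd z) * (g (X (snd z) (fst z)) * exp (- r * snd z))) =
        exponential_density r (snd z) *\<^sub>R g (position z)"
      using z position_eq[of \<omega> x t] by (cases "0 \<le> t") (simp_all add: exponential_density_def mult_ac)
  qed
  finally show ?thesis
    unfolding product_density using r
    by (subst integrable_density) (simp_all add: exponential_density_nonneg)
qed

text \<open>
  Almost every path starts from \<open>x\<close>, so the factorisation, which concerns the path relative to its
  starting point, describes the actual maximum and position as well.
\<close>

lemma transfer_start:
  fixes f :: "real \<times> real \<Rightarrow> real"
  assumes f [measurable]: "f \<in> borel_measurable (borel \<Otimes>\<^sub>M borel)"
  shows "integrable (sup_law \<Otimes>\<^sub>M depth_law) (\<lambda>y. f (x + fst y, x + fst y - snd y)) \<longleftrightarrow>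
      integrable (\<B> x) (\<lambda>z. f (maximum z, position z))" (is ?A)
    and "(\<integral>y. f (x + fst y, x + fst y - snd y) \<partial>(sup_law \<Otimes>\<^sub>M depth_law)) =
      (\<integral>z. f (maximum z, position z) \<partial>\<B> x)" (is ?B)
proof -
  note measurable_shift_functionals[of 0 x, simplified, measurable]
  have meas: "(\<lambda>z. (shift_sup 0 z, shift_sup 0 z - shift_val 0 z)) \<in> measurable (\<B> x) (borel \<Otimes>\<^sub>M borel)"
    by measurable
  have f': "(\<lambda>y. f (x + fst y, x + fst y - snd y)) \<in> borel_measurable (borel \<Otimes>\<^sub>M borel)"
    by measurable
  have AE: "AE z in \<B> x. f (x + fst (shift_sup 0 z, shift_sup 0 z - shift_val 0 z),
      x + fst (shift_sup 0 z, shift_sup 0 z - shift_val 0 z) - snd (shift_sup 0 z, shift_sup 0 z - shift_val 0 z)) =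
      f (maximum z, position z)"
    using AE_from_start[of x] by eventually_elim simp
  show ?A
    unfolding wiener_hopf[of x, symmetric] integrable_distr_eq[OF meas f']
    by (rule integrable_cong_AE[OF _ _ AE]) measurable
  show ?B
    unfolding wiener_hopf[of x, symmetric] integral_distr[OF meas f']
    by (rule integral_cong_AE[OF _ _ AE]) measurable
qed

lemma integrable_g_pair: "integrable (sup_law \<Otimes>\<^sub>M depth_law) (\<lambda>y. g (x + fst y - snd y))"
  using transfer_start(1)[of "\<lambda>y. g (snd y)" x] integrable_g_position[of x] by simp

text \<open>
  Finiteness of the resolvent gives integrability of \<open>g (k + u - d)\<close> only for almost every \<open>u\<close>, with
  an exceptional set that depends on the starting point \<open>k\<close>. One \<open>u\<close> serves all integers \<open>k\<close>, and
  monotonicity of \<open>g\<close> squeezes an arbitrary shift between two integer shifts of it.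
\<close>

lemma integrable_g_depth: "integrable depth_law (\<lambda>d. g (y - d))"
proof -
  have "AE u in sup_law. integrable depth_law (\<lambda>d. g (real_of_int k + u - d))" for k
    using SD.AE_integrable_fst'[OF integrable_g_pair[of "real_of_int k"]] by simp
  then have "AE u in sup_law. \<forall>k. integrable depth_law (\<lambda>d. g (real_of_int k + u - d))"
    by (simp add: AE_all_countable)
  then have "\<exists>u. \<forall>k. integrable depth_law (\<lambda>d. g (real_of_int k + u - d))"
  proof (rule contrapos_pp)
    assume none: "\<nexists>u. \<forall>k. integrable depth_law (\<lambda>d. g (real_of_int k + u - d))"
    show "\<not> (AE u in sup_law. \<forall>k. integrable depth_law (\<lambda>d. g (real_of_int k + u - d)))"
    proof
      assume "AE u in sup_law. \<forall>k. integrable depth_law (\<lambda>d. g (real_of_int k + u - d))"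
      then have "AE u in sup_law. False" by eventually_elim (use none in blast)
      then show False by simp
    qed
  qed
  then obtain u where u: "\<And>k. integrable depth_law (\<lambda>d. g (real_of_int k + u - d))" by blast
  \<comment> \<open>The integer shifts of \<open>u\<close> next to \<open>y\<close>.\<close>
  define k where "k = \<lfloor>y - u\<rfloor>"
  define l where "l = \<lceil>y - u\<rceil>"
  have kl: "real_of_int k + u \<le> y" "y \<le> real_of_int l + u"
    unfolding k_def l_def by linarith+
  show ?thesis
  proof (rule Bochner_Integration.integrable_bound)
    show "integrable depth_law (\<lambda>d. \<bar>g (real_of_int k + u - d)\<bar> + \<bar>g (real_of_int l + u - d)\<bar>)"
      by (intro Bochner_Integration.integrable_add integrable_abs u)
    have "\<bar>g (y - d)\<bar> \<le> \<bar>g (real_of_int k + u - d)\<bar> + \<bar>g (real_of_int l + u - d)\<bar>" for d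
      using monoD[OF mono_g, of "real_of_int k + u - d" "y - d"]
        monoD[OF mono_g, of "y - d" "real_of_int l + u - d"] kl by linarith
    then show "AE d in depth_law. norm (g (y - d)) \<le>
        norm (\<bar>g (real_of_int k + u - d)\<bar> + \<bar>g (real_of_int l + u - d)\<bar>)"
      by (intro AE_I2) (simp add: abs_of_nonneg)
  qed measurable
qed

text \<open>
  The function \<open>kappa\<close> of the problem, with the infimum replaced by its law under the
  factorisation (see \<open>kappa_eq\<close>).
\<close>

definition \<kappa> :: "real \<Rightarrow> real" where
  "\<kappa> y = 1 / r * (\<integral>d. g (y - d) \<partial>depth_law)"

definition excess :: "real \<Rightarrow> real" where
  "excess y = max (\<kappa> y - c) 0"

lemma mono_kappa: "mono \<kappa>"
proof (rule monoI)
  fix y z :: real assume "y \<le> z"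
  then have "(\<integral>d. g (y - d) \<partial>depth_law) \<le> (\<integral>d. g (z - d) \<partial>depth_law)"
    by (intro integral_mono integrable_g_depth monoD[OF mono_g]) simp
  then show "\<kappa> y \<le> \<kappa> z" using r by (simp add: \<kappa>_def divide_right_mono)
qed

lemma continuous_kappa: "continuous_on UNIV \<kappa>"
proof -
  have "(\<kappa> \<circ> u) \<longlonglongrightarrow> \<kappa> y" if u: "u \<longlonglongrightarrow> y" for u y
  proof -
    obtain K where K: "\<And>n. \<bar>u n\<bar> \<le> K"
      using convergent_imp_Bseq[OF convergentI[OF u]] by (auto simp: Bseq_def)
    have "(\<lambda>n. \<integral>d. g (u n - d) \<partial>depth_law) \<longlonglongrightarrow> (\<integral>d. g (y - d) \<partial>depth_law)"
    proof (rule integral_dominated_convergence[where w = "\<lambda>d. \<bar>g (- K - d)\<bar> + \<bar>g (K - d)\<bar>"])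
      show "integrable depth_law (\<lambda>d. \<bar>g (- K - d)\<bar> + \<bar>g (K - d)\<bar>)"
        by (intro Bochner_Integration.integrable_add integrable_abs integrable_g_depth)
      show "AE d in depth_law. (\<lambda>n. g (u n - d)) \<longlonglongrightarrow> g (y - d)"
        by (intro AE_I2 continuous_on_tendsto_compose[OF continuous_g] tendsto_diff u tendsto_const) auto
      fix n
      have "\<bar>g (u n - d)\<bar> \<le> \<bar>g (- K - d)\<bar> + \<bar>g (K - d)\<bar>" for d
        using monoD[OF mono_g, of "- K - d" "u n - d"] monoD[OF mono_g, of "u n - d" "K - d"] K[of n]
        by linarith
      then show "AE d in depth_law. norm (g (u n - d)) \<le> \<bar>g (- K - d)\<bar> + \<bar>g (K - d)\<bar>"
        by (intro AE_I2) simp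
    qed measurable
    then show ?thesis unfolding \<kappa>_def o_def by (intro tendsto_mult tendsto_const)
  qed
  then show ?thesis
    by (simp add: continuous_on_eq_continuous_at continuous_at_sequentially)
qed

lemma mono_excess: "mono excess"
  using mono_kappa unfolding excess_def mono_def by (fastforce simp: max_def)

lemma continuous_excess: "continuous_on UNIV excess"
  unfolding excess_def[abs_def] by (intro continuous_intros continuous_kappa)

lemma excess_nonneg [simp]: "0 \<le> excess y"
  by (simp add: excess_def)

lemma measurable_kappa [measurable]: "\<kappa> \<in> borel_measurable borel" "excess \<in> borel_measurable borel"
  using continuous_kappa continuous_excess by (auto intro: borel_measurable_continuous_onI)

text \<open>
  The level set of \<open>\<kappa>\<close> is closed by continuity, so it contains its infimum unless that is infinite;
  by monotonicity it contains everything to the right.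
\<close>

lemma threshold_kappa: "threshold \<kappa> c \<le> ereal y \<longleftrightarrow> c \<le> \<kappa> y"
proof
  assume "c \<le> \<kappa> y"
  then show "threshold \<kappa> c \<le> ereal y" unfolding threshold_def by (intro INF_lower) simp
next
  assume le: "threshold \<kappa> c \<le> ereal y"
  show "c \<le> \<kappa> y"
  proof (rule ccontr)
    assume less: "\<not> c \<le> \<kappa> y"
    have "(\<kappa> \<longlongrightarrow> \<kappa> y) (at_right y)"
      using continuous_kappa by (auto simp: continuous_on_def intro: tendsto_within_subset)
    then have "eventually (\<lambda>z. \<kappa> z < c) (at_right y)"
      using less by (intro order_tendstoD(2)) auto
    then obtain b where b: "y < b" "\<And>z. y < z \<Longrightarrow> z < b \<Longrightarrow> \<kappa> z < c"
      unfolding eventually_at_right_field by blast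
    define m where "m = (y + b) / 2"
    have m: "y < m" "\<kappa> m < c" using b by (auto simp: m_def)
    have "ereal m \<le> threshold \<kappa> c"
      unfolding threshold_def
    proof (rule INF_greatest)
      fix z assume "z \<in> {z. c \<le> \<kappa> z}"
      then have "\<not> z \<le> m" using m(2) monoD[OF mono_kappa, of z m] by auto
      then show "ereal m \<le> ereal z" by simp
    qed
    from order_trans[OF this le] m(1) show False by simp
  qed
qed

lemma integrable_kappa: "integrable sup_law (\<lambda>u. \<kappa> (y + u))"
  using SD.integrable_fst'[OF integrable_g_pair[of y]] by (simp add: \<kappa>_def)

lemma integrable_excess: "integrable sup_law (\<lambda>u. excess (y + u))"
  unfolding excess_def by (intro integrable_max Bochner_Integration.integrable_diff integrable_kappa) simp_all

text \<open>
  The function \<open>V\<close> of the introduction.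
\<close>

definition excess_value :: "real \<Rightarrow> real" where
  "excess_value y = (\<integral>u. excess (y + u) \<partial>sup_law)"

lemma integrable_excess_maximum: "integrable (\<B> x) (\<lambda>z. excess (maximum z))"
  and integral_excess_maximum: "(\<integral>z. excess (maximum z) \<partial>\<B> x) = excess_value x"
proof -
  have int: "integrable (sup_law \<Otimes>\<^sub>M depth_law) (\<lambda>(u, d). excess (x + u))"
  proof -
    have "integrable (distr (sup_law \<Otimes>\<^sub>M depth_law) sup_law fst) (\<lambda>u. excess (x + u))"
      unfolding D.distr_pair_fst by (rule integrable_excess)
    then show ?thesis by (subst (asm) integrable_distr_eq) (simp_all add: split_beta')
  qed
  show "integrable (\<B> x) (\<lambda>z. excess (maximum z))"
    using transfer_start(1)[of "\<lambda>y. excess (fst y)" x] int by (simp add: split_beta')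
  show "(\<integral>z. excess (maximum z) \<partial>\<B> x) = excess_value x"
    using transfer_start(2)[of "\<lambda>y. excess (fst y)" x] SD.integral_fst'[OF int]
    by (simp add: excess_value_def split_beta' D.prob_space[simplified])
qed

text \<open>
  Integrating out the drawdown first turns \<open>g - r c\<close> into \<open>r (\<kappa> - c)\<close> at the maximum.
\<close>

lemma resolvent_excess:
  "(\<integral>y. g (x + fst y - snd y) - r * c \<partial>(sup_law \<Otimes>\<^sub>M depth_law)) = r * (\<integral>u. \<kappa> (x + u) - c \<partial>sup_law)"
proof -
  have int: "integrable (sup_law \<Otimes>\<^sub>M depth_law) (\<lambda>y. g (x + fst y - snd y) - r * c)"
    by (intro Bochner_Integration.integrable_diff integrable_g_pair) simp
  have "(\<integral>y. g (x + fst y - snd y) - r * c \<partial>(sup_law \<Otimes>\<^sub>M depth_law)) =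
      (\<integral>u. \<integral>d. g (x + u - d) - r * c \<partial>depth_law \<partial>sup_law)"
    using SD.integral_fst'[OF int] by simp
  also have "\<dots> = (\<integral>u. r * (\<kappa> (x + u) - c) \<partial>sup_law)"
  proof (intro Bochner_Integration.integral_cong refl)
    fix u
    show "(\<integral>d. g (x + u - d) - r * c \<partial>depth_law) = r * (\<kappa> (x + u) - c)"
      using r integrable_g_depth[of "x + u"] D.prob_space
      by (simp add: \<kappa>_def right_diff_distrib)
  qed
  finally show ?thesis by simp
qed

text \<open>
  The indicator depends on the maximum alone, so the drawdown can be integrated out again, and
  \<open>\<kappa> - c\<close> on the event where it is nonnegative is the excess.
\<close>

lemma middle_excess:
  "(\<integral>y. (g (x + fst y - snd y) - r * c) * (if c \<le> \<kappa> (x + fst y) then 1 else 0) \<partial>(sup_law \<Otimes>\<^sub>M depth_law)) =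
    r * excess_value x"
proof -
  have int: "integrable (sup_law \<Otimes>\<^sub>M depth_law)
      (\<lambda>y. (g (x + fst y - snd y) - r * c) * (if c \<le> \<kappa> (x + fst y) then 1 else 0))"
  proof (rule Bochner_Integration.integrable_bound)
    show "integrable (sup_law \<Otimes>\<^sub>M depth_law) (\<lambda>y. g (x + fst y - snd y) - r * c)"
      by (intro Bochner_Integration.integrable_diff integrable_g_pair) simp
  qed auto
  have "(\<integral>y. (g (x + fst y - snd y) - r * c) * (if c \<le> \<kappa> (x + fst y) then 1 else 0) \<partial>(sup_law \<Otimes>\<^sub>M depth_law)) =
      (\<integral>u. \<integral>d. (g (x + u - d) - r * c) * (if c \<le> \<kappa> (x + u) then 1 else 0) \<partial>depth_law \<partial>sup_law)"
    using SD.integral_fst'[OF int] by simp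
  also have "\<dots> = (\<integral>u. r * excess (x + u) \<partial>sup_law)"
  proof (intro Bochner_Integration.integral_cong refl)
    fix u
    show "(\<integral>d. (g (x + u - d) - r * c) * (if c \<le> \<kappa> (x + u) then 1 else 0) \<partial>depth_law) = r * excess (x + u)"
      using r integrable_g_depth[of "x + u"] D.prob_space
      by (simp add: excess_def \<kappa>_def right_diff_distrib max_def field_simps)
  qed
  finally show ?thesis by (simp add: excess_value_def)
qed

end

section \<open>Comparing the gain after a grid time with the running excess\<close>

context stopping_problem
begin

definition gain :: "'a \<times> real \<Rightarrow> real" where
  "gain z = g (position z) - r * c"

text \<open>
  The supremum of \<open>X\<close> over \<open>[s, t]\<close> for the pair of a path and a time \<open>t \<ge> s\<close>.
\<close>

definition segment_max :: "real \<Rightarrow> 'a \<times> real \<Rightarrow> real" where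
  "segment_max s z = X s (fst z) + shift_sup s (fst z, snd z - s)"

lemma measurable_gain [measurable]: "gain \<in> borel_measurable (\<B> x)"
  unfolding gain_def[abs_def] by measurable

lemma integrable_gain: "integrable (\<B> x) gain"
  unfolding gain_def[abs_def] by (intro Bochner_Integration.integrable_diff integrable_g_position) simp

lemma measurable_segment_max [measurable]:
  "0 \<le> s \<Longrightarrow> segment_max s \<in> borel_measurable (\<B> x)"
  unfolding segment_max_def[abs_def] shift_sup_def fst_conv snd_conv
  by (intro borel_measurable_add measurable_path_sup borel_measurable_diff measurable_X_fst) (simp_all, measurable)

lemma segment_max_ge:
  assumes "\<omega> \<in> space (P x)" "0 \<le> s" "s \<le> u" "u \<le> t"
  shows "X u \<omega> \<le> segment_max s (\<omega>, t)"
  using shift_sup_ge[OF assms(1,2,3), of "t - s"] assms(4) by (simp add: segment_max_def)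

lemma segment_max_le:
  assumes "\<omega> \<in> space (P x)" "0 \<le> s" "s \<le> t"
  shows "segment_max s (\<omega>, t) \<le> maximum (\<omega>, t)"
  using shift_sup_le[OF assms(1,2), of "t - s"] assms by (simp add: segment_max_def maximum_eq)

definition gain_after :: "real \<Rightarrow> 'a set \<Rightarrow> 'a \<times> real \<Rightarrow> real" where
  "gain_after s A z = indicator {s<..} (snd z) * (indicator A (fst z) * gain z)"

definition excess_after :: "real \<Rightarrow> 'a set \<Rightarrow> 'a \<times> real \<Rightarrow> real" where
  "excess_after s A z = indicator {s<..} (snd z) * (indicator A (fst z) * excess (segment_max s z))"

context
  fixes s :: real and A :: "'a set" and x :: real
  assumes s: "0 \<le> s" and A: "A \<in> sets (F s)"
begin

lemma A_event [measurable]: "A \<in> sets (P x)"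
  using A filtration_events by blast

lemma integrable_gain_after: "integrable (\<B> x) (gain_after s A)"
proof (rule Bochner_Integration.integrable_bound[OF integrable_gain])
  show "gain_after s A \<in> borel_measurable (\<B> x)"
    unfolding gain_after_def[abs_def] by measurable
qed (auto simp: gain_after_def indicator_def)

lemma excess_after_le:
  assumes "z \<in> space (\<B> x)"
  shows "excess_after s A z \<le> excess (maximum z)"
  using segment_max_le[of "fst z" x s "snd z"] s assms monoD[OF mono_excess]
  by (auto simp: excess_after_def indicator_def space_pair_measure)

lemma measurable_excess_after [measurable]: "excess_after s A \<in> borel_measurable (\<B> x)"
  unfolding excess_after_def[abs_def] using measurable_segment_max[OF s, measurable] by measurable

lemma excess_after_nonneg: "0 \<le> excess_after s A z"
  by (simp add: excess_after_def)

lemma integrable_excess_after: "integrable (\<B> x) (excess_after s A)"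
proof (rule Bochner_Integration.integrable_bound[OF integrable_excess_maximum[of x]])
  show "AE z in \<B> x. norm (excess_after s A z) \<le> norm (excess (maximum z))"
    using excess_after_le excess_after_nonneg by (intro AE_I2) simp
qed measurable

text \<open>
  Given survival beyond \<open>s\<close>, the remaining exponential time is fresh, and so is the path after \<open>s\<close>;
  both expectations become functions of the position at time \<open>s\<close>.
\<close>

lemma restart:
  "(\<integral>z. gain_after s A z \<partial>\<B> x) = exp (- r * s) *
    (\<integral>\<omega>. indicator A \<omega> * (r * (\<integral>u. \<kappa> (X s \<omega> + u) - c \<partial>sup_law)) \<partial>P x)" (is ?gain)
  "integrable (P x) (\<lambda>\<omega>. indicator A \<omega> * (r * (\<integral>u. \<kappa> (X s \<omega> + u) - c \<partial>sup_law)))" (is ?int_gain)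
  "(\<integral>z. excess_after s A z \<partial>\<B> x) = exp (- r * s) * (\<integral>\<omega>. indicator A \<omega> * excess_value (X s \<omega>) \<partial>P x)" (is ?excess)
  "integrable (P x) (\<lambda>\<omega>. indicator A \<omega> * excess_value (X s \<omega>))" (is ?int_excess)
proof -
  let ?N = "borel \<Otimes>\<^sub>M borel :: (real \<times> real) measure"
  let ?W = "\<lambda>\<omega>. (indicat_real A \<omega>, X s \<omega>)"
  let ?SD = "sup_law \<Otimes>\<^sub>M depth_law"
  note measurable_shift_functionals[OF s, measurable] measurable_segment_max[OF s, measurable]
  have W: "?W \<in> measurable (F s) ?N"
    using A s by (intro measurable_Pair adapted) simp_all
  have W' [measurable]: "?W \<in> measurable (P x) ?N" by (rule measurable_filtration[OF W])
  interpret W: prob_space "distr (P x) ?N ?W" by (rule prob_space_distr) simp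
  interpret WSD: pair_prob_space "distr (P x) ?N ?W" ?SD ..
  have Z: "(\<lambda>z. (?W (fst z), (shift_sup s z, shift_sup s z - shift_val s z)))
      \<in> measurable (\<B> x) (?N \<Otimes>\<^sub>M (borel \<Otimes>\<^sub>M borel))"
    by measurable
  have transfer: "(\<integral>z. indicator {s<..} (snd z) * b z \<partial>\<B> x) =
        exp (- r * s) * (\<integral>\<omega>. \<integral>y. f (?W \<omega>, y) \<partial>?SD \<partial>P x)"
      "integrable (P x) (\<lambda>\<omega>. \<integral>y. f (?W \<omega>, y) \<partial>?SD)"
    if f [measurable]: "f \<in> borel_measurable (?N \<Otimes>\<^sub>M (borel \<Otimes>\<^sub>M borel))"
      and b [measurable]: "b \<in> borel_measurable (\<B> x)"
      and int: "integrable (\<B> x) (\<lambda>z. indicator {s<..} (snd z) * b z)"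
      and eq: "\<And>\<omega> t. \<omega> \<in> space (P x) \<Longrightarrow> 0 \<le> t \<Longrightarrow>
        b (\<omega>, s + t) = f (?W \<omega>, (shift_sup s (\<omega>, t), shift_sup s (\<omega>, t) - shift_val s (\<omega>, t)))"
    for f :: "(real \<times> real) \<times> real \<times> real \<Rightarrow> real" and b :: "'a \<times> real \<Rightarrow> real"
  proof -
    have b': "b \<in> borel_measurable (P x \<Otimes>\<^sub>M borel)"
      using b by (simp cong: measurable_cong_sets sets_pair_measure_cong)
    have AE: "AE z in \<B> x. b (fst z, s + snd z) =
        f (?W (fst z), (shift_sup s z, shift_sup s z - shift_val s z))"
      using AE_time_pos[of x] by eventually_elim (use eq in force)
    have [measurable]: "(\<lambda>z. b (fst z, s + snd z)) \<in> borel_measurable (\<B> x)"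
      by (rule measurable_compose[OF _ b']) measurable
    have fZ: "(\<lambda>z. f (?W (fst z), (shift_sup s z, shift_sup s z - shift_val s z))) \<in> borel_measurable (\<B> x)"
      by (rule measurable_compose[OF Z f])
    have "integrable (\<B> x) (\<lambda>z. b (fst z, s + snd z))"
      using integral_memoryless(2)[OF r s b'] int by (simp add: split_beta')
    then have "integrable (\<B> x) (\<lambda>z. f (?W (fst z), (shift_sup s z, shift_sup s z - shift_val s z)))"
      by (rule integrable_cong_AE_imp[OF _ fZ]) (use AE in \<open>eventually_elim, simp\<close>)
    then have int_f: "integrable (distr (P x) ?N ?W \<Otimes>\<^sub>M ?SD) f"
      unfolding markov_wiener_hopf[OF s W, symmetric] integrable_distr_eq[OF Z f] .
    have "(\<integral>z. indicator {s<..} (snd z) * b z \<partial>\<B> x) = exp (- r * s) * (\<integral>z. b (fst z, s + snd z) \<partial>\<B> x)"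
      using integral_memoryless(1)[OF r s b'] by (simp add: split_beta')
    also have "(\<integral>z. b (fst z, s + snd z) \<partial>\<B> x) =
        (\<integral>z. f (?W (fst z), (shift_sup s z, shift_sup s z - shift_val s z)) \<partial>\<B> x)"
      by (rule integral_cong_AE[OF _ fZ AE]) measurable
    also have "\<dots> = (\<integral>w. f w \<partial>(distr (P x) ?N ?W \<Otimes>\<^sub>M ?SD))"
      unfolding markov_wiener_hopf[OF s W, symmetric] integral_distr[OF Z f] ..
    also have "\<dots> = (\<integral>w. \<integral>y. f (w, y) \<partial>?SD \<partial>distr (P x) ?N ?W)"
      by (rule WSD.integral_fst'[OF int_f, symmetric])
    also have "\<dots> = (\<integral>\<omega>. \<integral>y. f (?W \<omega>, y) \<partial>?SD \<partial>P x)"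
      by (rule integral_distr) measurable
    finally show "(\<integral>z. indicator {s<..} (snd z) * b z \<partial>\<B> x) =
        exp (- r * s) * (\<integral>\<omega>. \<integral>y. f (?W \<omega>, y) \<partial>?SD \<partial>P x)" .
    have "integrable (distr (P x) ?N ?W) (\<lambda>w. \<integral>y. f (w, y) \<partial>?SD)"
      by (rule WSD.integrable_fst'[OF int_f])
    then show "integrable (P x) (\<lambda>\<omega>. \<integral>y. f (?W \<omega>, y) \<partial>?SD)"
      by (subst (asm) integrable_distr_eq) measurable
  qed
  \<comment> \<open>The two integrands as functions of the indicator of \<open>A\<close>, the position at \<open>s\<close>, the rise and the drawdown.\<close>
  define fg where "fg w = fst (fst w) * (g (snd (fst w) + fst (snd w) - snd (snd w)) - r * c)"
    for w :: "(real \<times> real) \<times> real \<times> real"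
  define fe where "fe w = fst (fst w) * excess (snd (fst w) + fst (snd w))"
    for w :: "(real \<times> real) \<times> real \<times> real"
  have fg: "(\<integral>y. fg (?W \<omega>, y) \<partial>?SD) = indicator A \<omega> * (r * (\<integral>u. \<kappa> (X s \<omega> + u) - c \<partial>sup_law))" for \<omega>
    using resolvent_excess[of "X s \<omega>"] by (simp add: fg_def)
  have fe: "(\<integral>y. fe (?W \<omega>, y) \<partial>?SD) = indicator A \<omega> * excess_value (X s \<omega>)" for \<omega>
  proof -
    have "(\<integral>y. excess (X s \<omega> + fst y) \<partial>?SD) = (\<integral>u. excess (X s \<omega> + u) \<partial>distr ?SD sup_law fst)"
      by (subst integral_distr) simp_all
    then show ?thesis by (simp add: fe_def D.distr_pair_fst excess_value_def)
  qed
  have fg_meas: "fg \<in> borel_measurable (?N \<Otimes>\<^sub>M (borel \<Otimes>\<^sub>M borel))"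
    unfolding fg_def[abs_def] by measurable
  have fe_meas: "fe \<in> borel_measurable (?N \<Otimes>\<^sub>M (borel \<Otimes>\<^sub>M borel))"
    unfolding fe_def[abs_def] by measurable
  have bg_meas: "(\<lambda>z. indicator A (fst z) * gain z) \<in> borel_measurable (\<B> x)" by measurable
  have be_meas: "(\<lambda>z. indicator A (fst z) * excess (segment_max s z)) \<in> borel_measurable (\<B> x)"
    by measurable
  have eg: "indicator A (fst (\<omega>, s + t)) * gain (\<omega>, s + t) =
      fg (?W \<omega>, (shift_sup s (\<omega>, t), shift_sup s (\<omega>, t) - shift_val s (\<omega>, t)))"
    if "\<omega> \<in> space (P x)" "0 \<le> t" for \<omega> t
    using that s by (simp add: fg_def gain_def position_eq[of \<omega> x] shift_val_eq[of \<omega> x])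
  have ee: "indicator A (fst (\<omega>, s + t)) * excess (segment_max s (\<omega>, s + t)) =
      fe (?W \<omega>, (shift_sup s (\<omega>, t), shift_sup s (\<omega>, t) - shift_val s (\<omega>, t)))"
    for \<omega> t
    by (simp add: fe_def segment_max_def)
  show ?gain ?int_gain
    using transfer[OF fg_meas bg_meas integrable_gain_after[unfolded gain_after_def[abs_def]] eg]
    unfolding fg gain_after_def by simp_all
  show ?excess ?int_excess
    using transfer[OF fe_meas be_meas integrable_excess_after[unfolded excess_after_def[abs_def]] ee]
    unfolding fe excess_after_def by simp_all
qed

lemma kappa_le_excess: "(\<integral>u. \<kappa> (y + u) - c \<partial>sup_law) \<le> excess_value y"
  unfolding excess_value_def
  by (intro integral_mono integrable_excess Bochner_Integration.integrable_diff integrable_kappa)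
    (simp_all add: excess_def)

lemma gain_after_le: "(\<integral>z. gain_after s A z \<partial>\<B> x) \<le> r * (\<integral>z. excess_after s A z \<partial>\<B> x)"
proof -
  have "(\<integral>\<omega>. indicator A \<omega> * (r * (\<integral>u. \<kappa> (X s \<omega> + u) - c \<partial>sup_law)) \<partial>P x) \<le>
      (\<integral>\<omega>. r * (indicator A \<omega> * excess_value (X s \<omega>)) \<partial>P x)"
    using r kappa_le_excess
    by (intro integral_mono restart integrable_mult_right) (auto simp: indicator_def mult_left_mono)
  also have "\<dots> = r * (\<integral>\<omega>. indicator A \<omega> * excess_value (X s \<omega>) \<partial>P x)"
    by (rule integral_mult_right_zero)
  finally have "exp (- r * s) * (\<integral>\<omega>. indicator A \<omega> * (r * (\<integral>u. \<kappa> (X s \<omega> + u) - c \<partial>sup_law)) \<partial>P x) \<le>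
      exp (- r * s) * (r * (\<integral>\<omega>. indicator A \<omega> * excess_value (X s \<omega>) \<partial>P x))"
    by (rule mult_left_mono) simp
  then show ?thesis
    unfolding restart(1,3) by (simp only: mult.left_commute[of r])
qed

text \<open>
  The maximum after \<open>s\<close> is at least \<open>X s\<close>, so where \<open>\<kappa> (X s)\<close> has reached the level \<open>c\<close>, \<open>\<kappa> - c\<close> at
  the maximum is nonnegative and coincides with the excess.
\<close>

lemma gain_after_eq:
  assumes above: "\<And>\<omega>. \<omega> \<in> A \<Longrightarrow> c \<le> \<kappa> (X s \<omega>)"
  shows "(\<integral>z. gain_after s A z \<partial>\<B> x) = r * (\<integral>z. excess_after s A z \<partial>\<B> x)"
proof -
  have nonneg: "AE u in sup_law. 0 \<le> u"
  proof -
    have "AE z in \<B> 0. 0 \<le> path_sup (\<lambda>s. X s (fst z) - X 0 (fst z)) (snd z)"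
      using AE_time_pos[of 0]
    proof eventually_elim
      case (elim z)
      then show ?case
        using shift_sup_ge[of "fst z" 0 0 0 "snd z"] by (simp add: shift_sup_def)
    qed
    then show ?thesis unfolding sup_law_def by (subst AE_distr_iff) auto
  qed
  have eq: "(\<integral>u. \<kappa> (y + u) - c \<partial>sup_law) = excess_value y" if "c \<le> \<kappa> y" for y
    unfolding excess_value_def
  proof (rule integral_cong_AE)
    show "AE u in sup_law. \<kappa> (y + u) - c = excess (y + u)"
      using nonneg
    proof eventually_elim
      case (elim u)
      then show ?case
        using that monoD[OF mono_kappa, of y "y + u"] by (simp add: excess_def)
    qed
  qed simp_all
  have "(\<integral>\<omega>. indicator A \<omega> * (r * (\<integral>u. \<kappa> (X s \<omega> + u) - c \<partial>sup_law)) \<partial>P x) =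
      (\<integral>\<omega>. r * (indicator A \<omega> * excess_value (X s \<omega>)) \<partial>P x)"
    by (intro Bochner_Integration.integral_cong refl) (use above in \<open>auto simp: indicator_def eq\<close>)
  also have "\<dots> = r * (\<integral>\<omega>. indicator A \<omega> * excess_value (X s \<omega>) \<partial>P x)"
    by (rule integral_mult_right_zero)
  finally show ?thesis
    unfolding restart(1,3) by (simp only: mult.left_commute[of r])
qed

end

end

section \<open>Stopping on a grid\<close>

lemma sum_disjointed_indicator:
  fixes w :: "nat \<Rightarrow> real"
  assumes C: "\<omega> \<in> disjointed C j" and j: "j < K"
  shows "(\<Sum>k<K. w k * indicator (disjointed C k) \<omega>) = w j"
proof -
  have "\<omega> \<notin> disjointed C k" if "k \<noteq> j" for k
    using disjoint_family_disjointed[of C] C that by (auto simp: disjoint_family_on_def)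
  then have "(\<Sum>k<K. w k * indicator (disjointed C k) \<omega>) = (\<Sum>k<K. if k = j then w j else 0)"
    using C by (intro sum.cong) auto
  then show ?thesis using j by simp
qed

context stopping_problem
begin

text \<open>
  Stopping on the grid is described by events \<open>C k\<close>, to be thought of as having stopped by the \<open>k\<close>-th
  grid point. The predicate says that the time lies beyond the stopping time, as far as the first
  \<open>K\<close> grid points tell; disjointing the \<open>C k\<close> yields the events of stopping exactly at the \<open>k\<close>-th
  point.
\<close>

definition after :: "(nat \<Rightarrow> 'a set) \<Rightarrow> nat \<Rightarrow> nat \<Rightarrow> 'a \<times> real \<Rightarrow> bool" where
  "after C n K z \<longleftrightarrow> (\<exists>k<K. fst z \<in> C k \<and> grid n k < snd z)"

lemma sum_gain_after:
  "(\<Sum>k<K. gain_after (grid n k) (disjointed C k) z) = of_bool (after C n K z) * gain z"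
proof (cases "\<exists>j<K. fst z \<in> C j")
  case True
  define j where "j = (LEAST j. fst z \<in> C j)"
  obtain i where i: "i < K" "fst z \<in> C i" using True by blast
  have j: "fst z \<in> C j" "\<And>i. i < j \<Longrightarrow> fst z \<notin> C i" "j \<le> i"
    unfolding j_def using i(2) by (rule LeastI, blast dest: not_less_Least, rule Least_le)
  have jK: "j < K" using j(3) i(1) by simp
  have dj: "fst z \<in> disjointed C j" using j(1,2) by (simp add: disjointed_def)
  have "after C n K z \<longleftrightarrow> grid n j < snd z"
  proof
    assume "after C n K z"
    then obtain k where k: "fst z \<in> C k" "grid n k < snd z" by (auto simp: after_def)
    then have "j \<le> k" using j(2) not_le by blast
    then have "grid n j \<le> grid n k" by (simp add: grid_le_iff)
    with k show "grid n j < snd z" by simp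
  qed (use j(1) jK in \<open>auto simp: after_def\<close>)
  moreover have "(\<Sum>k<K. gain_after (grid n k) (disjointed C k) z) = indicator {grid n j<..} (snd z) * gain z"
  proof -
    have "gain_after (grid n k) (disjointed C k) z =
        indicator {grid n k<..} (snd z) * gain z * indicator (disjointed C k) (fst z)" for k
      by (simp add: gain_after_def)
    then show ?thesis using sum_disjointed_indicator[OF dj jK] by simp
  qed
  ultimately show ?thesis by simp
next
  case False
  then have "fst z \<notin> disjointed C k" if "k < K" for k
    using that disjointed_subset[of C k] by auto
  then have "(\<Sum>k<K. gain_after (grid n k) (disjointed C k) z) = 0"
    by (intro sum.neutral) (simp add: gain_after_def)
  moreover have "\<not> after C n K z" using False by (auto simp: after_def)
  ultimately show ?thesis by simp
qed

context
  fixes C :: "nat \<Rightarrow> 'a set" and n :: nat and x :: real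
  assumes C: "\<And>k. C k \<in> sets (F (grid n k))"
begin

lemma disjointed_adapted: "disjointed C k \<in> sets (F (grid n k))"
proof -
  have "C i \<in> sets (F (grid n k))" if "i < k" for i
    using C[of i] filtration_mono[of "ennreal (grid n i)" "ennreal (grid n k)"] that
    by (auto simp: grid_le_iff intro!: ennreal_leI)
  then show ?thesis
    unfolding disjointed_def using C[of k] by (intro sets.Diff sets.finite_UN) auto
qed

lemma measurable_after:
  "Measurable.pred (\<B> x) (after C n K)"
  "Measurable.pred (\<B> x) (\<lambda>z. \<exists>K. after C n K z)"
proof -
  have [measurable]: "C k \<in> sets (P x)" for k using C filtration_events by blast
  show "Measurable.pred (\<B> x) (after C n K)" for K
    unfolding after_def[abs_def] by measurable
  then show "Measurable.pred (\<B> x) (\<lambda>z. \<exists>K. after C n K z)" by measurable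
qed

lemma after_tendsto:
  fixes f :: "'a \<times> real \<Rightarrow> real"
  assumes f: "integrable (\<B> x) f"
  shows "(\<lambda>K. \<integral>z. of_bool (after C n K z) * f z \<partial>\<B> x) \<longlonglongrightarrow>
    (\<integral>z. of_bool (\<exists>K. after C n K z) * f z \<partial>\<B> x)"
proof (rule integral_dominated_convergence[where w = "\<lambda>z. \<bar>f z\<bar>"])
  note measurable_after [measurable]
  have [measurable]: "f \<in> borel_measurable (\<B> x)" using f by auto
  show "(\<lambda>z. of_bool (\<exists>K. after C n K z) * f z) \<in> borel_measurable (\<B> x)"
    "(\<lambda>z. of_bool (after C n K z) * f z) \<in> borel_measurable (\<B> x)" for K
    unfolding of_bool_def by measurable
  show "AE z in \<B> x. (\<lambda>K. of_bool (after C n K z) * f z) \<longlonglongrightarrow> of_bool (\<exists>K. after C n K z) * f z"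
  proof (intro AE_I2 tendsto_eventually)
    fix z
    show "eventually (\<lambda>K. of_bool (after C n K z) * f z = of_bool (\<exists>K. after C n K z) * f z) sequentially"
    proof (cases "\<exists>K. after C n K z")
      case True
      then obtain K0 where "after C n K0 z" by blast
      then have "after C n K z" if "K0 \<le> K" for K using that by (auto simp: after_def intro: less_le_trans)
      then show ?thesis using True by (auto simp: eventually_sequentially)
    qed simp
  qed
  show "integrable (\<B> x) (\<lambda>z. \<bar>f z\<bar>)" using f by simp
  show "AE z in \<B> x. norm (of_bool (after C n K z) * f z) \<le> \<bar>f z\<bar>" for K
    by (simp add: of_bool_def)
qed

text \<open>
  The comparison of \<open>gain_after_le\<close>, summed over the value of the grid time. For each path at most one
  summand is nonzero, and a maximum over \<open>[s, t]\<close> is at most the maximum over \<open>[0, t]\<close>.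
\<close>

lemma gain_after_grid_le:
  "(\<integral>z. of_bool (\<exists>K. after C n K z) * gain z \<partial>\<B> x) \<le> r * excess_value x"
proof (rule LIMSEQ_le_const2[OF after_tendsto[OF integrable_gain]])
  have "(\<integral>z. of_bool (after C n K z) * gain z \<partial>\<B> x) \<le> r * excess_value x" for K
  proof -
    let ?A = "\<lambda>k. disjointed C k"
    note int = integrable_gain_after[OF grid_nonneg disjointed_adapted]
      integrable_excess_after[OF grid_nonneg disjointed_adapted]
    have "(\<integral>z. of_bool (after C n K z) * gain z \<partial>\<B> x) =
        (\<Sum>k<K. \<integral>z. gain_after (grid n k) (?A k) z \<partial>\<B> x)"
      unfolding sum_gain_after[symmetric] by (rule Bochner_Integration.integral_sum) (rule int)
    also have "\<dots> \<le> (\<Sum>k<K. r * (\<integral>z. excess_after (grid n k) (?A k) z \<partial>\<B> x))"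
      by (intro sum_mono gain_after_le disjointed_adapted) simp
    also have "\<dots> = r * (\<integral>z. (\<Sum>k<K. excess_after (grid n k) (?A k) z) \<partial>\<B> x)"
      by (subst Bochner_Integration.integral_sum) (auto simp: int sum_distrib_left)
    also have "\<dots> \<le> r * (\<integral>z. excess (maximum z) \<partial>\<B> x)"
    proof (intro mult_left_mono integral_mono Bochner_Integration.integrable_sum int integrable_excess_maximum)
      fix z assume z: "z \<in> space (\<B> x)"
      show "(\<Sum>k<K. excess_after (grid n k) (?A k) z) \<le> excess (maximum z)"
      proof (cases "\<exists>j<K. fst z \<in> ?A j")
        case True
        then obtain j where j: "j < K" "fst z \<in> ?A j" by blast
        have "(\<Sum>k<K. excess_after (grid n k) (?A k) z) = excess_after (grid n j) (?A j) z"
          using sum_disjointed_indicator[OF j(2,1), of "\<lambda>k. indicator {grid n k<..} (snd z) * excess (segment_max (grid n k) z)"] j(2)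
          by (simp add: excess_after_def mult_ac)
        then show ?thesis using excess_after_le[OF grid_nonneg disjointed_adapted z] by simp
      next
        case False
        then have "(\<Sum>k<K. excess_after (grid n k) (?A k) z) = 0"
          by (intro sum.neutral) (simp add: excess_after_def)
        then show ?thesis by simp
      qed
    qed (use r in simp)
    finally show ?thesis by (simp add: integral_excess_maximum)
  qed
  then show "\<exists>N. \<forall>K\<ge>N. (\<integral>z. of_bool (after C n K z) * gain z \<partial>\<B> x) \<le> r * excess_value x" by blast
qed

end

definition exceeded :: "nat \<Rightarrow> nat \<Rightarrow> 'a set" where
  "exceeded n k = {\<omega> \<in> space (P 0). \<exists>j\<le>k. c < \<kappa> (X (grid n j) \<omega>)}"

text \<open>
  The index \<open>cell n t - 1\<close> belongs to the last grid point strictly before \<open>t\<close>.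
\<close>

definition grid_excess :: "nat \<Rightarrow> 'a \<times> real \<Rightarrow> real" where
  "grid_excess n z = excess (grid_max (\<lambda>s. X s (fst z)) n (cell n (snd z) - 1))"

lemma grid_excess_nonneg [simp]: "0 \<le> grid_excess n z"
  by (simp add: grid_excess_def)

lemma exceeded_adapted: "exceeded n k \<in> sets (F (grid n k))"
proof -
  have "{\<omega> \<in> space (F (grid n k)). c < \<kappa> (X (grid n j) \<omega>)} \<in> sets (F (grid n k))" if "j \<le> k" for j
  proof -
    have [measurable]: "X (grid n j) \<in> borel_measurable (F (grid n k))"
      using that by (intro adapted) (auto simp: grid_le_iff)
    show ?thesis by measurable
  qed
  then have "(\<Union>j\<le>k. {\<omega> \<in> space (F (grid n k)). c < \<kappa> (X (grid n j) \<omega>)}) \<in> sets (F (grid n k))"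
    by (intro sets.finite_UN) auto
  also have "(\<Union>j\<le>k. {\<omega> \<in> space (F (grid n k)). c < \<kappa> (X (grid n j) \<omega>)}) = exceeded n k"
    by (auto simp: exceeded_def space_natural_filtration)
  finally show ?thesis .
qed

lemma exceeded_disjointed:
  assumes "\<omega> \<in> disjointed (exceeded n) k"
  shows "c < \<kappa> (X (grid n k) \<omega>)" "\<And>j. j < k \<Longrightarrow> \<kappa> (X (grid n j) \<omega>) \<le> c"
proof -
  have \<omega>: "\<omega> \<in> exceeded n k" "\<And>j. j < k \<Longrightarrow> \<omega> \<notin> exceeded n j"
    using assms by (auto simp: disjointed_def)
  show less: "\<kappa> (X (grid n j) \<omega>) \<le> c" if "j < k" for j
    using \<omega>(1) \<omega>(2)[OF that] by (auto simp: exceeded_def not_less)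
  obtain j where "j \<le> k" "c < \<kappa> (X (grid n j) \<omega>)" using \<omega>(1) by (auto simp: exceeded_def)
  then show "c < \<kappa> (X (grid n k) \<omega>)" using less[of j] by (cases "j = k") auto
qed

lemma measurable_grid_max_cell [measurable]:
  "(\<lambda>z. grid_max (\<lambda>s. X s (fst z)) n (h (cell n (snd z)))) \<in> borel_measurable (\<B> x)"
proof -
  have [measurable]: "(\<lambda>z. h (cell n (snd z))) \<in> measurable (\<B> x) (count_space UNIV)" by measurable
  have [measurable]: "(\<lambda>z. grid_max (\<lambda>s. X s (fst z)) n k) \<in> borel_measurable (\<B> x)" for k
    by (intro measurable_grid_max measurable_X_fst) simp
  show ?thesis
    by (rule measurable_compose_countable[where f = "\<lambda>k z. grid_max (\<lambda>s. X s (fst z)) n k"]) measurable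
qed

lemma measurable_grid_excess [measurable]: "grid_excess n \<in> borel_measurable (\<B> x)"
  unfolding grid_excess_def[abs_def] using measurable_grid_max_cell[of n "\<lambda>k. k - 1"] by measurable

lemma grid_max_attained: "\<exists>j\<le>k. grid_max p n k = p (grid n j)"
proof -
  have "grid_max p n k \<in> (\<lambda>j. p (grid n j)) ` {..k}"
    unfolding grid_max_def by (rule Max_in) auto
  then show ?thesis by auto
qed

lemma grid_excess_attained:
  assumes "0 < snd z"
  obtains j where "grid n j < snd z" "grid_excess n z = excess (X (grid n j) (fst z))"
proof -
  have cell: "0 < cell n (snd z)" using grid_less_cell_iff[of n 0 "snd z"] assms by simp
  obtain j where j: "j \<le> cell n (snd z) - 1"
    "grid_max (\<lambda>s. X s (fst z)) n (cell n (snd z) - 1) = X (grid n j) (fst z)"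
    using grid_max_attained by blast
  then have "grid n j < snd z" using cell by (simp add: grid_less_cell_iff)
  with j(2) show ?thesis using that by (simp add: grid_excess_def)
qed

lemma grid_excess_le:
  assumes "z \<in> space (\<B> x)" "0 < snd z"
  shows "grid_excess n z \<le> excess (maximum z)"
proof -
  obtain j where j: "grid n j < snd z" "grid_excess n z = excess (X (grid n j) (fst z))"
    using grid_excess_attained[OF assms(2)] .
  have \<omega>: "fst z \<in> space (P x)" using assms(1) by (auto simp: space_pair_measure)
  have "X (grid n j) (fst z) \<le> running_sup X (snd z) (fst z)"
    unfolding running_sup_def using j(1) by (intro cSUP_upper cadlag_bdd_above cadlag_X[OF \<omega>]) auto
  also have "\<dots> = maximum z" using maximum_eq[OF \<omega>, of "snd z"] assms(2) by simp
  finally show ?thesis unfolding j(2) by (rule monoD[OF mono_excess])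
qed

lemma integrable_grid_excess: "integrable (\<B> x) (grid_excess n)"
proof (rule Bochner_Integration.integrable_bound[OF integrable_excess_maximum[of x]])
  show "AE z in \<B> x. norm (grid_excess n z) \<le> norm (excess (maximum z))"
    using AE_time_pos[of x] AE_space
  proof eventually_elim
    case (elim z)
    then show ?case using grid_excess_le[of z x n] by (simp add: grid_excess_def)
  qed
qed (rule measurable_grid_excess)

text \<open>
  Now each summand is an equality because the level is exceeded at the time of stopping. The grid
  points before it contribute no excess, and those after it are covered by the maximum over
  \<open>[s, t]\<close>.
\<close>

lemma gain_after_exceeded_ge:
  "r * (\<integral>z. grid_excess n z \<partial>\<B> x) \<le>
    (\<integral>z. of_bool (\<exists>K. after (exceeded n) n K z) * gain z \<partial>\<B> x)"
proof -
  let ?C = "exceeded n" and ?A = "disjointed (exceeded n)"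
  note after_lims = after_tendsto[where C = ?C and n = n, OF exceeded_adapted]
  note int = integrable_gain_after[OF grid_nonneg disjointed_adapted[where C = ?C and n = n, OF exceeded_adapted]]
    integrable_excess_after[OF grid_nonneg disjointed_adapted[where C = ?C and n = n, OF exceeded_adapted]]
  have restrict: "(\<integral>z. grid_excess n z \<partial>\<B> x) = (\<integral>z. of_bool (\<exists>K. after ?C n K z) * grid_excess n z \<partial>\<B> x)"
  proof (rule integral_cong_AE)
    show "AE z in \<B> x. grid_excess n z = of_bool (\<exists>K. after ?C n K z) * grid_excess n z"
      using AE_time_pos[of x]
    proof eventually_elim
      case (elim z)
      obtain j where j: "grid n j < snd z" "grid_excess n z = excess (X (grid n j) (fst z))"
        using grid_excess_attained elim by blast
      show ?case
      proof (cases "c < \<kappa> (X (grid n j) (fst z))")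
        case True
        then have "after ?C n (Suc j) z"
          using elim j(1) by (auto simp: after_def exceeded_def space_P[of x])
        then show ?thesis by auto
      qed (simp add: j(2) excess_def)
    qed
    show "(\<lambda>z. of_bool (\<exists>K. after ?C n K z) * grid_excess n z) \<in> borel_measurable (\<B> x)"
      using measurable_after(2)[where C = ?C and n = n and x = x, OF exceeded_adapted] unfolding of_bool_def by measurable
  qed measurable
  show ?thesis
    unfolding restrict
  proof (rule LIMSEQ_le[OF tendsto_mult_left[OF after_lims[OF integrable_grid_excess]] after_lims[OF integrable_gain]])
    have "r * (\<integral>z. of_bool (after ?C n K z) * grid_excess n z \<partial>\<B> x) \<le>
        (\<integral>z. of_bool (after ?C n K z) * gain z \<partial>\<B> x)" for K
    proof -
      have [measurable]: "Measurable.pred (\<B> x) (after ?C n K)"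
        using measurable_after(1)[where C = ?C and n = n and x = x, OF exceeded_adapted] .
      have "(\<lambda>z. of_bool (after ?C n K z) * grid_excess n z) \<in> borel_measurable (\<B> x)"
        unfolding of_bool_def by measurable
      then have "integrable (\<B> x) (\<lambda>z. of_bool (after ?C n K z) * grid_excess n z)"
        by (rule Bochner_Integration.integrable_bound[OF integrable_grid_excess[of x n]]) (simp add: of_bool_def)
      then have "(\<integral>z. of_bool (after ?C n K z) * grid_excess n z \<partial>\<B> x) \<le>
          (\<integral>z. (\<Sum>k<K. excess_after (grid n k) (?A k) z) \<partial>\<B> x)"
      proof (rule integral_mono_AE)
        show "integrable (\<B> x) (\<lambda>z. \<Sum>k<K. excess_after (grid n k) (?A k) z)"
          by (intro Bochner_Integration.integrable_sum int)
        show "AE z in \<B> x. of_bool (after ?C n K z) * grid_excess n z \<le>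
            (\<Sum>k<K. excess_after (grid n k) (?A k) z)"
          using AE_time_pos[of x]
        proof eventually_elim
          case (elim z)
          show ?case
          proof (cases "after ?C n K z")
            case True
            then obtain k where k: "k < K" "fst z \<in> ?C k" "grid n k < snd z" by (auto simp: after_def)
            \<comment> \<open>The grid point at which the path is stopped.\<close>
            define i where "i = (LEAST i. fst z \<in> ?C i)"
            have i: "fst z \<in> ?C i" "\<And>j. j < i \<Longrightarrow> fst z \<notin> ?C j" "i \<le> k"
              unfolding i_def using k(2) by (rule LeastI, blast dest: not_less_Least, rule Least_le)
            then have A: "fst z \<in> ?A i" by (simp add: disjointed_def)
            have "grid n i \<le> grid n k" using i(3) by (simp add: grid_le_iff)
            then have before: "grid n i < snd z" using k(3) by simp
            have "(\<Sum>k<K. excess_after (grid n k) (?A k) z) = excess (segment_max (grid n i) z)"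
              using sum_disjointed_indicator[OF A, of K "\<lambda>k. indicator {grid n k<..} (snd z) * excess (segment_max (grid n k) z)"]
                i(3) k(1) before by (simp add: excess_after_def mult_ac)
            moreover have "grid_excess n z \<le> excess (segment_max (grid n i) z)"
            proof -
              obtain j where j: "grid n j < snd z" "grid_excess n z = excess (X (grid n j) (fst z))"
                using grid_excess_attained elim by blast
              show ?thesis
              proof (cases "j < i")
                case True
                then show ?thesis using exceeded_disjointed(2)[OF A True] by (simp add: j(2) excess_def)
              next
                case False
                then have "X (grid n j) (fst z) \<le> segment_max (grid n i) (fst z, snd z)"
                  using elim j(1) by (intro segment_max_ge[of _ x]) (auto simp: grid_le_iff)
                then show ?thesis unfolding j(2) by (simp add: monoD[OF mono_excess])
              qed
            qed
            ultimately show ?thesis using True by simp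
          next
            case False
            then show ?thesis by (simp add: sum_nonneg excess_after_def)
          qed
        qed
      qed
      then have "r * (\<integral>z. of_bool (after ?C n K z) * grid_excess n z \<partial>\<B> x) \<le>
          r * (\<Sum>k<K. \<integral>z. excess_after (grid n k) (?A k) z \<partial>\<B> x)"
        using r by (subst (asm) Bochner_Integration.integral_sum) (auto simp: int intro: mult_left_mono)
      also have "\<dots> = (\<Sum>k<K. \<integral>z. gain_after (grid n k) (?A k) z \<partial>\<B> x)"
        unfolding sum_distrib_left
        by (intro sum.cong refl gain_after_eq[symmetric] disjointed_adapted[where C = ?C and n = n, OF exceeded_adapted])
          (auto dest: exceeded_disjointed(1))
      also have "\<dots> = (\<integral>z. of_bool (after ?C n K z) * gain z \<partial>\<B> x)"
        unfolding sum_gain_after[symmetric] by (rule Bochner_Integration.integral_sum[symmetric]) (rule int)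
      finally show ?thesis .
    qed
    then show "\<exists>N. \<forall>K\<ge>N. r * (\<integral>z. of_bool (after ?C n K z) * grid_excess n z \<partial>\<B> x) \<le>
        (\<integral>z. of_bool (after ?C n K z) * gain z \<partial>\<B> x)" by blast
  qed
qed

text \<open>
  The grid maximum up to \<open>cell n t\<close> converges to the running maximum and is dominated by the running
  maximum one unit of time later, which is integrable by memorylessness. Dropping the last grid
  point costs only the factor \<open>q\<close>, by \<open>nn_integral_cell\<close>.
\<close>

lemma grid_excess_lower:
  "\<exists>e. e \<longlonglongrightarrow> excess_value x \<and> (\<forall>n. e n \<le> (\<integral>z. grid_excess n z \<partial>\<B> x))"
proof -
  define q where "q n = exp (- r * grid n 1)" for n
  define H where "H n z = excess (grid_max (\<lambda>s. X s (fst z)) n (cell n (snd z)))" for n z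
  have [measurable]: "H n \<in> borel_measurable (\<B> x)" for n
    unfolding H_def[abs_def] using measurable_grid_max_cell[of n "\<lambda>k. k"] by measurable
  \<comment> \<open>A mesh is at most one, so the grid maximum does not look further than one unit of time ahead.\<close>
  define D where "D z = excess (maximum (fst z, 1 + snd z))" for z
  have max_meas: "(\<lambda>z. excess (maximum z)) \<in> borel_measurable (P x \<Otimes>\<^sub>M borel)"
    using measurable_compose[OF measurable_position_maximum(2) measurable_kappa(2), of x]
    by (simp cong: measurable_cong_sets sets_pair_measure_cong)
  have "integrable (\<B> x) (\<lambda>z. indicator {1<..} (snd z) * excess (maximum z))"
    by (rule Bochner_Integration.integrable_bound[OF integrable_excess_maximum[of x]])
      (measurable, auto simp: indicator_def)
  then have int_D: "integrable (\<B> x) D"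
    using integral_memoryless(2)[OF r _ max_meas, of 1] by (simp add: D_def[abs_def] split_beta')
  have le_D: "AE z in \<B> x. norm (H n z) \<le> D z" for n
    using AE_time_pos[of x]
  proof eventually_elim
    case (elim z)
    obtain j where j: "j \<le> cell n (snd z)" "grid_max (\<lambda>s. X s (fst z)) n (cell n (snd z)) = X (grid n j) (fst z)"
      using grid_max_attained by blast
    have "grid n j \<le> grid n (cell n (snd z))" using j(1) by (simp add: grid_le_iff)
    also have "\<dots> \<le> snd z + 1 / 2 ^ n" using grid_cell_less[of "snd z" n] elim by simp
    also have "\<dots> \<le> snd z + 1" by simp
    finally have "X (grid n j) (fst z) \<le> running_sup X (1 + snd z) (fst z)"
      unfolding running_sup_def using elim by (intro cSUP_upper cadlag_bdd_above cadlag_X[of _ x]) auto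
    also have "\<dots> = maximum (fst z, 1 + snd z)" using maximum_eq[of "fst z" x "1 + snd z"] elim by simp
    finally show ?case by (simp add: H_def D_def j(2) monoD[OF mono_excess])
  qed
  have int_H: "integrable (\<B> x) (H n)" for n
    by (rule Bochner_Integration.integrable_bound[OF int_D]) (use le_D[of n] in \<open>auto elim!: eventually_mono\<close>)
  have lim: "(\<lambda>n. \<integral>z. H n z \<partial>\<B> x) \<longlonglongrightarrow> (\<integral>z. excess (maximum z) \<partial>\<B> x)"
  proof (rule integral_dominated_convergence[OF _ _ int_D])
    show "AE z in \<B> x. (\<lambda>n. H n z) \<longlonglongrightarrow> excess (maximum z)"
      using AE_time_pos[of x]
    proof eventually_elim
      case (elim z)
      then have t: "0 \<le> snd z" and c: "cadlag (\<lambda>s. X s (fst z))" by (auto intro: cadlag_X)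
      have "(\<lambda>n. grid_max (\<lambda>s. X s (fst z)) n (cell n (snd z))) \<longlonglongrightarrow> maximum z"
        unfolding maximum_def path_sup_cadlag[OF c t] by (rule grid_max_tendsto[OF c t])
      then show ?case
        unfolding H_def by (rule continuous_on_tendsto_compose[OF continuous_excess]) auto
    qed
  qed (use le_D in auto)
  have "(\<lambda>n. grid n 1) \<longlonglongrightarrow> 0"
    using LIMSEQ_power_zero[of "1 / 2 :: real"] by (simp add: grid_def power_divide)
  then have "q \<longlonglongrightarrow> exp (- r * 0)"
    unfolding q_def by (intro tendsto_intros)
  then have "(\<lambda>n. q n * (\<integral>z. H n z \<partial>\<B> x)) \<longlonglongrightarrow> 1 * excess_value x"
    using lim unfolding integral_excess_maximum by (intro tendsto_mult) simp_all
  moreover have "q n * (\<integral>z. H n z \<partial>\<B> x) \<le> (\<integral>z. grid_excess n z \<partial>\<B> x)" for n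
  proof -
    have "ennreal (q n) * (\<integral>\<^sup>+z. ennreal (H n z) \<partial>\<B> x) \<le> (\<integral>\<^sup>+z. ennreal (grid_excess n z) \<partial>\<B> x)"
    proof -
      have "ennreal (q n) * (\<integral>\<^sup>+z. ennreal (H n z) \<partial>\<B> x) =
          (\<integral>\<^sup>+\<omega>. ennreal (q n) * (\<integral>\<^sup>+t. ennreal (H n (\<omega>, t)) \<partial>exp_law r) \<partial>P x)"
        by (subst E.nn_integral_fst[symmetric]) (simp_all add: nn_integral_cmult)
      also have "\<dots> \<le> (\<integral>\<^sup>+\<omega>. \<integral>\<^sup>+t. ennreal (grid_excess n (\<omega>, t)) \<partial>exp_law r \<partial>P x)"
      proof (rule nn_integral_mono)
        fix \<omega>
        show "ennreal (q n) * (\<integral>\<^sup>+t. ennreal (H n (\<omega>, t)) \<partial>exp_law r) \<le>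
            (\<integral>\<^sup>+t. ennreal (grid_excess n (\<omega>, t)) \<partial>exp_law r)"
          using nn_integral_cell[OF r, of "\<lambda>k. ennreal (excess (grid_max (\<lambda>s. X s \<omega>) n k))" n]
          by (simp add: H_def grid_excess_def q_def)
      qed
      also have "\<dots> = (\<integral>\<^sup>+z. ennreal (grid_excess n z) \<partial>\<B> x)"
        by (rule E.nn_integral_fst) simp
      finally show ?thesis .
    qed
    moreover have "(\<integral>\<^sup>+z. ennreal (H n z) \<partial>\<B> x) = ennreal (\<integral>z. H n z \<partial>\<B> x)"
      by (rule nn_integral_eq_integral[OF int_H]) (simp add: H_def)
    moreover have "(\<integral>\<^sup>+z. ennreal (grid_excess n z) \<partial>\<B> x) = ennreal (\<integral>z. grid_excess n z \<partial>\<B> x)"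
      by (rule nn_integral_eq_integral[OF integrable_grid_excess]) (simp add: grid_excess_def)
    ultimately have "ennreal (q n * (\<integral>z. H n z \<partial>\<B> x)) \<le> ennreal (\<integral>z. grid_excess n z \<partial>\<B> x)"
      by (simp add: q_def ennreal_mult')
    then show ?thesis
      by (subst (asm) ennreal_le_iff) (auto intro!: integral_nonneg_AE)
  qed
  ultimately show ?thesis by (intro exI[of _ "\<lambda>n. q n * (\<integral>z. H n z \<partial>\<B> x)"]) simp
qed

end

section \<open>The value of the stopping problem\<close>

context levy_exp
begin

lemma exp_law_after: "0 \<le> s \<Longrightarrow> measure (exp_law r) {s<..} = exp (- r * s)"
  using nn_integral_exp_law_after[OF r, of s "\<lambda>_. 1"] E.emeasure_space_1
  by (simp add: E.emeasure_eq_measure)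

lemma discount_eq: "discount r \<tau> = (\<integral>t. of_bool (\<tau> < ennreal t) \<partial>exp_law r)"
proof (cases \<tau>)
  case (real s)
  have "AE t in exp_law r. of_bool (\<tau> < ennreal t) = indicat_real {s<..} t"
    using AE_exp_law_pos[of r]
    by eventually_elim (use real in \<open>auto simp: ennreal_less_iff indicator_def\<close>)
  then have "(\<integral>t. of_bool (\<tau> < ennreal t) \<partial>exp_law r) = (\<integral>t. indicat_real {s<..} t \<partial>exp_law r)"
    by (intro integral_cong_AE) (simp_all add: of_bool_def)
  then show ?thesis using exp_law_after[of s] real by (simp add: discount_def)
qed (simp add: discount_def)

end

context stopping_problem
begin

lemma integral_exp_law:
  fixes f :: "real \<Rightarrow> real"
  assumes [measurable]: "f \<in> borel_measurable borel"
  shows "(\<integral>t. f t \<partial>exp_law r) = (LBINT t:{0..}. f t * (r * exp (- r * t)))"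
proof -
  have "(\<integral>t. f t \<partial>exp_law r) = (\<integral>t. exponential_density r t *\<^sub>R f t \<partial>lborel)"
    unfolding exp_law_def using r by (intro integral_density) (auto simp: exponential_density_nonneg)
  also have "\<dots> = (LBINT t:{0..}. f t * (r * exp (- r * t)))"
    unfolding set_lebesgue_integral_def
    by (intro Bochner_Integration.integral_cong) (auto simp: exponential_density_def indicator_def mult_ac)
  finally show ?thesis .
qed

lemma measurable_section:
  assumes "f \<in> borel_measurable (\<B> x)" "\<omega> \<in> space (P x)"
  shows "(\<lambda>t. f (\<omega>, t)) \<in> borel_measurable borel"
proof -
  have "f \<in> borel_measurable (P x \<Otimes>\<^sub>M borel)"
    using assms(1) by (simp cong: measurable_cong_sets sets_pair_measure_cong)
  then show ?thesis using assms(2) by measurable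
qed

lemma running_cost_eq:
  assumes \<omega>: "\<omega> \<in> space (P x)"
  shows "running_cost g r X \<tau> \<omega> = 1 / r * (\<integral>t. of_bool (ennreal t \<le> \<tau>) * g (position (\<omega>, t)) \<partial>exp_law r)"
proof -
  have [measurable]: "(\<lambda>t. position (\<omega>, t)) \<in> borel_measurable borel"
    by (rule measurable_section[OF _ \<omega>]) measurable
  have "(\<integral>t. of_bool (ennreal t \<le> \<tau>) * g (position (\<omega>, t)) \<partial>exp_law r) =
      (LBINT t:{0..}. of_bool (ennreal t \<le> \<tau>) * g (position (\<omega>, t)) * (r * exp (- r * t)))"
    by (rule integral_exp_law) (simp add: of_bool_def)
  also have "\<dots> = r * running_cost g r X \<tau> \<omega>"
    unfolding running_cost_def set_lebesgue_integral_def integral_mult_right_zero[symmetric]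
    by (intro Bochner_Integration.integral_cong refl)
      (auto simp: indicator_def position_eq[OF \<omega>])
  finally show ?thesis using r by simp
qed

definition gain_beyond :: "('a \<Rightarrow> ennreal) \<Rightarrow> real \<Rightarrow> real" where
  "gain_beyond \<tau> x = (\<integral>z. of_bool (\<tau> (fst z) < ennreal (snd z)) * gain z \<partial>\<B> x)"

text \<open>
  For almost every path all the time integrals converge, and the cost of stopping at \<open>\<tau>\<close> is the
  cost of never stopping less the integral of \<open>g - r c\<close> beyond \<open>\<tau>\<close>, the discount factor being the
  probability that an exponential time exceeds \<open>\<tau>\<close>.
\<close>

lemma expected_cost:
  assumes [measurable]: "\<tau> \<in> borel_measurable (P x)"
  shows "(\<integral>\<omega>. running_cost g r X (\<tau> \<omega>) \<omega> + c * discount r (\<tau> \<omega>) \<partial>P x) =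
    resolvent P X r g x - 1 / r * gain_beyond \<tau> x"
proof -
  define all where "all \<omega> = (\<integral>t. g (position (\<omega>, t)) \<partial>exp_law r)" for \<omega>
  define beyond where "beyond \<omega> = (\<integral>t. of_bool (\<tau> \<omega> < ennreal t) * gain (\<omega>, t) \<partial>exp_law r)" for \<omega>
  define cost where "cost \<omega> = 1 / r * (\<integral>t. of_bool (ennreal t \<le> \<tau> \<omega>) * g (position (\<omega>, t)) \<partial>exp_law r) +
      c * (\<integral>t. of_bool (\<tau> \<omega> < ennreal t) \<partial>exp_law r)" for \<omega>
  have beyond_meas [measurable]: "(\<lambda>z. of_bool (\<tau> (fst z) < ennreal (snd z)) * gain z) \<in> borel_measurable (\<B> x)"
    unfolding of_bool_def by measurable
  have int_beyond: "integrable (\<B> x) (\<lambda>z. of_bool (\<tau> (fst z) < ennreal (snd z)) * gain z)"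
    by (rule Bochner_Integration.integrable_bound[OF integrable_gain beyond_meas]) (simp add: of_bool_def)
  have int_all: "integrable (P x) all"
    unfolding all_def[abs_def] by (rule B.integrable_fst'[OF integrable_g_position])
  have int_beyond': "integrable (P x) beyond"
    unfolding beyond_def[abs_def] using B.integrable_fst'[OF int_beyond] by simp
  have "(\<integral>\<omega>. running_cost g r X (\<tau> \<omega>) \<omega> + c * discount r (\<tau> \<omega>) \<partial>P x) = (\<integral>\<omega>. cost \<omega> \<partial>P x)"
    by (intro Bochner_Integration.integral_cong) (simp_all add: cost_def running_cost_eq discount_eq)
  also have "\<dots> = (\<integral>\<omega>. 1 / r * all \<omega> - 1 / r * beyond \<omega> \<partial>P x)"
  proof (rule integral_cong_AE)
    show "cost \<in> borel_measurable (P x)"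
      unfolding cost_def[abs_def] of_bool_def by measurable
    show "(\<lambda>\<omega>. 1 / r * all \<omega> - 1 / r * beyond \<omega>) \<in> borel_measurable (P x)"
      using int_all int_beyond' by auto
    show "AE \<omega> in P x. cost \<omega> = 1 / r * all \<omega> - 1 / r * beyond \<omega>"
      using B.AE_integrable_fst'[OF integrable_g_position[of x]] AE_space
    proof eventually_elim
      case (elim \<omega>)
      have [measurable]: "(\<lambda>t. position (\<omega>, t)) \<in> borel_measurable borel"
        by (rule measurable_section[of _ x]) (use elim in auto)
      have int: "integrable (exp_law r) (\<lambda>t. g (position (\<omega>, t)))" using elim by simp
      have int1: "integrable (exp_law r) (\<lambda>t. of_bool (ennreal t \<le> \<tau> \<omega>) * g (position (\<omega>, t)))"
        by (rule Bochner_Integration.integrable_bound[OF int]) (simp_all add: of_bool_def)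
      have int2: "integrable (exp_law r) (\<lambda>t. of_bool (\<tau> \<omega> < ennreal t) :: real)"
        by (rule E.integrable_const_bound[where B = 1]) (simp_all add: of_bool_def)
      have "beyond \<omega> = (\<integral>t. g (position (\<omega>, t)) - of_bool (ennreal t \<le> \<tau> \<omega>) * g (position (\<omega>, t)) -
          r * c * of_bool (\<tau> \<omega> < ennreal t) \<partial>exp_law r)"
        unfolding beyond_def gain_def
        by (intro Bochner_Integration.integral_cong refl) (auto simp: of_bool_def algebra_simps)
      also have "\<dots> = all \<omega> - (\<integral>t. of_bool (ennreal t \<le> \<tau> \<omega>) * g (position (\<omega>, t)) \<partial>exp_law r) -
          r * c * (\<integral>t. of_bool (\<tau> \<omega> < ennreal t) \<partial>exp_law r)"
        unfolding all_def using int int1 int2 by simp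
      finally show ?case using r by (simp add: cost_def field_simps)
    qed
  qed
  also have "\<dots> = 1 / r * (\<integral>\<omega>. all \<omega> \<partial>P x) - 1 / r * (\<integral>\<omega>. beyond \<omega> \<partial>P x)"
    using int_all int_beyond' by simp
  also have "(\<integral>\<omega>. beyond \<omega> \<partial>P x) = gain_beyond \<tau> x"
    unfolding beyond_def gain_beyond_def using B.integral_fst'[OF int_beyond] by simp
  also have "1 / r * (\<integral>\<omega>. all \<omega> \<partial>P x) = resolvent P X r g x"
  proof -
    have "resolvent P X r g x = (\<integral>\<omega>. 1 / r * all \<omega> \<partial>P x)"
      unfolding resolvent_def all_def by (intro Bochner_Integration.integral_cong refl) (simp add: running_cost_eq)
    then show ?thesis by simp
  qed
  finally show ?thesis .
qed

lemma measurable_stopping: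
  assumes "stopping_time (natural_filtration (space (P 0)) X) \<tau>"
  shows "\<tau> \<in> borel_measurable (P x)"
  by (rule measurable_stopping_time[OF assms filtration_events])
    (simp add: space_natural_filtration space_P[of x])

text \<open>
  Rounding \<open>\<tau>\<close> up to the grid gives grid times that decrease to \<open>\<tau>\<close>, and the events of having
  stopped by a grid point are known at that point. Dominated convergence yields the limit.
\<close>

lemma gain_beyond_le:
  assumes \<tau>: "stopping_time (natural_filtration (space (P 0)) X) \<tau>"
  shows "gain_beyond \<tau> x \<le> r * excess_value x"
proof -
  have [measurable]: "\<tau> \<in> borel_measurable (P x)" by (rule measurable_stopping[OF \<tau>])
  define C where "C n k = {\<omega> \<in> space (P 0). \<tau> \<omega> \<le> ennreal (grid n k)}" for n k
  have C: "C n k \<in> sets (F (grid n k))" for n k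
    using stopping_timeD[OF \<tau>, of "ennreal (grid n k)"]
    by (simp add: C_def pred_def space_natural_filtration)
  have "(\<lambda>n. \<integral>z. of_bool (\<exists>K. after (C n) n K z) * gain z \<partial>\<B> x) \<longlonglongrightarrow> gain_beyond \<tau> x"
    unfolding gain_beyond_def
  proof (rule integral_dominated_convergence[where w = "\<lambda>z. \<bar>gain z\<bar>"])
    show "(\<lambda>z. of_bool (\<tau> (fst z) < ennreal (snd z)) * gain z) \<in> borel_measurable (\<B> x)"
      unfolding of_bool_def by measurable
    show "(\<lambda>z. of_bool (\<exists>K. after (C n) n K z) * gain z) \<in> borel_measurable (\<B> x)" for n
      using measurable_after(2)[where C = "C n" and n = n and x = x, OF C]
      unfolding of_bool_def by measurable
    show "integrable (\<B> x) (\<lambda>z. \<bar>gain z\<bar>)" using integrable_gain by simp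
    show "AE z in \<B> x. norm (of_bool (\<exists>K. after (C n) n K z) * gain z) \<le> \<bar>gain z\<bar>" for n
      by (simp add: of_bool_def)
    show "AE z in \<B> x. (\<lambda>n. of_bool (\<exists>K. after (C n) n K z) * gain z) \<longlonglongrightarrow>
        of_bool (\<tau> (fst z) < ennreal (snd z)) * gain z"
      using AE_time_pos[of x]
    proof (eventually_elim, intro tendsto_eventually)
      case (elim z)
      show "eventually (\<lambda>n. of_bool (\<exists>K. after (C n) n K z) * gain z =
          of_bool (\<tau> (fst z) < ennreal (snd z)) * gain z) sequentially"
      proof (cases "\<tau> (fst z) < ennreal (snd z)")
        case True
        then obtain s where s: "0 \<le> s" "\<tau> (fst z) = ennreal s"
          by (cases "\<tau> (fst z)") auto
        then have less: "s < snd z" using True by (simp add: ennreal_less_iff)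
        have "eventually (\<lambda>n. grid n (cell n s) < snd z) sequentially"
          using grid_cell_tendsto[OF s(1)] less by (rule order_tendstoD)
        then have "eventually (\<lambda>n. \<exists>K. after (C n) n K z) sequentially"
        proof (rule eventually_mono)
          fix n assume "grid n (cell n s) < snd z"
          moreover have "fst z \<in> C n (cell n s)"
            using elim s le_grid_cell[of s n] by (auto simp: C_def space_P[of x] intro: ennreal_leI)
          ultimately have "after (C n) n (Suc (cell n s)) z" by (auto simp: after_def)
          then show "\<exists>K. after (C n) n K z" by blast
        qed
        then show ?thesis by (rule eventually_mono) (use True in simp)
      next
        case False
        have "\<not> after (C n) n K z" for n K
        proof
          assume "after (C n) n K z"
          then obtain k where "\<tau> (fst z) \<le> ennreal (grid n k)" "grid n k < snd z"
            by (auto simp: after_def C_def)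
          then have "\<tau> (fst z) < ennreal (snd z)"
            by (auto intro: le_less_trans simp: ennreal_less_iff)
          with False show False by simp
        qed
        then show ?thesis using False by simp
      qed
    qed
  qed
  then show ?thesis
    by (rule LIMSEQ_le_const2) (intro exI[of _ 0] allI impI gain_after_grid_le C)
qed

text \<open>
  Entry into a set is observed along a grid because the entry time in continuous time need not be a
  stopping time of the natural filtration, which is neither right-continuous nor completed.
\<close>

definition grid_entry :: "nat \<Rightarrow> 'a \<Rightarrow> ennreal" where
  "grid_entry n \<omega> = (if \<exists>k. c < \<kappa> (X (grid n k) \<omega>)
    then ennreal (grid n (LEAST k. c < \<kappa> (X (grid n k) \<omega>))) else \<infinity>)"

lemma grid_entry_less_iff:
  assumes "\<omega> \<in> space (P x)" "0 < t"
  shows "grid_entry n \<omega> < ennreal t \<longleftrightarrow> (\<exists>K. after (exceeded n) n K (\<omega>, t))"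
proof
  let ?L = "LEAST k. c < \<kappa> (X (grid n k) \<omega>)"
  assume less: "grid_entry n \<omega> < ennreal t"
  then have ex: "\<exists>k. c < \<kappa> (X (grid n k) \<omega>)" by (auto simp: grid_entry_def split: if_splits)
  then have "grid n ?L < t" using less by (simp add: grid_entry_def ennreal_less_iff)
  moreover have "c < \<kappa> (X (grid n ?L) \<omega>)" using ex by (rule LeastI_ex)
  ultimately have "after (exceeded n) n (Suc ?L) (\<omega>, t)"
    using assms by (auto simp: after_def exceeded_def space_P[of x])
  then show "\<exists>K. after (exceeded n) n K (\<omega>, t)" by blast
next
  let ?L = "LEAST k. c < \<kappa> (X (grid n k) \<omega>)"
  assume "\<exists>K. after (exceeded n) n K (\<omega>, t)"
  then obtain k j where k: "grid n k < t" "j \<le> k" "c < \<kappa> (X (grid n j) \<omega>)"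
    by (auto simp: after_def exceeded_def)
  have "?L \<le> k" using Least_le[of "\<lambda>k. c < \<kappa> (X (grid n k) \<omega>)", OF k(3)] k(2) by simp
  then have "grid n ?L \<le> grid n k" by (simp add: grid_le_iff)
  then have "grid n ?L < t" using k(1) by simp
  then show "grid_entry n \<omega> < ennreal t" using k(3) by (auto simp: grid_entry_def ennreal_less_iff)
qed

lemma stopping_time_grid_entry: "stopping_time (natural_filtration (space (P 0)) X) (grid_entry n)"
proof
  fix t :: ennreal
  let ?F = "natural_filtration (space (P 0)) X t"
  have iff: "grid_entry n \<omega> \<le> t \<longleftrightarrow> t = \<infinity> \<or> (\<exists>k. ennreal (grid n k) \<le> t \<and> c < \<kappa> (X (grid n k) \<omega>))" for \<omega>
  proof -
    let ?Q = "\<lambda>k. c < \<kappa> (X (grid n k) \<omega>)"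
    show ?thesis
    proof (cases "\<exists>k. ?Q k")
      case True
      let ?L = "LEAST k. ?Q k"
      have entry: "grid_entry n \<omega> = ennreal (grid n ?L)" using True by (simp add: grid_entry_def)
      have L: "?Q ?L" using True by (rule LeastI_ex)
      show ?thesis
      proof
        assume "grid_entry n \<omega> \<le> t"
        then have "ennreal (grid n ?L) \<le> t" by (simp only: entry)
        with L show "t = \<infinity> \<or> (\<exists>k. ennreal (grid n k) \<le> t \<and> ?Q k)" by blast
      next
        assume "t = \<infinity> \<or> (\<exists>k. ennreal (grid n k) \<le> t \<and> ?Q k)"
        then show "grid_entry n \<omega> \<le> t"
        proof
          assume "\<exists>k. ennreal (grid n k) \<le> t \<and> ?Q k"
          then obtain k where k: "ennreal (grid n k) \<le> t" "?Q k" by blast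
          have "?L \<le> k" using k(2) by (rule Least_le)
          then have "ennreal (grid n ?L) \<le> ennreal (grid n k)"
            by (intro ennreal_leI) (simp add: grid_le_iff)
          then show ?thesis unfolding entry using k(1) by (rule order_trans)
        qed simp
      qed
    qed (simp add: grid_entry_def top_unique)
  qed
  have "{\<omega> \<in> space ?F. ennreal (grid n k) \<le> t \<and> c < \<kappa> (X (grid n k) \<omega>)} \<in> sets ?F" for k
  proof (cases "ennreal (grid n k) \<le> t")
    case True
    have [measurable]: "X (grid n k) \<in> borel_measurable ?F"
      by (rule measurable_filtration_mono[OF adapted True]) simp_all
    show ?thesis using True by simp
  qed simp
  then have "(\<Union>k. {\<omega> \<in> space ?F. ennreal (grid n k) \<le> t \<and> c < \<kappa> (X (grid n k) \<omega>)}) \<in> sets ?F"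
    by (intro sets.countable_UN image_subsetI)
  moreover have "{\<omega> \<in> space ?F. grid_entry n \<omega> \<le> t} = (if t = \<infinity> then space ?F
      else (\<Union>k. {\<omega> \<in> space ?F. ennreal (grid n k) \<le> t \<and> c < \<kappa> (X (grid n k) \<omega>)}))"
    by (auto simp: iff)
  ultimately have "{\<omega> \<in> space ?F. grid_entry n \<omega> \<le> t} \<in> sets ?F"
    by (cases "t = \<infinity>") (simp_all only: if_True if_False simp_thms sets.top)
  then show "Measurable.pred ?F (\<lambda>\<omega>. grid_entry n \<omega> \<le> t)"
    by (simp only: pred_def)
qed

lemma gain_beyond_grid_entry_ge:
  "r * (\<integral>z. grid_excess n z \<partial>\<B> x) \<le> gain_beyond (grid_entry n) x"
proof -
  have [measurable]: "grid_entry n \<in> borel_measurable (P x)"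
    by (rule measurable_stopping[OF stopping_time_grid_entry])
  have "gain_beyond (grid_entry n) x = (\<integral>z. of_bool (\<exists>K. after (exceeded n) n K z) * gain z \<partial>\<B> x)"
    unfolding gain_beyond_def
  proof (rule integral_cong_AE)
    show "(\<lambda>z. of_bool (grid_entry n (fst z) < ennreal (snd z)) * gain z) \<in> borel_measurable (\<B> x)"
      unfolding of_bool_def by measurable
    show "(\<lambda>z. of_bool (\<exists>K. after (exceeded n) n K z) * gain z) \<in> borel_measurable (\<B> x)"
      using measurable_after(2)[where C = "exceeded n" and n = n and x = x, OF exceeded_adapted]
      unfolding of_bool_def by measurable
    show "AE z in \<B> x. of_bool (grid_entry n (fst z) < ennreal (snd z)) * gain z =
        of_bool (\<exists>K. after (exceeded n) n K z) * gain z"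
      using AE_time_pos[of x] by eventually_elim (simp add: grid_entry_less_iff[of _ x])
  qed
  then show ?thesis using gain_after_exceeded_ge by simp
qed

theorem stopping_value_eq: "stopping_value P X r g x c = resolvent P X r g x - excess_value x"
proof (rule antisym)
  let ?S = "{\<tau>. stopping_time (natural_filtration (space (P 0)) X) \<tau>}"
  let ?J = "\<lambda>\<tau>. \<integral>\<omega>. running_cost g r X (\<tau> \<omega>) \<omega> + c * discount r (\<tau> \<omega>) \<partial>P x"
  have J: "?J \<tau> = resolvent P X r g x - 1 / r * gain_beyond \<tau> x" if "\<tau> \<in> ?S" for \<tau>
  proof -
    have "stopping_time (natural_filtration (space (P 0)) X) \<tau>" using that by simp
    then show ?thesis by (rule expected_cost[OF measurable_stopping])
  qed
  have INF_eq: "stopping_value P X r g x c = (INF \<tau>\<in>?S. ?J \<tau>)"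
    unfolding stopping_value_def space_P[of x] by (rule refl)
  have lower: "resolvent P X r g x - excess_value x \<le> ?J \<tau>" if "\<tau> \<in> ?S" for \<tau>
    unfolding J[OF that] using gain_beyond_le[of \<tau> x] that r by (simp add: field_simps)
  show "resolvent P X r g x - excess_value x \<le> stopping_value P X r g x c"
    unfolding INF_eq
  proof (rule cINF_greatest)
    show "?S \<noteq> {}" using stopping_time_grid_entry by blast
  qed (rule lower)
  obtain e where e: "e \<longlonglongrightarrow> excess_value x" "\<And>n. e n \<le> (\<integral>z. grid_excess n z \<partial>\<B> x)"
    using grid_excess_lower[of x] by blast
  have "stopping_value P X r g x c \<le> resolvent P X r g x - e n" for n
  proof -
    have "stopping_value P X r g x c \<le> ?J (grid_entry n)"
      unfolding INF_eq
    proof (rule cINF_lower)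
      show "bdd_below (?J ` ?S)" by (rule bdd_belowI2[OF lower])
    qed (simp add: stopping_time_grid_entry)
    also have "\<dots> \<le> resolvent P X r g x - e n"
    proof -
      have "r * e n \<le> gain_beyond (grid_entry n) x"
        using mult_left_mono[OF e(2)[of n], of r] gain_beyond_grid_entry_ge[where n = n and x = x] r by linarith
      moreover have "grid_entry n \<in> ?S" using stopping_time_grid_entry by simp
      ultimately show ?thesis unfolding J[OF \<open>grid_entry n \<in> ?S\<close>] using r by (simp add: field_simps)
    qed
    finally show ?thesis .
  qed
  then have "\<exists>N. \<forall>n\<ge>N. stopping_value P X r g x c \<le> resolvent P X r g x - e n" by blast
  moreover have "(\<lambda>n. resolvent P X r g x - e n) \<longlonglongrightarrow> resolvent P X r g x - excess_value x"
    by (intro tendsto_diff tendsto_const e)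
  ultimately show "stopping_value P X r g x c \<le> resolvent P X r g x - excess_value x"
    by (rule LIMSEQ_le_const[rotated])
qed

lemma integral_running_excess:
  "(\<integral>\<omega>. (LBINT t:{0..}. (SUP u\<in>{0..t}. max (\<kappa> (X u \<omega>) - c) 0) * (r * exp (- r * t))) \<partial>P x) =
    excess_value x"
proof -
  have "(LBINT t:{0..}. (SUP u\<in>{0..t}. max (\<kappa> (X u \<omega>) - c) 0) * (r * exp (- r * t))) =
      (\<integral>t. excess (maximum (\<omega>, t)) \<partial>exp_law r)" if \<omega>: "\<omega> \<in> space (P x)" for \<omega>
  proof -
    have [measurable]: "(\<lambda>t. maximum (\<omega>, t)) \<in> borel_measurable borel"
      by (rule measurable_section[OF _ \<omega>]) measurable
    have "excess (maximum (\<omega>, t)) = (SUP u\<in>{0..t}. max (\<kappa> (X u \<omega>) - c) 0)" if "0 \<le> t" for t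
      unfolding maximum_eq[OF \<omega> that] running_sup_def
      using that by (subst cont_mono_Sup[OF mono_excess continuous_excess])
        (auto simp: cadlag_bdd_above[OF cadlag_X[OF \<omega>]] image_image excess_def)
    then show ?thesis
      by (subst integral_exp_law)
        (auto simp: set_lebesgue_integral_def indicator_def intro!: Bochner_Integration.integral_cong)
  qed
  then have "(\<integral>\<omega>. (LBINT t:{0..}. (SUP u\<in>{0..t}. max (\<kappa> (X u \<omega>) - c) 0) * (r * exp (- r * t))) \<partial>P x) =
      (\<integral>\<omega>. \<integral>t. excess (maximum (\<omega>, t)) \<partial>exp_law r \<partial>P x)"
    by (intro Bochner_Integration.integral_cong) auto
  then show ?thesis
    using B.integral_fst'[OF integrable_excess_maximum[of x]] integral_excess_maximum[of x] by simp
qed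

end

section \<open>Independent exponential times\<close>

lemma indep_rv_compose:
  assumes M: "prob_space M" and indep: "indep_rv M N Y N' Z"
    and f: "f \<in> measurable N K" and h: "h \<in> measurable N' K'"
  shows "indep_rv M K (\<lambda>\<omega>. f (Y \<omega>)) K' (\<lambda>\<omega>. h (Z \<omega>))"
proof -
  interpret prob_space M by fact
  have Y: "Y \<in> measurable M N" and Z: "Z \<in> measurable M N'"
    and I: "indep_set {Y -` A \<inter> space M |A. A \<in> sets N} {Z -` B \<inter> space M |B. B \<in> sets N'}"
    using indep by (auto simp: indep_rv_def)
  have fY: "(\<lambda>\<omega>. f (Y \<omega>)) -` A \<inter> space M = Y -` (f -` A \<inter> space N) \<inter> space M" for A
    using measurable_space[OF Y] by auto
  have hZ: "(\<lambda>\<omega>. h (Z \<omega>)) -` A \<inter> space M = Z -` (h -` A \<inter> space N') \<inter> space M" for A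
    using measurable_space[OF Z] by auto
  have fY': "(\<lambda>\<omega>. f (Y \<omega>)) \<in> measurable M K" and hZ': "(\<lambda>\<omega>. h (Z \<omega>)) \<in> measurable M K'"
    using measurable_compose[OF Y f] measurable_compose[OF Z h] by auto
  have "indep_set {(\<lambda>\<omega>. f (Y \<omega>)) -` A \<inter> space M |A. A \<in> sets K} {(\<lambda>\<omega>. h (Z \<omega>)) -` B \<inter> space M |B. B \<in> sets K'}"
  proof (rule indep_setI)
    fix a b
    assume "a \<in> {(\<lambda>\<omega>. f (Y \<omega>)) -` A \<inter> space M |A. A \<in> sets K}"
      and "b \<in> {(\<lambda>\<omega>. h (Z \<omega>)) -` B \<inter> space M |B. B \<in> sets K'}"
    then show "prob (a \<inter> b) = prob a * prob b"
      unfolding fY hZ using measurable_sets[OF f] measurable_sets[OF h]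
      by (intro indep_setD[OF I]) blast+
  qed (use measurable_sets[OF fY'] measurable_sets[OF hZ'] in blast)+
  then show ?thesis using fY' hZ' by (simp add: indep_rv_def)
qed

lemma distr_path_exponential_time:
  assumes M: "prob_space M" and T: "exponential_time M r T"
    and indep: "indep_rv M (path_space {0..}) (path {0..} Y) borel T"
  shows "distr M (path_space {0..} \<Otimes>\<^sub>M borel) (\<lambda>\<omega>. (path {0..} Y \<omega>, T \<omega>)) = path_law M Y \<Otimes>\<^sub>M exp_law r"
proof -
  have "distr M borel T = distr M lborel T" by (rule distr_cong) simp_all
  also have "\<dots> = exp_law r"
    using T by (simp add: exponential_time_def exp_law_def distributed_distr_eq_density)
  finally show ?thesis using distr_pair_indep[OF M indep] by simp
qed

context levy_exp
begin

lemma path_law_exp_law: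
  "path_law (P x) X \<Otimes>\<^sub>M exp_law r =
    distr (\<B> x) (path_space {0..} \<Otimes>\<^sub>M borel) (\<lambda>z. (path {0..} X (fst z), snd z))"
proof -
  have "path_law (P x) X \<Otimes>\<^sub>M distr (exp_law r) borel (\<lambda>t. t) =
      distr (\<B> x) (path_space {0..} \<Otimes>\<^sub>M borel) (\<lambda>(\<omega>, t). (path {0..} X \<omega>, t))"
    by (rule pair_measure_distr)
      (simp_all add: prob_space_imp_sigma_finite E.prob_space_distr)
  moreover have "distr (exp_law r) borel (\<lambda>t. t) = exp_law r"
    by (rule distr_id2) simp
  ultimately show ?thesis by (simp add: split_beta')
qed

lemma measurable_coordinate:
  "0 \<le> u \<Longrightarrow> (\<lambda>y. fst y u) \<in> borel_measurable (path_space {0..} \<Otimes>\<^sub>M borel)" for u :: real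
  by (intro measurable_compose[OF measurable_fst measurable_component_singleton]) auto

lemma integral_depth_law:
  fixes f :: "real \<Rightarrow> real"
  assumes f [measurable]: "f \<in> borel_measurable borel"
  shows "(\<integral>d. f d \<partial>depth_law) = (\<integral>y. f (path_sup (\<lambda>s. - fst y s) (snd y)) \<partial>(path_law (P 0) X \<Otimes>\<^sub>M exp_law r))"
proof -
  have meas: "(\<lambda>y. path_sup (\<lambda>s. - fst y s) (snd y)) \<in> borel_measurable (path_space {0..} \<Otimes>\<^sub>M borel)"
    by (intro measurable_path_sup borel_measurable_uminus measurable_coordinate measurable_snd)
  have pathz: "(\<lambda>z. (path {0..} X (fst z), snd z)) \<in> measurable (\<B> 0) (path_space {0..} \<Otimes>\<^sub>M borel)"
    by measurable
  have "AE z in \<B> 0. X 0 (fst z) = 0"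
  proof (rule B.AE_pair_measure)
    show "{z \<in> space (\<B> 0). X 0 (fst z) = 0} \<in> sets (\<B> 0)"
      using measurable_X_fst[of 0 0] by measurable
    show "AE \<omega> in P 0. AE t in exp_law r. X 0 (fst (\<omega>, t)) = 0"
      using start[of 0] by simp
  qed
  then have AE: "AE z in \<B> 0. f (path_sup (\<lambda>s. X 0 (fst z) - X s (fst z)) (snd z)) =
      f (path_sup (\<lambda>s. - path {0..} X (fst z) s) (snd z))"
    by eventually_elim (simp add: path_sup_def grid_max_def path_def)
  have "(\<integral>d. f d \<partial>depth_law) = (\<integral>z. f (path_sup (\<lambda>s. X 0 (fst z) - X s (fst z)) (snd z)) \<partial>\<B> 0)"
    unfolding depth_law_def by (rule integral_distr) measurable
  also have "\<dots> = (\<integral>z. f (path_sup (\<lambda>s. - path {0..} X (fst z) s) (snd z)) \<partial>\<B> 0)"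
  proof (rule integral_cong_AE[OF _ _ AE])
    show "(\<lambda>z. f (path_sup (\<lambda>s. X 0 (fst z) - X s (fst z)) (snd z))) \<in> borel_measurable (\<B> 0)"
      by measurable
    show "(\<lambda>z. f (path_sup (\<lambda>s. - path {0..} X (fst z) s) (snd z))) \<in> borel_measurable (\<B> 0)"
      using measurable_compose[OF pathz measurable_compose[OF meas f]] by simp
  qed
  also have "\<dots> = (\<integral>y. f (path_sup (\<lambda>s. - fst y s) (snd y)) \<partial>(path_law (P 0) X \<Otimes>\<^sub>M exp_law r))"
    unfolding path_law_exp_law using measurable_compose[OF meas f] by (subst integral_distr[OF pathz]) simp_all
  finally show ?thesis .
qed

end

context stopping_problem
begin

text \<open>
  The infimum of \<open>X'\<close> is minus the supremum of \<open>- X'\<close>, and only the joint law of the path and the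
  exponential time enters; that law is the same for \<open>X'\<close> and \<open>X\<close>.
\<close>

lemma kappa_eq:
  assumes cadlag: "\<And>\<omega>. \<omega> \<in> space (P 0) \<Longrightarrow> cadlag (\<lambda>t. X' t \<omega>)"
    and law: "path_law (P 0) X' = path_law (P 0) X"
    and T': "exponential_time (P 0) r T'"
    and indep: "indep_rv (P 0) (path_space {0..}) (path {0..} X') borel T'"
  shows "kappa P X' T' r g = \<kappa>"
proof
  fix y
  have T'0: "0 \<le> T' \<omega>" if "\<omega> \<in> space (P 0)" for \<omega>
    using T' that by (simp add: exponential_time_def)
  have meas: "(\<lambda>z. path_sup (\<lambda>s. - fst z s) (snd z)) \<in> borel_measurable (path_space {0..} \<Otimes>\<^sub>M borel)"
    by (intro measurable_path_sup borel_measurable_uminus measurable_coordinate measurable_snd)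
  have pathT: "(\<lambda>\<omega>. (path {0..} X' \<omega>, T' \<omega>)) \<in> measurable (P 0) (path_space {0..} \<Otimes>\<^sub>M borel)"
    using indep by (auto simp: indep_rv_def)
  have "running_inf X' (T' \<omega>) \<omega> = - path_sup (\<lambda>s. - path {0..} X' \<omega> s) (T' \<omega>)" if \<omega>: "\<omega> \<in> space (P 0)" for \<omega>
  proof -
    have "path_sup (\<lambda>s. - path {0..} X' \<omega> s) (T' \<omega>) = path_sup (\<lambda>s. - X' s \<omega>) (T' \<omega>)"
      by (simp add: path_sup_def grid_max_def path_def)
    then show ?thesis
      by (simp add: running_inf_def Inf_real_def image_image
          path_sup_cadlag[OF cadlag_minus[OF cadlag[OF \<omega>]] T'0[OF \<omega>]])
  qed
  then have "(\<integral>\<omega>. g (y + running_inf X' (T' \<omega>) \<omega>) \<partial>P 0) =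
      (\<integral>\<omega>. g (y - path_sup (\<lambda>s. - path {0..} X' \<omega> s) (T' \<omega>)) \<partial>P 0)"
    by (intro Bochner_Integration.integral_cong) simp_all
  also have "\<dots> = (\<integral>z. g (y - path_sup (\<lambda>s. - fst z s) (snd z)) \<partial>(path_law (P 0) X' \<Otimes>\<^sub>M exp_law r))"
    unfolding distr_path_exponential_time[OF prob_space_axioms T' indep, symmetric]
    using meas by (subst integral_distr[OF pathT]) simp_all
  also have "\<dots> = (\<integral>d. g (y - d) \<partial>depth_law)"
    unfolding law by (rule integral_depth_law[symmetric]) measurable
  finally show "kappa P X' T' r g y = \<kappa> y" by (simp add: kappa_def \<kappa>_def)
qed

lemma expectation_exponential_time:
  fixes f :: "real \<times> real \<Rightarrow> real"
  assumes f [measurable]: "f \<in> borel_measurable (borel \<Otimes>\<^sub>M borel)"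
    and T: "exponential_time (P x) r T"
    and indep: "indep_rv (P x) (path_space {0..}) (path {0..} X) borel T"
  shows "(\<integral>\<omega>. f (running_sup X (T \<omega>) \<omega>, X (T \<omega>) \<omega>) \<partial>P x) = (\<integral>z. f (maximum z, position z) \<partial>\<B> x)"
proof -
  let ?\<Psi> = "\<lambda>y. f (path_sup (fst y) (snd y), path_val (fst y) (snd y))"
  have T0: "0 \<le> T \<omega>" if "\<omega> \<in> space (P x)" for \<omega>
    using T that by (simp add: exponential_time_def)
  have meas: "?\<Psi> \<in> borel_measurable (path_space {0..} \<Otimes>\<^sub>M borel)"
    by (intro measurable_compose[OF measurable_Pair f] measurable_path_sup measurable_path_val
        measurable_coordinate measurable_snd)
  have pathT: "(\<lambda>\<omega>. (path {0..} X \<omega>, T \<omega>)) \<in> measurable (P x) (path_space {0..} \<Otimes>\<^sub>M borel)"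
    using indep by (auto simp: indep_rv_def)
  have pathz: "(\<lambda>z. (path {0..} X (fst z), snd z)) \<in> measurable (\<B> x) (path_space {0..} \<Otimes>\<^sub>M borel)"
    by measurable
  have "(\<integral>\<omega>. f (running_sup X (T \<omega>) \<omega>, X (T \<omega>) \<omega>) \<partial>P x) = (\<integral>\<omega>. ?\<Psi> (path {0..} X \<omega>, T \<omega>) \<partial>P x)"
    by (intro Bochner_Integration.integral_cong refl)
      (simp add: path_sup_path path_val_path path_sup_cadlag path_val_cadlag cadlag_X T0 running_sup_def)
  also have "\<dots> = (\<integral>y. ?\<Psi> y \<partial>(path_law (P x) X \<Otimes>\<^sub>M exp_law r))"
    unfolding distr_path_exponential_time[OF prob_space_axioms T indep, symmetric]
    by (rule integral_distr[OF pathT meas, symmetric])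
  also have "\<dots> = (\<integral>z. f (maximum z, position z) \<partial>\<B> x)"
    unfolding path_law_exp_law using integral_distr[OF pathz meas]
    by (simp add: path_sup_path path_val_path maximum_def position_def)
  finally show ?thesis .
qed

end

theorem corollary13:
  fixes P :: "real \<Rightarrow> 'a measure"
    and X X' :: "real \<Rightarrow> 'a \<Rightarrow> real"
    and T T' :: "'a \<Rightarrow> real"
    and g :: "real \<Rightarrow> real"
    and r x c :: real
  assumes "levy_family P X"
    and "r > 0"
    and "\<And>y. independent_copy (P y) X X'"
    and "\<And>y. independent_exponential_times (P y) r X X' T T'"
    and "continuous_on UNIV g"
    and "mono g"
    and "\<And>y. resolvent_finite P X r g y"
  shows "let \<kappa> = kappa P X' T' r g;
             middle = 1 / r * (\<integral>\<omega>. (g (X (T \<omega>) \<omega>) - r * c) *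
               indicator {\<omega>. threshold \<kappa> c \<le> ereal (running_sup X (T \<omega>) \<omega>)} \<omega> \<partial>P x)
         in resolvent P X r g x - stopping_value P X r g x c = middle \<and>
            middle = (\<integral>\<omega>. (LBINT t:{0..}.
              (SUP u\<in>{0..t}. max (\<kappa> (X u \<omega>) - c) 0) * (r * exp (- r * t))) \<partial>P x)"
proof -
  interpret stopping_problem P X r g c
    by unfold_locales fact+
  have T: "exponential_time (P y) r T" and T': "exponential_time (P y) r T'"
    and indep: "indep_rv (P y) (path_space {0..} \<Otimes>\<^sub>M path_space {0..})
      (\<lambda>\<omega>. (path {0..} X \<omega>, path {0..} X' \<omega>)) (borel \<Otimes>\<^sub>M borel) (\<lambda>\<omega>. (T \<omega>, T' \<omega>))" for y
    using assms(4)[of y] by (auto simp: independent_exponential_times_def)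
  have XT: "indep_rv (P x) (path_space {0..}) (path {0..} X) borel T"
    using indep_rv_compose[OF prob_space_axioms indep measurable_fst measurable_fst] by simp
  have XT': "indep_rv (P 0) (path_space {0..}) (path {0..} X') borel T'"
    using indep_rv_compose[OF prob_space_axioms indep measurable_snd measurable_snd] by simp
  have kappa: "kappa P X' T' r g = \<kappa>"
    using assms(3)[of 0] by (intro kappa_eq T' XT') (auto simp: independent_copy_def)
  have "(\<integral>\<omega>. (g (X (T \<omega>) \<omega>) - r * c) *
      indicator {\<omega>. threshold \<kappa> c \<le> ereal (running_sup X (T \<omega>) \<omega>)} \<omega> \<partial>P x) =
    (\<integral>\<omega>. (\<lambda>(m, p). (g p - r * c) * (if c \<le> \<kappa> m then 1 else 0))
      (running_sup X (T \<omega>) \<omega>, X (T \<omega>) \<omega>) \<partial>P x)"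
    by (intro Bochner_Integration.integral_cong refl) (auto simp: threshold_kappa indicator_def)
  also have "\<dots> = (\<integral>z. (\<lambda>(m, p). (g p - r * c) * (if c \<le> \<kappa> m then 1 else 0)) (maximum z, position z) \<partial>\<B> x)"
    by (rule expectation_exponential_time[OF _ T XT]) (unfold split_beta', measurable)
  also have "\<dots> = (\<integral>y. (\<lambda>(m, p). (g p - r * c) * (if c \<le> \<kappa> m then 1 else 0))
      (x + fst y, x + fst y - snd y) \<partial>(sup_law \<Otimes>\<^sub>M depth_law))"
    by (rule transfer_start(2)[symmetric]) (unfold split_beta', measurable)
  also have "\<dots> = r * excess_value x"
    using middle_excess[of x] by simp
  finally have middle: "1 / r * (\<integral>\<omega>. (g (X (T \<omega>) \<omega>) - r * c) *
      indicator {\<omega>. threshold \<kappa> c \<le> ereal (running_sup X (T \<omega>) \<omega>)} \<omega> \<partial>P x) = excess_value x"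
    using assms(2) by simp
  show ?thesis
    unfolding Let_def kappa middle integral_running_excess stopping_value_eq by simp
qed

end
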